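(* Let $\Omega\subset\mathbb{R}^2$ be a planar convex body, $p\in[1,+\infty)$ and $c\in[0,|\Omega|]$. If $\omega^*$ is a solution of the problem $$\inf\left\{\left(\int_{\mathbb{S}^{1}}|h_\Omega-h_\omega|^p\,d\mathcal{H}^{1}\right)^{1/p}\ \Big|\ \omega\subset\Omega\ \text{is convex and}\ |\omega|=c\right\},$$ then the free part of its boundary, i.e. $\partial\omega^*\setminus\partial\Omega$, is the union of polygonal lines. In particular, if $\Omega$ is a polygon, then $\omega^*$ is also a polygon.
   Context: A convex body is a compact convex set; the container $\Omega$ has non-empty interior. The competitors $\omega$ are non-empty compact convex sets (possibly with empty interior when $c=0$, in which case "polygon" is understood to allow degenerate polygons). $|\cdot|$ denotes area, $\mathbb{S}^1$ the unit circle, $\mathcal{H}^1$ the one-dimensional Hausdorff measure on it. The support function of a convex set $K\subset\mathbb{R}^2$ is $h_K:\mathbb{S}^1\to\mathbb{R}$, $h_K(\theta)=\sup\{\langle\theta,y\rangle\ |\ y\in K\}$. *)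

theory Defs
  imports "HOL-Analysis.Analysis"
begin

definition convex_body :: "(real^2) set \<Rightarrow> bool" where
  "convex_body K \<longleftrightarrow> compact K \<and> convex K \<and> K \<noteq> {}"

definition area :: "(real^2) set \<Rightarrow> real" where
  "area K = measure lebesgue K"

definition support_function :: "(real^2) set \<Rightarrow> real^2 \<Rightarrow> real" where
  "support_function K \<theta> = (SUP y\<in>K. \<theta> \<bullet> y)"

text \<open>One-dimensional Hausdorff (outer) measure, normalised so that it is length on curves.
  Coverings are restricted to bounded sets because \<^const>\<open>diameter\<close> is real-valued
  and carries no information on unbounded sets.\<close>

definition hausdorff1_pre :: "real \<Rightarrow> 'a::metric_space set \<Rightarrow> ennreal" where
  "hausdorff1_pre \<delta> A =
     (INF U \<in> {U :: nat \<Rightarrow> 'a set. A \<subseteq> (\<Union>i. U i) \<and> (\<forall>i. bounded (U i) \<and> diameter (U i) \<le> \<delta>)}.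
        \<Sum>i. ennreal (diameter (U i)))"

definition hausdorff1 :: "'a::metric_space set \<Rightarrow> ennreal" where
  "hausdorff1 A = (SUP \<delta>\<in>{0<..}. hausdorff1_pre \<delta> A)"

abbreviation unit_circle :: "(real^2) set" where
  "unit_circle \<equiv> sphere 0 1"

definition circle_measure :: "(real^2) measure" where
  "circle_measure = measure_of unit_circle (sets (restrict_space borel unit_circle)) hausdorff1"

definition support_dist :: "real \<Rightarrow> (real^2) set \<Rightarrow> (real^2) set \<Rightarrow> real" where
  "support_dist p K L =
     (\<integral>\<theta>. \<bar>support_function K \<theta> - support_function L \<theta>\<bar> powr p \<partial>circle_measure) powr (1 / p)"

definition admissible :: "(real^2) set \<Rightarrow> real \<Rightarrow> (real^2) set set" where
  "admissible \<Omega> c = {\<omega>. convex_body \<omega> \<and> \<omega> \<subseteq> \<Omega> \<and> area \<omega> = c}"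

definition is_solution :: "(real^2) set \<Rightarrow> real \<Rightarrow> real \<Rightarrow> (real^2) set \<Rightarrow> bool" where
  "is_solution \<Omega> p c \<omega> \<longleftrightarrow>
     \<omega> \<in> admissible \<Omega> c \<and> (\<forall>\<omega>'\<in>admissible \<Omega> c. support_dist p \<Omega> \<omega> \<le> support_dist p \<Omega> \<omega>')"

text \<open>A polygonal line is a finite chain of at least one segment; degenerate segments are
  excluded, since otherwise a single point would count and every set would be a union of
  polygonal lines.\<close>

definition polygonal_line :: "(real^2) set \<Rightarrow> bool" where
  "polygonal_line S \<longleftrightarrow>
     (\<exists>xs. 2 \<le> length xs \<and> (\<forall>i. Suc i < length xs \<longrightarrow> xs ! i \<noteq> xs ! Suc i) \<and>
        S = (\<Union>i<length xs - 1. closed_segment (xs ! i) (xs ! Suc i)))"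

text \<open>The free part of a boundary is in general not closed: it may lack the points where it
  meets the boundary of the container, and vertices may accumulate there. Hence the union need
  not be finite, but it is required to be locally finite in \<open>S\<close>, so that vertices cannot
  accumulate at a point of \<open>S\<close>.\<close>

definition union_of_polygonal_lines :: "(real^2) set \<Rightarrow> bool" where
  "union_of_polygonal_lines S \<longleftrightarrow>
     (\<exists>\<P>. (\<forall>P\<in>\<P>. polygonal_line P) \<and> locally_finite_in (top_of_set S) \<P> \<and> \<Union>\<P> = S)"

text \<open>A convex polygon, possibly degenerate (segment or point), is the convex hull of a
  non-empty finite set of points.\<close>

definition convex_polygon :: "(real^2) set \<Rightarrow> bool" where
  "convex_polygon K \<longleftrightarrow> polytope K \<and> K \<noteq> {}"

text \<open>As \<^const>\<open>measure_of\<close> yields the null measure when the given set function is not a measure,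
  the remainder checks that \<^const>\<open>circle_measure\<close> is arc length on the circle.\<close>

definition circle_point :: "real \<Rightarrow> real^2" where
  "circle_point t = vector [cos t, sin t]"

lemma dist_circle_point: "dist (circle_point s) (circle_point t) = 2 * \<bar>sin ((s - t) / 2)\<bar>"
proof -
  have "cos (s - t) = 1 - 2 * (sin ((s - t) / 2))\<^sup>2"
    by (metis cos_double_sin field_sum_of_halves mult_2)
  hence "(cos s - cos t)\<^sup>2 + (sin s - sin t)\<^sup>2 = (2 * \<bar>sin ((s - t) / 2)\<bar>)\<^sup>2"
    using sin_cos_squared_add[of s] sin_cos_squared_add[of t]
    by (simp add: power2_eq_square algebra_simps cos_diff)
  moreover have "dist (circle_point s) (circle_point t) = sqrt ((cos s - cos t)\<^sup>2 + (sin s - sin t)\<^sup>2)"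
    by (simp add: dist_norm norm_vec_def L2_set_def sum_2 circle_point_def)
  ultimately show ?thesis by (simp only: real_sqrt_abs abs_mult abs_idempotent abs_numeral)
qed

lemma circle_point_in: "circle_point t \<in> unit_circle"
  by (simp add: circle_point_def norm_vec_def L2_set_def sum_2)

lemma circle_point_onto:
  assumes "x \<in> unit_circle"
  obtains t where "t \<in> {0..<2*pi}" "x = circle_point t"
proof -
  have "(x $ 1)\<^sup>2 + (x $ 2)\<^sup>2 = 1"
    using assms by (simp add: norm_vec_def L2_set_def sum_2)
  then obtain t where "0 \<le> t" "t < 2*pi" "x $ 1 = cos t" "x $ 2 = sin t"
    by (rule sincos_total_2pi)
  thus ?thesis
    by (intro that[of t]) (auto simp: circle_point_def vec_eq_iff forall_2)
qed

lemma circle_point_period: "circle_point (t + 2 * pi) = circle_point t"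
  "circle_point (t - 2 * pi) = circle_point t"
  by (auto simp: circle_point_def cos_diff sin_diff)

lemma continuous_circle_point: "continuous_on UNIV circle_point"
proof -
  have *: "circle_point = (\<lambda>t. cos t *\<^sub>R axis 1 1 + sin t *\<^sub>R axis 2 1)"
    by (auto simp: fun_eq_iff circle_point_def vec_eq_iff forall_2 axis_def)
  show ?thesis unfolding * by (intro continuous_intros)
qed

lemma measurable_circle_point: "circle_point \<in> borel_measurable borel"
  by (rule borel_measurable_continuous_onI[OF continuous_circle_point])

lemma arc_cover:
  fixes U :: "(real^2) set"
  assumes "bounded U" "diameter U \<le> 1"
  obtains W where "W \<in> sets borel" "{t \<in> {0..<2*pi}. circle_point t \<in> U} \<subseteq> W"
    "emeasure lborel W \<le> ennreal (2 * arcsin (diameter U / 2))"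
proof (cases "\<exists>t. circle_point t \<in> U")
  case False
  thus ?thesis by (intro that[of "{}"]) auto
next
  case True
  define a where "a = 2 * arcsin (diameter U / 2)"
  have d0: "0 \<le> diameter U" using assms by (rule_tac diameter_ge_0)
  have a0: "0 \<le> a" unfolding a_def using d0 assms by (simp add: arcsin_nonneg arcsin_bounded)
  have "arcsin (diameter U / 2) \<le> arcsin (1/2)"
    using d0 assms by (intro arcsin_le_arcsin) auto
  hence a1: "a \<le> pi / 3"
    unfolding a_def using arcsin_sin[of "pi/6"] sin_30 by simp
  obtain t0 where t0: "t0 \<in> {0..<2*pi}" "circle_point t0 \<in> U"
    using True circle_point_onto circle_point_in by metis
  define T where "T = {t. \<bar>t - t0\<bar> \<le> pi \<and> circle_point t \<in> U}"
  have close: "\<bar>s - t\<bar> \<le> a" if "circle_point s \<in> U" "circle_point t \<in> U" "\<bar>s - t\<bar> \<le> pi" for s t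
  proof -
    have "2 * \<bar>sin ((s - t) / 2)\<bar> \<le> diameter U"
      using diameter_bounded_bound[OF assms(1) that(1,2)] by (simp add: dist_circle_point)
    moreover have "\<bar>sin ((s - t) / 2)\<bar> = sin (\<bar>s - t\<bar> / 2)"
    proof -
      have "0 \<le> sin (\<bar>s - t\<bar> / 2)" using that(3) by (intro sin_ge_zero) auto
      thus ?thesis 
        using sin_minus[of "(s - t) / 2"] by (cases "s \<le> t") (auto simp: minus_divide_left simp del: sin_minus)
    qed
    ultimately have "sin (\<bar>s - t\<bar> / 2) \<le> diameter U / 2" by simp
    hence "\<bar>s - t\<bar> / 2 \<le> arcsin (diameter U / 2)"
      using that(3) d0 assms(2) by (subst le_arcsin_iff) (auto intro: order_trans[of _ 0])
    thus ?thesis by (simp add: a_def)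
  qed
  have t0T: "t0 \<in> T" using t0 by (auto simp: T_def)
  have Tt0: "\<bar>t - t0\<bar> \<le> a" if "t \<in> T" for t
    using close[of t t0] that t0 by (auto simp: T_def)
  have TT: "\<bar>s - t\<bar> \<le> a" if "s \<in> T" "t \<in> T" for s t
    using Tt0[OF that(1)] Tt0[OF that(2)] a1 pi_gt_zero that by (intro close) (auto simp: T_def)
  define m where "m = Inf T"
  have bb: "bdd_below T" using Tt0 by (intro bdd_belowI[of _ "t0 - a"]) (force simp: abs_le_iff)
  have Tm: "t \<in> {m..m+a}" if "t \<in> T" for t
  proof -
    have "m \<le> t" unfolding m_def by (rule cInf_lower[OF that bb])
    moreover have "t - a \<le> m" unfolding m_def
      using TT[OF that] t0T by (intro cInf_greatest) (force simp: abs_le_iff)+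
    ultimately show ?thesis by auto
  qed
  have mlo: "-pi \<le> m" unfolding m_def
    using Tt0 t0T t0 a1 pi_gt_zero by (intro cInf_greatest) (force simp: abs_le_iff)+
  have mhi: "m < 2 * pi" using Tm[OF t0T] t0 by auto
  have cov: "t \<in> {m..m+a} \<or> t - 2*pi \<in> {m..m+a} \<or> t + 2*pi \<in> {m..m+a}"
    if "t \<in> {0..<2*pi}" "circle_point t \<in> U" for t
  proof -
    consider "\<bar>t - t0\<bar> \<le> pi" | "t - t0 > pi" | "t0 - t > pi" by linarith
    thus ?thesis
    proof cases
      case 1
      thus ?thesis using Tm[of t] that by (auto simp: T_def)
    next
      case 2
      hence "t - 2*pi \<in> T" using that t0 by (auto simp: T_def circle_point_period)
      thus ?thesis using Tm by blast
    next
      case 3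
      hence "t + 2*pi \<in> T" using that t0 by (auto simp: T_def circle_point_period)
      thus ?thesis using Tm by blast
    qed
  qed
  define T' where "T' = {t \<in> {0..<2*pi}. circle_point t \<in> U}"
  have "\<exists>W \<in> sets borel. T' \<subseteq> W \<and> emeasure lborel W \<le> ennreal a"
  proof -
    consider "m < 0" "m + a < 0" | "m < 0" "m + a \<ge> 0" | "m \<ge> 0" "m + a < 2*pi" | "m \<ge> 0" "m + a \<ge> 2*pi"
      by linarith
    thus ?thesis
    proof cases
      case 1
      let ?W = "{m + 2*pi..m+2*pi+a}"
      have em: "emeasure lborel ?W \<le> ennreal a" using a0 by simp
      have "T' \<subseteq> ?W"
      proof
        fix t assume "t \<in> T'"
        hence "0 \<le> t" "t < 2*pi" "t \<in> {m..m+a} \<or> t - 2*pi \<in> {m..m+a} \<or> t + 2*pi \<in> {m..m+a}"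
          using cov[of t] by (auto simp: T'_def)
        thus "t \<in> ?W" using 1 a0 a1 mlo mhi pi_gt_zero unfolding Un_iff atLeastAtMost_iff by (smt (verit))
      qed
      with em show ?thesis by (intro bexI[of _ ?W]) auto
    next
      case 2
      let ?W = "{0..m+a} \<union> {m+2*pi..2*pi}"
      have "emeasure lborel ({0..m+a} \<union> {m+2*pi..2*pi})
          \<le> emeasure lborel {0..m+a} + emeasure lborel {m+2*pi..2*pi}"
        by (rule emeasure_subadditive) auto
      also have "\<dots> = ennreal a" using 2 by (simp flip: ennreal_plus)
      finally have em: "emeasure lborel ?W \<le> ennreal a" by simp
      have "T' \<subseteq> ?W"
      proof
        fix t assume "t \<in> T'"
        hence "0 \<le> t" "t < 2*pi" "t \<in> {m..m+a} \<or> t - 2*pi \<in> {m..m+a} \<or> t + 2*pi \<in> {m..m+a}"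
          using cov[of t] by (auto simp: T'_def)
        thus "t \<in> ?W" using 2 a0 a1 mlo mhi pi_gt_zero unfolding Un_iff atLeastAtMost_iff by (smt (verit))
      qed
      with em show ?thesis by (intro bexI[of _ ?W]) auto
    next
      case 3
      let ?W = "{m..m+a}"
      have em: "emeasure lborel ?W \<le> ennreal a" using a0 by simp
      have "T' \<subseteq> ?W"
      proof
        fix t assume "t \<in> T'"
        hence "0 \<le> t" "t < 2*pi" "t \<in> {m..m+a} \<or> t - 2*pi \<in> {m..m+a} \<or> t + 2*pi \<in> {m..m+a}"
          using cov[of t] by (auto simp: T'_def)
        thus "t \<in> ?W" using 3 a0 a1 mlo mhi pi_gt_zero unfolding Un_iff atLeastAtMost_iff by (smt (verit))
      qed
      with em show ?thesis by (intro bexI[of _ ?W]) auto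
    next
      case 4
      let ?W = "{m..2*pi} \<union> {0..m+a-2*pi}"
      have "emeasure lborel ({m..2*pi} \<union> {0..m+a-2*pi})
          \<le> emeasure lborel {m..2*pi} + emeasure lborel {0..m+a-2*pi}"
        by (rule emeasure_subadditive) auto
      also have "\<dots> = ennreal a" using 4 mhi by (simp flip: ennreal_plus)
      finally have em: "emeasure lborel ?W \<le> ennreal a" by simp
      have "T' \<subseteq> ?W"
      proof
        fix t assume "t \<in> T'"
        hence "0 \<le> t" "t < 2*pi" "t \<in> {m..m+a} \<or> t - 2*pi \<in> {m..m+a} \<or> t + 2*pi \<in> {m..m+a}"
          using cov[of t] by (auto simp: T'_def)
        thus "t \<in> ?W" using 4 a0 a1 mlo mhi pi_gt_zero unfolding Un_iff atLeastAtMost_iff by (smt (verit))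
      qed
      with em show ?thesis by (intro bexI[of _ ?W]) auto
    qed
  qed
  thus ?thesis using that unfolding T'_def a_def by blast
qed

lemma arcsin_bound:
  assumes "0 \<le> d" "d \<le> \<delta>" "\<delta> \<le> 1"
  shows "sqrt (1 - (\<delta>/2)\<^sup>2) * (2 * arcsin (d / 2)) \<le> d"
proof -
  let ?x = "arcsin (d / 2)"
  have x: "0 \<le> ?x" "?x \<le> pi/2" using assms arcsin_ubound[of "d/2"] by (auto simp: arcsin_nonneg)
  have "sqrt (1 - (\<delta>/2)\<^sup>2) \<le> sqrt (1 - (d/2)\<^sup>2)"
    using assms by (simp add: power_mono power_divide)
  also have "\<dots> = cos ?x" using assms by (subst cos_arcsin) auto
  finally have 1: "sqrt (1 - (\<delta>/2)\<^sup>2) \<le> cos ?x" .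
  have "?x * cos ?x \<le> sin ?x"
  proof -
    have "\<exists>z. z \<ge> 0 \<and> z \<le> ?x \<and> sin ?x - sin 0 = (?x - 0) * cos z"
    proof (cases "?x = 0")
      case False
      hence "0 < ?x" using x by simp
      from MVT2[OF this, of sin cos] obtain z where "0 < z" "z < ?x" "sin ?x - sin 0 = (?x - 0) * cos z" by (auto intro: DERIV_sin)
      thus ?thesis by (intro exI[of _ z]) auto
    qed auto
    then obtain z where z: "z \<ge> 0" "z \<le> ?x" "sin ?x = ?x * cos z" by auto
    have "cos ?x \<le> cos z" using z x by (intro cos_monotone_0_pi_le) auto
    thus ?thesis using z x by (simp add: mult_left_mono)
  qed
  also have "sin ?x = d / 2" using assms by simp
  finally have 2: "?x * cos ?x \<le> d / 2" .
  have "sqrt (1 - (\<delta>/2)\<^sup>2) * ?x \<le> cos ?x * ?x" by (rule mult_right_mono[OF 1 x(1)])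
  with 2 show ?thesis by (simp add: algebra_simps)
qed

lemma hausdorff1_circle_lower:
  assumes "A \<subseteq> unit_circle" "{t \<in> {0..<2*pi}. circle_point t \<in> A} \<in> sets borel"
    "0 < \<delta>" "\<delta> \<le> 1"
  shows "ennreal (sqrt (1 - (\<delta>/2)\<^sup>2)) * emeasure lborel {t \<in> {0..<2*pi}. circle_point t \<in> A} \<le> hausdorff1_pre \<delta> A"
  unfolding hausdorff1_pre_def
proof (rule INF_greatest, clarify)
  let ?k = "sqrt (1 - (\<delta>/2)\<^sup>2)"
  fix U :: "nat \<Rightarrow> (real^2) set"
  assume U: "A \<subseteq> (\<Union>i. U i)" "\<forall>i. bounded (U i) \<and> diameter (U i) \<le> \<delta>"
  have "\<exists>W. \<forall>i. W i \<in> sets borel \<and> {t \<in> {0..<2*pi}. circle_point t \<in> U i} \<subseteq> W i \<and>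
    emeasure lborel (W i) \<le> ennreal (2 * arcsin (diameter (U i) / 2))"
  proof (intro choice allI)
    fix i
    have "bounded (U i)" "diameter (U i) \<le> 1" using U(2) assms(4) order_trans by blast+
    then obtain Z where "Z \<in> sets borel" "{t \<in> {0..<2*pi}. circle_point t \<in> U i} \<subseteq> Z"
      "emeasure lborel Z \<le> ennreal (2 * arcsin (diameter (U i) / 2))"
      by (rule arc_cover)
    thus "\<exists>Z. Z \<in> sets borel \<and> {t \<in> {0..<2*pi}. circle_point t \<in> U i} \<subseteq> Z \<and>
      emeasure lborel Z \<le> ennreal (2 * arcsin (diameter (U i) / 2))" by blast
  qed
  then obtain W where W: "\<And>i. W i \<in> sets borel" "\<And>i. {t \<in> {0..<2*pi}. circle_point t \<in> U i} \<subseteq> W i"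
    "\<And>i. emeasure lborel (W i) \<le> ennreal (2 * arcsin (diameter (U i) / 2))" by auto
  have k0: "0 \<le> ?k" using assms by (simp add: power_le_one)
  have "{t \<in> {0..<2*pi}. circle_point t \<in> A} \<subseteq> (\<Union>i. W i)"
  proof
    fix t assume t: "t \<in> {t \<in> {0..<2*pi}. circle_point t \<in> A}"
    then obtain i where "circle_point t \<in> U i" using U(1) by blast
    thus "t \<in> (\<Union>i. W i)" using W(2)[of i] t by blast
  qed
  hence "emeasure lborel {t \<in> {0..<2*pi}. circle_point t \<in> A} \<le> emeasure lborel (\<Union>i. W i)"
    using W(1) by (intro emeasure_mono) auto
  also have "\<dots> \<le> (\<Sum>i. emeasure lborel (W i))"
    using W(1) by (intro emeasure_subadditive_countably) auto
  finally have "ennreal ?k * emeasure lborel {t \<in> {0..<2*pi}. circle_point t \<in> A} \<le> ennreal ?k * (\<Sum>i. emeasure lborel (W i))"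
    by (intro mult_left_mono) auto
  also have "\<dots> = (\<Sum>i. ennreal ?k * emeasure lborel (W i))" by simp
  also have "\<dots> \<le> (\<Sum>i. ennreal (diameter (U i)))"
  proof (intro suminf_le allI)
    fix i
    have d0: "0 \<le> diameter (U i)" using U(2) by (simp add: diameter_ge_0)
    have "ennreal ?k * emeasure lborel (W i) \<le> ennreal ?k * ennreal (2 * arcsin (diameter (U i) / 2))"
      by (intro mult_left_mono W) auto
    also have "\<dots> = ennreal (?k * (2 * arcsin (diameter (U i) / 2)))"
      using k0 by (subst ennreal_mult') auto
    also have "\<dots> \<le> ennreal (diameter (U i))"
      using U(2) d0 assms by (intro ennreal_leI arcsin_bound) auto
    finally show "ennreal ?k * emeasure lborel (W i) \<le> ennreal (diameter (U i))" .
  qed auto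
  finally show "ennreal ?k * emeasure lborel {t \<in> {0..<2*pi}. circle_point t \<in> A} \<le> (\<Sum>i. ennreal (diameter (U i)))" .
qed

lemma hausdorff1_circle_upper:
  assumes "A \<subseteq> unit_circle" "{t \<in> {0..<2*pi}. circle_point t \<in> A} \<in> sets borel" "0 < \<delta>"
  shows "hausdorff1_pre \<delta> A \<le> emeasure lborel {t \<in> {0..<2*pi}. circle_point t \<in> A}"
proof (rule ennreal_le_epsilon)
  define T where "T = {t \<in> {0..<2*pi}. circle_point t \<in> A}"
  fix \<epsilon> :: real assume "\<epsilon> > 0"
  obtain G where G: "open G" "T \<subseteq> G" "emeasure lborel (G - T) < \<epsilon>"
    using outer_regular_lborel[of T \<epsilon>] assms(2) \<open>\<epsilon> > 0\<close> by (auto simp: T_def)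
  have Tb: "T \<in> sets borel" using assms(2) by (simp add: T_def)
  have "emeasure lborel G = emeasure lborel T + emeasure lborel (G - T)"
    using G Tb by (subst plus_emeasure) (auto simp: Un_absorb1)
  hence G4: "emeasure lborel G \<le> emeasure lborel T + \<epsilon>"
    using G(3) by (auto intro!: add_left_mono)
  define g where "g = (\<lambda>x. if x \<in> G then G \<inter> ball x (\<delta>/2) else ball x 1)"
  have "gauge g" using G(1) assms(3) by (auto simp: g_def gauge_def)
  moreover have "T \<subseteq> cbox 0 (2*pi)" by (auto simp: T_def)
  moreover have "box 0 (2*pi) \<noteq> {}" using pi_gt_zero by (simp del: pi_gt_zero)
  ultimately obtain \<D> where D: "countable \<D>"
    "\<And>K. K \<in> \<D> \<Longrightarrow> interior K \<noteq> {} \<and> (\<exists>c d. K = cbox c d)"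
    "pairwise (\<lambda>A B. interior A \<inter> interior B = {}) \<D>"
    "\<And>K. K \<in> \<D> \<Longrightarrow> \<exists>x \<in> T \<inter> K. K \<subseteq> g x" "T \<subseteq> \<Union>\<D>"
    using covering_lemma[of T 0 "2*pi" g] by metis
  define V where "V i = (if i \<in> to_nat_on \<D> ` \<D> then from_nat_into \<D> i else {})" for i
  have Vcase: "V i = {} \<or> V i \<in> \<D>" for i
    using D(1) by (auto simp: V_def)
  have VU: "\<Union>\<D> \<subseteq> (\<Union>i. V i)"
  proof
    fix x assume "x \<in> \<Union>\<D>"
    then obtain K where "x \<in> K" "K \<in> \<D>" by auto
    hence "x \<in> V (to_nat_on \<D> K)" using D(1) by (auto simp: V_def)
    thus "x \<in> (\<Union>i. V i)" by blast
  qed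
  have disj: "disjoint_family (\<lambda>i. interior (V i))"
    unfolding disjoint_family_on_def
  proof clarify
    fix i j :: nat assume "i \<noteq> j"
    show "interior (V i) \<inter> interior (V j) = {}"
    proof (cases "i \<in> to_nat_on \<D> ` \<D> \<and> j \<in> to_nat_on \<D> ` \<D>")
      case True
      then obtain K L where KL: "K \<in> \<D>" "L \<in> \<D>" "i = to_nat_on \<D> K" "j = to_nat_on \<D> L" by auto
      hence "K \<noteq> L" using \<open>i \<noteq> j\<close> by auto
      thus ?thesis using KL D(1,3) by (auto simp: V_def pairwise_def)
    qed (auto simp: V_def)
  qed
  have sub: "V i \<subseteq> G \<and> (\<forall>s\<in>V i. \<forall>t\<in>V i. \<bar>s - t\<bar> \<le> \<delta>)" for i
  proof (cases "V i = {}")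
    case False
    then obtain x where x: "x \<in> T" "V i \<subseteq> g x" using Vcase[of i] D(4) by blast
    have "x \<in> G" using x(1) G(2) by blast
    hence *: "V i \<subseteq> G \<inter> ball x (\<delta>/2)" using x(2) by (simp only: g_def if_True)
    have "\<bar>s - t\<bar> \<le> \<delta>" if "s \<in> V i" "t \<in> V i" for s t
    proof -
      have "dist x s < \<delta>/2" "dist x t < \<delta>/2" using that * by auto
      thus ?thesis unfolding dist_real_def by linarith
    qed
    with * show ?thesis by blast
  qed auto
  have em: "ennreal \<bar>s - t\<bar> \<le> emeasure lborel (interior (V i))" if "s \<in> V i" "t \<in> V i" for s t i
  proof -
    have "V i \<in> \<D>" using Vcase[of i] that(1) by auto
    then obtain c d where "V i = cbox c d" using D(2) by blast
    hence cd: "V i = {c..d}" by simp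
    hence "\<bar>s - t\<bar> \<le> d - c" "c \<le> d" using that by auto
    thus ?thesis unfolding cd by (simp add: interior_atLeastAtMost_real ennreal_leI)
  qed
  have bnd: "dist (circle_point s) (circle_point t) \<le> \<bar>s - t\<bar>" for s t
    using abs_sin_x_le_abs_x[of "(s - t) / 2"] by (simp add: dist_circle_point)
  let ?U = "\<lambda>i. circle_point ` V i"
  have bdd: "bounded (?U i)" for i
    by (rule bounded_subset[of unit_circle]) (use circle_point_in in auto)
  have "?U \<in> {U. A \<subseteq> (\<Union>i. U i) \<and> (\<forall>i. bounded (U i) \<and> diameter (U i) \<le> \<delta>)}"
  proof (safe)
    fix x assume "x \<in> A"
    hence "x \<in> unit_circle" using assms(1) by blast
    then obtain t where "t \<in> {0..<2*pi}" "x = circle_point t" by (rule circle_point_onto)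
    moreover from this have "t \<in> T" using \<open>x \<in> A\<close> by (simp add: T_def)
    ultimately have "\<exists>t\<in>T. x = circle_point t" by blast
    thus "x \<in> (\<Union>i. ?U i)" using D(5) VU by blast
  next
    fix i
    show "diameter (?U i) \<le> \<delta>"
    proof (rule diameter_le)
      fix x y assume "x \<in> ?U i" "y \<in> ?U i"
      then obtain s t where st: "s \<in> V i" "t \<in> V i" "x = circle_point s" "y = circle_point t" by auto
      have "\<bar>s - t\<bar> \<le> \<delta>" using sub[of i] st by blast
      thus "norm (x - y) \<le> \<delta>" using bnd[of s t] st by (simp add: dist_norm)
    qed (use assms(3) in auto)
  qed (use bdd in auto)
  hence "hausdorff1_pre \<delta> A \<le> (\<Sum>i. ennreal (diameter (?U i)))"
    unfolding hausdorff1_pre_def by (rule INF_lower)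
  also have "\<dots> \<le> (\<Sum>i. emeasure lborel (interior (V i)))"
  proof (intro suminf_le allI)
    fix i
    show "ennreal (diameter (?U i)) \<le> emeasure lborel (interior (V i))"
    proof (cases "emeasure lborel (interior (V i))")
      case (real r)
      have "diameter (?U i) \<le> r"
      proof (rule diameter_le)
        fix x y assume "x \<in> ?U i" "y \<in> ?U i"
        then obtain s t where st: "s \<in> V i" "t \<in> V i" "x = circle_point s" "y = circle_point t" by auto
        have "\<bar>s - t\<bar> \<le> r" using em[OF st(1,2)] real by (simp add: ennreal_le_iff)
        thus "norm (x - y) \<le> r" using bnd[of s t] st by (simp add: dist_norm)
      qed (use real in auto)
      thus ?thesis using real by (simp add: ennreal_leI)
    qed auto
  qed auto
  also have "\<dots> = emeasure lborel (\<Union>i. interior (V i))"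
    by (rule suminf_emeasure[OF _ disj]) auto
  also have "\<dots> \<le> emeasure lborel G"
    using sub interior_subset G(1) by (intro emeasure_mono) (blast | simp)+
  also note G4
  finally show "hausdorff1_pre \<delta> A \<le> emeasure lborel {t \<in> {0..<2*pi}. circle_point t \<in> A} + ennreal \<epsilon>"
    by (simp add: T_def)
qed

lemma hausdorff1_circle:
  assumes "A \<in> sets (restrict_space borel unit_circle)"
  shows "hausdorff1 A = emeasure lborel {t \<in> {0..<2*pi}. circle_point t \<in> A}"
proof (rule antisym)
  have A: "A \<subseteq> unit_circle" "A \<in> sets borel"
    using assms by (auto simp: sets_restrict_space)
  have T: "{t \<in> {0..<2*pi}. circle_point t \<in> A} \<in> sets borel" (is "?T \<in> _")
  proof -
    have "?T = {0..<2*pi} \<inter> (circle_point -` A \<inter> space borel)" by auto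
    thus ?thesis using measurable_sets[OF measurable_circle_point A(2)] by simp
  qed
  show "hausdorff1 A \<le> emeasure lborel ?T"
    unfolding hausdorff1_def using hausdorff1_circle_upper[OF A(1) T] by (intro SUP_least) auto
  let ?k = "\<lambda>n::nat. sqrt (1 - ((1 / real (Suc n))/2)\<^sup>2)"
  have "ennreal (?k n) * emeasure lborel ?T \<le> hausdorff1 A" for n
    unfolding hausdorff1_def
    by (rule order_trans[OF hausdorff1_circle_lower[OF A(1) T]]) (auto intro!: SUP_upper)
  moreover have "(\<lambda>n. ennreal (?k n)) \<longlonglongrightarrow> ennreal 1"
  proof (rule tendsto_ennrealI)
    have "?k \<longlonglongrightarrow> sqrt (1 - (0/2)\<^sup>2)"
      by (intro tendsto_intros LIMSEQ_Suc[OF lim_1_over_n]) auto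
    thus "?k \<longlonglongrightarrow> 1" by simp
  qed
  hence "(\<lambda>n. emeasure lborel ?T * ennreal (?k n)) \<longlonglongrightarrow> emeasure lborel ?T * ennreal 1"
    by (intro ennreal_tendsto_cmult)
      (rule le_less_trans[OF emeasure_mono[of ?T "{0..2*pi}"]], auto)
  ultimately show "emeasure lborel ?T \<le> hausdorff1 A"
    by (intro LIMSEQ_le_const2[of _ "emeasure lborel ?T"]) (auto simp: mult.commute)
qed

lemma circle_measure_eq_arc_length:
  "circle_measure =
     distr (restrict_space lborel {0..<2*pi}) (restrict_space borel unit_circle)
       (\<lambda>t. vector [cos t, sin t])"
  (is "_ = ?N")
proof -
  have m: "circle_point \<in> measurable (restrict_space lborel {0..<2*pi}) (restrict_space borel unit_circle)"
    using measurable_circle_point circle_point_in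
    by (intro measurable_restrict_space2 measurable_restrict_space1) auto
  have N: "?N = distr (restrict_space lborel {0..<2*pi}) (restrict_space borel unit_circle) circle_point"
    by (simp add: circle_point_def[abs_def])
  have sp: "space ?N = unit_circle" "sets ?N = sets (restrict_space borel unit_circle)"
    by (simp_all add: space_restrict_space)
  have "hausdorff1 A = emeasure ?N A" if "A \<in> sets (restrict_space borel unit_circle)" for A
  proof -
    have eq: "circle_point -` A \<inter> space (restrict_space lborel {0..<2*pi}) = {t \<in> {0..<2*pi}. circle_point t \<in> A}"
      by (auto simp: space_restrict_space)
    have "emeasure ?N A = emeasure (restrict_space lborel {0..<2*pi}) {t \<in> {0..<2*pi}. circle_point t \<in> A}"
      unfolding N by (subst emeasure_distr[OF m that]) (simp only: eq)
    also have "\<dots> = emeasure lborel {t \<in> {0..<2*pi}. circle_point t \<in> A}"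
      by (rule emeasure_restrict_space) auto
    finally show ?thesis using hausdorff1_circle[OF that] by simp
  qed
  hence "circle_measure = measure_of (space ?N) (sets ?N) (emeasure ?N)"
    unfolding circle_measure_def sp
    using sets.sigma_sets_eq[of "restrict_space borel unit_circle"] sets.space_closed[of "restrict_space borel unit_circle"]
    by (intro measure_of_eq) (auto simp: space_restrict_space)
  thus ?thesis using measure_of_of_measure[of ?N] by simp
qed

end

theory Submission
  imports Defs
begin

text \<open>Write \<open>J\<close> for the integral to be minimised. Interpolating towards \<open>\<Omega>\<close> shows that a
  competitor whose area falls short of \<open>c\<close> by \<open>\<delta>\<close> has \<open>J\<close> at least a factor \<open>1 + \<kappa> \<delta>\<close> above
  the minimum. In a direction \<open>u\<close> put \<open>g s = h\<^sub>\<omega> (u + s \<tau>)\<close>, a convex function. If \<open>g\<close> is not affine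
  on any interval \<open>[0, e]\<close>, then short arcs of the boundary can be rescaled so that \<open>g\<close> is replaced by
  \<open>g + t V\<close> with \<open>V\<close> compactly supported and with vanishing first variation of the area. Since the area
  under the perturbed arc is a constant minus half the Dirichlet energy of \<open>g + t V\<close>, the area drops by at least
  \<open>t\<^sup>2 E / 2\<close>, where \<open>E\<close> is the Dirichlet energy of \<open>V\<close>. For the right sign of \<open>t\<close> the first-order
  change of \<open>J\<close> is a gain, and by \<open>V\<^sup>2 \<le> s E\<close> its second-order change is a small multiple of
  \<open>t\<^sup>2 E\<close> when the arc is short. This contradicts minimality, so \<open>g\<close> is affine on both sides of \<open>0\<close>
  wherever \<open>h\<^sub>\<Omega> - h\<^sub>\<omega>\<close> grows at least linearly in \<open>s\<close>. Compactness of the circle yields finitely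
  many segments near each free boundary point, and finitely many vertices if \<open>\<Omega>\<close> is a polygon.\<close>

subsection \<open>Support functions and areas of convex bodies\<close>

text \<open>The obstacle is the second-order term of \<open>J\<close>. Put
  \<open>d = h\<^sub>\<Omega> - h\<^sub>\<omega>\<close>. The coefficient
  \<open>d powr (p - 2)\<close> blows up for p < 2 where the bodies touch, and for a polygonal
  container they may touch in the direction \<open>u\<close> itself. The two rates
  \<open>m * s \<le> d\<close> and \<open>V\<^sup>2 \<le> s E\<close> compensate each other:
  \<open>d powr (p - 2) * s\<close> stays bounded because \<open>p \<ge> 1\<close>. Hence linear
  growth of \<open>d\<close> is the right condition.

  The functions involved are merely Lipschitz, so Dirichlet energies are taken on grids. They are
  the areas of circumscribed polygons up to boundary terms, and limits along subsequences are
  enough, since the area of the perturbed body only has to be bounded from above.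

  The penalisation works with a ball of fixed radius inside the competitors and with c < |\<Omega>|,
  so the extreme areas are treated apart: c = |\<Omega>| forces \<omega> = \<Omega>, and for c = 0
  the solution is a segment, where the one bad case is a single point inside \<Omega>.\<close>

lemma support_function_upper:
  assumes "convex_body K" "y \<in> K"
  shows "x \<bullet> y \<le> support_function K x"
proof -
  have "compact ((\<lambda>y. x \<bullet> y) ` K)"
    using assms(1) by (intro compact_continuous_image continuous_intros) (auto simp: convex_body_def)
  thus ?thesis
    unfolding support_function_def using assms(2)
    by (intro cSUP_upper bounded_imp_bdd_above compact_imp_bounded)
qed

lemma support_function_attained:
  assumes "convex_body K"
  obtains y where "y \<in> K" "x \<bullet> y = support_function K x"
proof -
  have "\<exists>y\<in>K. \<forall>z\<in>K. x \<bullet> z \<le> x \<bullet> y"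
    using assms by (intro continuous_attains_sup continuous_intros) (auto simp: convex_body_def)
  then obtain y where y: "y \<in> K" "\<forall>z\<in>K. x \<bullet> z \<le> x \<bullet> y" by blast
  have "support_function K x = x \<bullet> y"
    unfolding support_function_def using y by (intro cSup_eq_maximum) auto
  with y that show ?thesis by simp
qed

lemma support_function_least:
  assumes "convex_body K" "\<And>y. y \<in> K \<Longrightarrow> x \<bullet> y \<le> b"
  shows "support_function K x \<le> b"
  using support_function_attained[OF assms(1), of x] assms(2) by metis

lemma support_function_eqI:
  assumes "convex_body K" "y \<in> K" "x \<bullet> y = b" "\<And>z. z \<in> K \<Longrightarrow> x \<bullet> z \<le> b"
  shows "support_function K x = b"
  using support_function_least[of K x b] support_function_upper[of K y x] assms by fastforce

lemma support_function_scaleR: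
  assumes "convex_body K" "0 \<le> r"
  shows "support_function K (r *\<^sub>R x) = r * support_function K x"
proof -
  obtain y where y: "y \<in> K" "x \<bullet> y = support_function K x"
    using support_function_attained[OF assms(1)] .
  show ?thesis
    by (rule support_function_eqI[OF assms(1) y(1)])
      (use y assms support_function_upper in \<open>auto intro!: mult_left_mono\<close>)
qed

lemma support_function_add_le:
  assumes "convex_body K"
  shows "support_function K (x + y) \<le> support_function K x + support_function K y"
  by (rule support_function_least[OF assms])
    (auto simp: inner_add_left intro!: add_mono support_function_upper[OF assms])

lemma support_function_mono:
  assumes "convex_body K" "convex_body L" "K \<subseteq> L"
  shows "support_function K x \<le> support_function L x"
  using assms by (auto intro!: support_function_least support_function_upper)

text \<open>A hyperplane separating \<open>y\<close> from \<open>K\<close> has a nonzero normal,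
  which can be normalised; so unit directions detect membership.\<close>

lemma mem_if_le_support_function:
  assumes "convex_body K" "\<And>x. norm x = 1 \<Longrightarrow> x \<bullet> y \<le> support_function K x"
  shows "y \<in> K"
proof (rule ccontr)
  assume "y \<notin> K"
  then obtain a b where ab: "a \<bullet> y < b" "\<And>x. x \<in> K \<Longrightarrow> b < a \<bullet> x"
    using separating_hyperplane_closed_point[of K y] assms(1)
    by (auto simp: convex_body_def compact_imp_closed)
  have a0: "a \<noteq> 0" using ab assms(1) by (fastforce simp: convex_body_def)
  define e where "e = - ((1 / norm a) *\<^sub>R a)"
  obtain z where z: "z \<in> K" "e \<bullet> z = support_function K e"
    using support_function_attained[OF assms(1)] .
  have "a \<bullet> y < a \<bullet> z" using ab z by fastforce
  hence "e \<bullet> z < e \<bullet> y" using a0 by (simp add: e_def field_simps)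
  moreover have "norm e = 1" using a0 by (simp add: e_def)
  ultimately show False using assms(2)[of e] z by simp
qed

lemma subset_if_support_function_le:
  assumes "convex_body K" "convex_body L"
    and "\<And>x. norm x = 1 \<Longrightarrow> support_function K x \<le> support_function L x"
  shows "K \<subseteq> L"
proof
  fix y assume y: "y \<in> K"
  show "y \<in> L"
    by (rule mem_if_le_support_function[OF assms(2)])
      (meson order_trans support_function_upper[OF assms(1) y] assms(3))
qed

lemma support_function_lipschitz:
  assumes "convex_body K" "K \<subseteq> cball 0 R"
  shows "\<bar>support_function K x - support_function K y\<bar> \<le> R * norm (x - y)"
proof -
  have *: "support_function K x \<le> support_function K y + R * norm (x - y)" for x y
  proof (rule support_function_least[OF assms(1)])
    fix z assume z: "z \<in> K"
    have "norm z \<le> R" using z assms(2) by auto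
    hence "norm (x - y) * norm z \<le> R * norm (x - y)"
      by (simp add: mult.commute mult_right_mono)
    hence "(x - y) \<bullet> z \<le> R * norm (x - y)"
      using norm_cauchy_schwarz[of "x - y" z] by linarith
    with support_function_upper[OF assms(1) z, of y]
    show "x \<bullet> z \<le> support_function K y + R * norm (x - y)"
      by (simp add: inner_diff_left)
  qed
  show ?thesis using *[of x y] *[of y x] by (simp add: norm_minus_commute abs_le_iff)
qed

lemma convex_body_bound:
  assumes "convex_body K"
  obtains R where "0 < R" "K \<subseteq> cball 0 R"
proof -
  have "bounded K" using assms by (simp add: convex_body_def compact_imp_bounded)
  then obtain R where "0 < R" "\<forall>x\<in>K. norm x \<le> R" using bounded_pos by blast
  thus ?thesis by (intro that[of R]) auto
qed

lemma continuous_support_function: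
  assumes "convex_body K"
  shows "continuous_on A (support_function K)"
proof -
  obtain R where R: "0 < R" "K \<subseteq> cball 0 R" using convex_body_bound[OF assms] .
  show ?thesis
  proof (rule lipschitz_on_continuous_on[of R])
    show "R-lipschitz_on A (support_function K)"
      using support_function_lipschitz[OF assms R(2)] R(1)
      by (intro lipschitz_onI) (auto simp: dist_norm)
  qed
qed

lemma convex_body_cball: "0 \<le> r \<Longrightarrow> convex_body (cball z r)"
  by (auto simp: convex_body_def)

text \<open>Turns the inclusion of a ball in a perturbed body into an inequality of support
  functions. At \<open>x = 0\<close> the witness is the centre, as \<open>sgn 0 = 0\<close>.\<close>

lemma support_function_cball:
  assumes "0 \<le> r"
  shows "support_function (cball z r) x = x \<bullet> z + r * norm x"
proof (rule support_function_eqI[OF convex_body_cball[OF assms], of "z + r *\<^sub>R sgn x"])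
  show "z + r *\<^sub>R sgn x \<in> cball z r" using assms by (auto simp: dist_norm norm_sgn)
  show "x \<bullet> (z + r *\<^sub>R sgn x) = x \<bullet> z + r * norm x"
    by (cases "x = 0") (auto simp: inner_add_right sgn_div_norm norm_eq_sqrt_inner field_simps simp flip: real_sqrt_mult)
next
  fix y assume "y \<in> cball z r"
  hence "norm (y - z) \<le> r" by (simp add: dist_norm norm_minus_commute)
  hence "x \<bullet> (y - z) \<le> r * norm x"
    using norm_cauchy_schwarz[of x "y - z"] mult_right_mono[of "norm (y - z)" r "norm x"]
    by (simp add: mult.commute)
  thus "x \<bullet> y \<le> x \<bullet> z + r * norm x" by (simp add: inner_diff_right)
qed

text \<open>The Minkowski combination of \<open>K\<close> and \<open>L\<close> with weights
  \<open>1 - s\<close> and \<open>s\<close>. Support functions combine with the same weights, so the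
  difference to the support function of \<open>L\<close> shrinks by the factor
  \<open>1 - s\<close>.\<close>

definition interpolate :: "real \<Rightarrow> (real^2) set \<Rightarrow> (real^2) set \<Rightarrow> (real^2) set" where
  "interpolate s K L = {(1 - s) *\<^sub>R x + s *\<^sub>R y |x y. x \<in> K \<and> y \<in> L}"

lemma convex_body_interpolate:
  assumes "convex_body K" "convex_body L"
  shows "convex_body (interpolate s K L)"
proof -
  have eq: "interpolate s K L = {x + y |x y. x \<in> (*\<^sub>R) (1 - s) ` K \<and> y \<in> (*\<^sub>R) s ` L}"
    by (auto simp: interpolate_def)
  have "compact (interpolate s K L)" unfolding eq
    using assms by (intro compact_sums compact_scaling) (auto simp: convex_body_def)
  moreover have "interpolate s K L = (\<Union>x\<in>(*\<^sub>R) (1 - s) ` K. \<Union>y\<in>(*\<^sub>R) s ` L. {x + y})"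
    by (auto simp: interpolate_def)
  hence "convex (interpolate s K L)"
    using assms convex_sums[of "(*\<^sub>R) (1 - s) ` K" "(*\<^sub>R) s ` L"]
    by (simp add: convex_body_def convex_scaling)
  ultimately show ?thesis using assms by (auto simp: convex_body_def interpolate_def)
qed

lemma interpolate_subset:
  assumes "convex M" "K \<subseteq> M" "L \<subseteq> M" "0 \<le> s" "s \<le> 1"
  shows "interpolate s K L \<subseteq> M"
proof
  fix z assume "z \<in> interpolate s K L"
  then obtain x y where "z = (1 - s) *\<^sub>R x + s *\<^sub>R y" "x \<in> K" "y \<in> L" by (auto simp: interpolate_def)
  thus "z \<in> M" using assms convexD_alt[of M x y s] by auto
qed

lemma support_function_interpolate:
  assumes "convex_body K" "convex_body L" "0 \<le> s" "s \<le> 1"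
  shows "support_function (interpolate s K L) x = (1 - s) * support_function K x + s * support_function L x"
proof -
  obtain y z where y: "y \<in> K" "x \<bullet> y = support_function K x" and z: "z \<in> L" "x \<bullet> z = support_function L x"
    using support_function_attained assms(1,2) by metis
  show ?thesis
  proof (rule support_function_eqI[OF convex_body_interpolate[OF assms(1,2)], of "(1 - s) *\<^sub>R y + s *\<^sub>R z"])
    show "(1 - s) *\<^sub>R y + s *\<^sub>R z \<in> interpolate s K L" using y z by (auto simp: interpolate_def)
    show "x \<bullet> ((1 - s) *\<^sub>R y + s *\<^sub>R z) = (1 - s) * support_function K x + s * support_function L x"
      using y z by (simp add: inner_add_right)
  next
    fix w assume "w \<in> interpolate s K L"
    then obtain a b where "w = (1 - s) *\<^sub>R a + s *\<^sub>R b" "a \<in> K" "b \<in> L" by (auto simp: interpolate_def)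
    thus "x \<bullet> w \<le> (1 - s) * support_function K x + s * support_function L x"
      using assms by (auto simp: inner_add_right intro!: add_mono mult_left_mono support_function_upper)
  qed
qed

section \<open>Areas of nested and rescaled convex bodies\<close>

lemma lmeasurable_convex_body: "convex_body K \<Longrightarrow> K \<in> lmeasurable"
  by (simp add: convex_body_def lmeasurable_compact)

lemma area_mono: "convex_body K \<Longrightarrow> convex_body L \<Longrightarrow> K \<subseteq> L \<Longrightarrow> area K \<le> area L"
  unfolding area_def by (intro measure_mono_fmeasurable lmeasurable_convex_body)
    (auto dest: lmeasurable_convex_body simp: fmeasurableD)

lemma area_nonneg: "0 \<le> area K"
  by (simp add: area_def)

lemma area_affine: "area ((\<lambda>x. m *\<^sub>R x + d) ` K) = m\<^sup>2 * area K"
  using measure_lebesgue_affine[of m d K] by (simp add: area_def add.commute power2_eq_square)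

lemma area_pos:
  assumes "convex_body K" "interior K \<noteq> {}"
  shows "0 < area K"
proof -
  obtain z r where r: "0 < r" "cball z r \<subseteq> K"
    using assms(2) mem_interior_cball by blast
  have "area (cball z r) \<le> area K"
    using r assms(1) by (intro area_mono convex_body_cball) auto
  moreover have "0 < area (cball z r)"
    using r(1) content_cball_pos[of r z] by (simp add: area_def measure_completion)
  ultimately show ?thesis by simp
qed

lemma interior_nonempty_if_area_pos:
  assumes "convex_body K" "0 < area K"
  shows "interior K \<noteq> {}"
proof
  assume "interior K = {}"
  hence "K \<subseteq> frontier K"
    using assms(1) by (auto simp: frontier_def convex_body_def compact_imp_closed)
  hence "negligible K"
    using assms(1) negligible_convex_frontier negligible_subset by (metis convex_body_def)
  hence "area K = 0" by (simp add: area_def negligible_imp_measure0)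
  thus False using assms(2) by simp
qed

text \<open>A point of \<open>interior L\<close> outside the closed set \<open>K\<close> would have
  a ball around it in \<open>L - K\<close>, which adds positive area. So \<open>K\<close> contains
  \<open>interior L\<close> and its closure \<open>L\<close>.\<close>

lemma eq_if_area_eq:
  assumes "convex_body K" "convex_body L" "K \<subseteq> L" "interior L \<noteq> {}" "area K = area L"
  shows "K = L"
proof -
  have "interior L \<subseteq> K"
  proof (rule ccontr)
    assume "\<not> interior L \<subseteq> K"
    then obtain x where x: "x \<in> interior L - K" by blast
    have "open (interior L - K)"
      using assms(1) by (auto simp: convex_body_def compact_imp_closed open_Diff)
    then obtain r where r: "0 < r" "cball x r \<subseteq> interior L - K"
      using x open_contains_cball_eq by blast
    have "area K + area (cball x r) = area (K \<union> cball x r)"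
    proof -
      have "cball x r - K = cball x r" using r(2) by blast
      thus ?thesis using measure_Un2[of K lebesgue "cball x r"] assms(1)
        by (simp add: area_def lmeasurable_convex_body)
    qed
    also have "\<dots> \<le> area L"
      unfolding area_def using assms r interior_subset[of L]
      by (intro measure_mono_fmeasurable) (auto simp: lmeasurable_convex_body fmeasurableD)
    finally show False
      using area_pos[OF convex_body_cball, of r x] r assms(5) by simp
  qed
  hence "closure (interior L) \<subseteq> K"
    using assms(1) by (simp add: closure_minimal convex_body_def compact_imp_closed)
  thus ?thesis
    using convex_closure_interior[of L] assms by (auto simp: convex_body_def compact_imp_closed)
qed

subsection \<open>The energy and its penalisation by area\<close>

lemma space_circle_measure: "space circle_measure = unit_circle"
  and sets_circle_measure: "sets circle_measure = sets (restrict_space borel unit_circle)"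
  by (simp_all add: circle_measure_eq_arc_length space_restrict_space)

lemma measurable_circle_point_restrict:
  "circle_point \<in> measurable (restrict_space lborel {0..<2*pi}) (restrict_space borel unit_circle)"
  using measurable_circle_point circle_point_in
  by (intro measurable_restrict_space2 measurable_restrict_space1) auto

lemma circle_measure_distr:
  "circle_measure = distr (restrict_space lborel {0..<2*pi}) (restrict_space borel unit_circle) circle_point"
  by (simp add: circle_measure_eq_arc_length circle_point_def[abs_def])

lemma emeasure_circle_measure_space: "emeasure circle_measure unit_circle = ennreal (2 * pi)"
proof -
  have "circle_point -` unit_circle \<inter> space (restrict_space lborel {0..<2*pi}) = {0..<2*pi}"
    using circle_point_in by (auto simp: space_restrict_space)
  moreover have "unit_circle \<in> sets (restrict_space borel unit_circle)"
    by (simp add: sets_restrict_space_iff)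
  ultimately show ?thesis
    unfolding circle_measure_distr
    by (subst emeasure_distr[OF measurable_circle_point_restrict])
      (auto simp: emeasure_restrict_space)
qed

lemma finite_measure_circle_measure: "finite_measure circle_measure"
  by (rule finite_measureI) (simp add: space_circle_measure emeasure_circle_measure_space)

lemma measure_circle_measure_space: "measure circle_measure unit_circle = 2 * pi"
  by (simp add: measure_def emeasure_circle_measure_space)

lemma borel_measurable_circle_measure:
  assumes "continuous_on unit_circle (f :: real^2 \<Rightarrow> real)"
  shows "f \<in> borel_measurable circle_measure"
  using borel_measurable_continuous_on_restrict[OF assms] sets_circle_measure
  by (simp cong: measurable_cong_sets)

lemma integrable_circle_measure:
  assumes "continuous_on unit_circle (f :: real^2 \<Rightarrow> real)"
  shows "integrable circle_measure f"
proof -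
  have "compact (f ` unit_circle)" using assms by (intro compact_continuous_image) auto
  then obtain B where "\<And>x. x \<in> unit_circle \<Longrightarrow> norm (f x) \<le> B"
    using compact_imp_bounded bounded_iff by (metis imageI)
  thus ?thesis
    by (intro finite_measure.integrable_const_bound[OF finite_measure_circle_measure, of _ B]
        borel_measurable_circle_measure assms AE_I2) (auto simp: space_circle_measure)
qed

text \<open>The integrand vanishes almost everywhere. Pulled back by \<open>circle_point\<close>,
  its zero set is closed and has full measure in an interval, hence contains the interval.\<close>

lemma zero_if_circle_integral_zero:
  assumes f: "continuous_on unit_circle (f :: real^2 \<Rightarrow> real)" "\<And>x. x \<in> unit_circle \<Longrightarrow> 0 \<le> f x"
    and "(\<integral>x. f x \<partial>circle_measure) = 0" "x \<in> unit_circle"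
  shows "f x = 0"
proof -
  have "AE x in circle_measure. f x = 0"
    using integral_nonneg_eq_0_iff_AE[OF integrable_circle_measure[OF f(1)]] assms(3)
      AE_I2[of circle_measure "\<lambda>x. 0 \<le> f x"] assms(2)
    by (simp add: space_circle_measure)
  moreover have "{x \<in> space (restrict_space borel unit_circle). f x = 0} \<in> sets (restrict_space borel unit_circle)"
    using borel_measurable_continuous_on_restrict[OF f(1)] by measurable
  ultimately have "AE t in restrict_space lborel {0..<2*pi}. f (circle_point t) = 0"
    unfolding circle_measure_distr by (subst (asm) AE_distr_iff[OF measurable_circle_point_restrict]) auto
  hence AE: "AE t in lborel. t \<in> {0..<2*pi} \<longrightarrow> f (circle_point t) = 0"
    by (subst (asm) AE_restrict_space_iff) auto
  define C where "C = {t. f (circle_point t) = 0}"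
  have "continuous_on UNIV (\<lambda>t. f (circle_point t))"
    by (rule continuous_on_compose2[OF f(1) continuous_circle_point]) (use circle_point_in in blast)
  hence C: "closed C" unfolding C_def by (intro closed_Collect_eq) auto
  have "AE t in lebesgue. t \<in> {0<..<2*pi} \<longrightarrow> t \<in> C"
    using AE_completion[OF AE] by eventually_elim (auto simp: C_def)
  hence "{0<..<2*pi} \<subseteq> C"
    using mem_closed_if_AE_lebesgue_open[OF open_greaterThanLessThan C] by blast
  hence "closure {0<..<2*pi} \<subseteq> C" using C by (rule closure_minimal)
  also have "closure {0<..<2*pi} = {0..2*pi}" by (rule closure_greaterThanLessThan) simp
  finally have "{0..2*pi} \<subseteq> C" .
  moreover obtain t where "t \<in> {0..<2*pi}" "x = circle_point t" using circle_point_onto[OF assms(4)] .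
  ultimately show ?thesis by (force simp: C_def)
qed

text \<open>The \<open>p\<close>-th power of \<open>support_dist\<close>: the minimisers are the
  same, and no root has to be expanded.\<close>

definition support_energy :: "real \<Rightarrow> (real^2) set \<Rightarrow> (real^2) set \<Rightarrow> real" where
  "support_energy p K L = (\<integral>\<theta>. \<bar>support_function K \<theta> - support_function L \<theta>\<bar> powr p \<partial>circle_measure)"

lemma support_energy_nonneg: "0 \<le> support_energy p K L"
  by (simp add: support_energy_def)

lemma continuous_support_energy_integrand:
  assumes "convex_body K" "convex_body L" "1 \<le> p"
  shows "continuous_on A (\<lambda>\<theta>. \<bar>support_function K \<theta> - support_function L \<theta>\<bar> powr p)"
  using assms by (intro continuous_on_powr' continuous_intros continuous_support_function) auto

lemma support_energy_zero:
  assumes "convex_body K" "convex_body L" "1 \<le> p" "support_energy p K L = 0"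
  shows "K = L"
proof -
  have eq: "support_function K x = support_function L x" if "norm x = 1" for x
  proof -
    have "\<bar>support_function K x - support_function L x\<bar> powr p = 0"
      using that assms(4) unfolding support_energy_def
      by (intro zero_if_circle_integral_zero[OF continuous_support_energy_integrand[OF assms(1-3)]]) auto
    thus ?thesis by simp
  qed
  show ?thesis
    by (intro subset_antisym subset_if_support_function_le assms(1,2)) (simp_all add: eq)
qed

lemma support_energy_minimal:
  assumes "is_solution \<Omega> p c \<omega>" "convex_body K" "K \<subseteq> \<Omega>" "area K = c" "1 \<le> p"
  shows "support_energy p \<Omega> \<omega> \<le> support_energy p \<Omega> K"
proof (rule ccontr)
  assume "\<not> ?thesis"
  hence "support_energy p \<Omega> K powr (1 / p) < support_energy p \<Omega> \<omega> powr (1 / p)"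
    using assms(5) by (intro powr_less_mono2) (auto simp: support_energy_nonneg)
  moreover have "support_dist p \<Omega> \<omega> \<le> support_dist p \<Omega> K"
    using assms by (auto simp: is_solution_def admissible_def)
  ultimately show False by (simp add: support_dist_def support_energy_def)
qed

text \<open>The two balls about \<open>z\<close> show that \<open>L - z\<close> lies in
  \<open>R / r\<close> times \<open>K - z\<close>. Hence the interpolant lies in a homothetic copy
  of \<open>K\<close> with centre \<open>z\<close> and ratio \<open>1 + s * (R / r)\<close>.\<close>

lemma area_interpolate_le:
  assumes K: "convex_body K" "cball z r \<subseteq> K" "0 < r" and L: "convex_body L" "L \<subseteq> cball z R"
    and s: "0 \<le> s" "s \<le> 1"
  shows "area (interpolate s K L) \<le> (1 + s * (R / r))\<^sup>2 * area K"
proof -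
  define \<rho> where "\<rho> = R / r"
  have "0 \<le> R" using L by (force simp: convex_body_def)
  hence \<rho>: "0 \<le> \<rho>" using K by (simp add: \<rho>_def)
  let ?T = "\<lambda>x. (1 + s * \<rho>) *\<^sub>R x + - ((s * \<rho>) *\<^sub>R z)"
  have pos: "0 < 1 + s * \<rho>" using \<rho> s by (simp add: add_pos_nonneg)
  have cK: "convex K" using K by (simp add: convex_body_def)
  have "interpolate s K L \<subseteq> ?T ` K"
  proof
    fix v assume "v \<in> interpolate s K L"
    then obtain x y where v: "v = (1 - s) *\<^sub>R x + s *\<^sub>R y" and x: "x \<in> K" and y: "y \<in> L"
      by (auto simp: interpolate_def)
    \<comment> \<open>The homothety about \<open>z\<close> with ratio \<open>r / R\<close> brings
      \<open>y\<close> into the small ball. If \<open>R = 0\<close>, division by zero gives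
      \<open>w = z\<close>, which is correct because then \<open>y = z\<close>.\<close>
    define w where "w = z + (r / R) *\<^sub>R (y - z)"
    have nz: "norm (y - z) \<le> R" using y L by (auto simp: dist_norm norm_minus_commute)
    have "norm ((r / R) *\<^sub>R (y - z)) \<le> r"
    proof (cases "R = 0")
      case False
      hence "r / R * norm (y - z) \<le> r / R * R" using K \<open>0 \<le> R\<close> nz by (intro mult_left_mono) auto
      thus ?thesis using False K \<open>0 \<le> R\<close> by simp
    qed (use K in auto)
    hence w: "w \<in> K" using K(2) by (auto simp: w_def dist_norm)
    have \<rho>w: "\<rho> *\<^sub>R (w - z) = y - z"
      using nz K(3) by (cases "R = 0") (auto simp: w_def \<rho>_def)
    define m where "m = (1 - s) *\<^sub>R x + s *\<^sub>R z"
    have "z \<in> K" using K by auto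
    hence m: "m \<in> K" using convexD_alt[OF cK x, of z s] s by (simp add: m_def)
    define q where "q = (1 / (1 + s * \<rho>)) *\<^sub>R m + (s * \<rho> / (1 + s * \<rho>)) *\<^sub>R w"
    have "q \<in> K" unfolding q_def
      using pos \<rho> s by (intro convexD[OF cK m w]) (auto simp: field_simps)
    moreover have "?T q = v"
    proof -
      have "(1 + s * \<rho>) *\<^sub>R q = m + (s * \<rho>) *\<^sub>R w"
        using pos by (simp add: q_def scaleR_right_distrib)
      hence "?T q = m + s *\<^sub>R (\<rho> *\<^sub>R (w - z))" by (simp add: algebra_simps)
      also have "\<dots> = v" unfolding \<rho>w by (simp add: m_def v algebra_simps)
      finally show ?thesis .
    qed
    ultimately show "v \<in> ?T ` K" by blast
  qed
  moreover have "convex_body (?T ` K)"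
    using K(1) convex_affinity[of K "- ((s * \<rho>) *\<^sub>R z)" "1 + s * \<rho>"]
    by (auto simp: convex_body_def add.commute intro!: compact_continuous_image continuous_intros)
  ultimately have "area (interpolate s K L) \<le> area (?T ` K)"
    using K(1) L(1) by (intro area_mono convex_body_interpolate)
  thus ?thesis by (simp only: area_affine \<rho>_def)
qed

text \<open>The weights \<open>1 - s\<close> multiply when interpolation towards \<open>L\<close> is
  repeated. The area at a later parameter can thus be estimated from an earlier one by
  \<open>area_interpolate_le\<close>.\<close>

lemma interpolate_interpolate_subset:
  assumes "1 - s' = (1 - t) * (1 - s)"
  shows "interpolate s' K L \<subseteq> interpolate t (interpolate s K L) L"
proof
  fix v assume "v \<in> interpolate s' K L"
  then obtain x y where v: "v = (1 - s') *\<^sub>R x + s' *\<^sub>R y" and x: "x \<in> K" and y: "y \<in> L"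
    by (auto simp: interpolate_def)
  have s': "s' = (1 - t) * s + t" using assms by (simp add: algebra_simps)
  have "v = (1 - t) *\<^sub>R ((1 - s) *\<^sub>R x + s *\<^sub>R y) + t *\<^sub>R y"
    unfolding v assms by (simp add: s' algebra_simps)
  thus "v \<in> interpolate t (interpolate s K L) L"
    using x y unfolding interpolate_def by blast
qed

lemma square_growth_le:
  assumes "0 \<le> (t::real)" "t \<le> 1" "0 \<le> \<rho>" "0 \<le> a" "a \<le> B"
  shows "(1 + t * \<rho>)\<^sup>2 * a \<le> a + (2 * \<rho> + \<rho>\<^sup>2) * B * t"
proof -
  have "(1 + t * \<rho>)\<^sup>2 = 1 + t * (2 * \<rho> + t * \<rho>\<^sup>2)" by (simp add: power2_eq_square algebra_simps)
  also have "\<dots> \<le> 1 + t * (2 * \<rho> + \<rho>\<^sup>2)"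
    using assms by (intro add_left_mono mult_left_mono) (auto simp: mult_left_le_one_le)
  finally have "(1 + t * \<rho>)\<^sup>2 * a \<le> (1 + t * (2 * \<rho> + \<rho>\<^sup>2)) * a"
    using assms by (intro mult_right_mono)
  also have "\<dots> = a + t * (2 * \<rho> + \<rho>\<^sup>2) * a" by (simp add: algebra_simps)
  also have "\<dots> \<le> a + t * (2 * \<rho> + \<rho>\<^sup>2) * B"
    using assms by (intro add_left_mono mult_left_mono) auto
  finally show ?thesis by (simp add: algebra_simps)
qed

text \<open>Intermediate value theorem: up to the parameter \<open>s1\<close> the area is a
  Lipschitz function, which starts at \<open>area K \<le> c\<close> and has reached \<open>c\<close>
  at \<open>s1\<close>.\<close>

lemma interpolate_with_area:
  assumes K: "convex_body K" "cball z r \<subseteq> K" "0 < r" "K \<subseteq> L" "area K \<le> c"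
    and L: "convex_body L" "L \<subseteq> cball z R" "c < area L"
  obtains s where "0 \<le> s" "s < 1" "area (interpolate s K L) = c"
proof -
  define A where "A s = area (interpolate s K L)" for s
  define \<rho> where "\<rho> = R / r"
  \<comment> \<open>The interpolant at \<open>s1\<close> contains a copy of \<open>L\<close> scaled
    by \<open>s1\<close>, whose area is \<open>c\<close>. As \<open>c < area L\<close>, the
    parameter stays below 1, where the Lipschitz constant \<open>M\<close> is finite.\<close>
  define s1 where "s1 = sqrt (c / area L)"
  have "0 \<le> R" using L by (force simp: convex_body_def)
  hence \<rho>: "0 \<le> \<rho>" using K by (simp add: \<rho>_def)
  have c0: "0 \<le> c" using K(5) area_nonneg[of K] by simp
  have aL: "0 < area L" using c0 L by simp
  have s1: "0 \<le> s1" "s1 < 1" using c0 L(3) aL by (auto simp: s1_def)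
  have zK: "z \<in> K" using K by auto
  have cb: "convex_body (interpolate s K L)" for s by (rule convex_body_interpolate[OF K(1) L(1)])
  have K_sub: "K \<subseteq> interpolate s K L" if "0 \<le> s" "s \<le> 1" for s
  proof
    fix x assume "x \<in> K"
    moreover have "x = (1 - s) *\<^sub>R x + s *\<^sub>R x" by (simp add: algebra_simps)
    ultimately show "x \<in> interpolate s K L" using K(4) unfolding interpolate_def by blast
  qed
  have sub_L: "interpolate s K L \<subseteq> L" if "0 \<le> s" "s \<le> 1" for s
    using K L that by (intro interpolate_subset) (auto simp: convex_body_def)
  define M where "M = (2 * \<rho> + \<rho>\<^sup>2) * area L / (1 - s1)"
  have M0: "0 \<le> M" using \<rho> s1 aL by (simp add: M_def)
  have step: "A s \<le> A t \<and> A t \<le> A s + M * (t - s)" if "0 \<le> s" "s \<le> t" "t \<le> s1" for s t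
  proof
    \<comment> \<open>Solves \<open>(1 - \<tau>) * (1 - s) = 1 - t\<close>: interpolating once more
      with \<open>\<tau>\<close> covers the interpolant at \<open>t\<close>.\<close>
    define \<tau> where "\<tau> = (t - s) / (1 - s)"
    have s: "s < 1" using that s1 by simp
    have \<tau>: "0 \<le> \<tau>" "\<tau> \<le> 1" using that s s1 by (auto simp: \<tau>_def field_simps)
    have "(1 - \<tau>) * (1 - s) = 1 - t" using s by (simp add: \<tau>_def field_simps)
    hence "A t \<le> area (interpolate \<tau> (interpolate s K L) L)" unfolding A_def
      by (intro area_mono convex_body_interpolate cb L(1) interpolate_interpolate_subset) auto
    also have "\<dots> \<le> (1 + \<tau> * \<rho>)\<^sup>2 * A s" unfolding A_def \<rho>_def
      using K_sub[of s] that s K L \<tau> by (intro area_interpolate_le[where z = z] cb) auto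
    also have "\<dots> \<le> A s + (2 * \<rho> + \<rho>\<^sup>2) * area L * \<tau>"
      using \<tau> \<rho> sub_L[of s] that s unfolding A_def
      by (intro square_growth_le area_nonneg area_mono cb L) auto
    also have "\<tau> \<le> (t - s) / (1 - s1)"
      unfolding \<tau>_def using that s s1 by (intro divide_left_mono) auto
    hence "(2 * \<rho> + \<rho>\<^sup>2) * area L * \<tau> \<le> (2 * \<rho> + \<rho>\<^sup>2) * area L * ((t - s) / (1 - s1))"
      using \<rho> aL by (intro mult_left_mono) auto
    finally show "A t \<le> A s + M * (t - s)" by (simp add: M_def)
    show "A s \<le> A t" unfolding A_def
    proof (intro area_mono cb)
      show "interpolate s K L \<subseteq> interpolate t K L"
      proof
        fix v assume "v \<in> interpolate s K L"
        then obtain x y where v: "v = (1 - s) *\<^sub>R x + s *\<^sub>R y" "x \<in> K" "y \<in> L"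
          by (auto simp: interpolate_def)
        define y' where "y' = (1 - s / t) *\<^sub>R x + (s / t) *\<^sub>R y"
        show "v \<in> interpolate t K L"
        proof (cases "t = 0")
          case True
          thus ?thesis using v that by (auto simp: interpolate_def)
        next
          case False
          have "y' \<in> L" unfolding y'_def using that False K(4) v L(1)
            by (intro convexD_alt) (auto simp: convex_body_def)
          moreover have "v = (1 - t) *\<^sub>R x + t *\<^sub>R y'"
            using False by (simp add: v y'_def algebra_simps)
          ultimately show ?thesis using v unfolding interpolate_def by blast
        qed
      qed
    qed
  qed
  have "M-lipschitz_on {0..s1} A"
  proof (rule lipschitz_onI[OF _ M0])
    fix s t assume "s \<in> {0..s1}" "t \<in> {0..s1}"
    thus "dist (A s) (A t) \<le> M * dist s t"
      using step[of s t] step[of t s] by (cases "s \<le> t") (auto simp: dist_real_def abs_if)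
  qed
  hence cont: "continuous_on {0..s1} A" by (rule lipschitz_on_continuous_on)
  have "A 0 = area K"
  proof -
    have "interpolate 0 K L = K" using L by (auto simp: interpolate_def convex_body_def)
    thus ?thesis by (simp add: A_def)
  qed
  moreover have "c \<le> A s1"
  proof -
    have "(\<lambda>x. s1 *\<^sub>R x + (1 - s1) *\<^sub>R z) ` L \<subseteq> interpolate s1 K L"
      using zK by (auto simp: interpolate_def add.commute)
    moreover have "convex_body ((\<lambda>x. s1 *\<^sub>R x + (1 - s1) *\<^sub>R z) ` L)"
      using L(1) convex_affinity[of L "(1 - s1) *\<^sub>R z" s1]
      by (auto simp: convex_body_def add.commute intro!: compact_continuous_image continuous_intros)
    ultimately have "s1\<^sup>2 * area L \<le> A s1"
      unfolding A_def area_affine[symmetric, of _ _ "(1 - s1) *\<^sub>R z"] by (intro area_mono cb)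
    thus ?thesis using c0 aL by (simp add: s1_def)
  qed
  ultimately obtain s where "0 \<le> s" "s \<le> s1" "A s = c"
    using IVT'[of A 0 c s1] K(5) s1(1) cont by auto
  thus ?thesis using that[of s] s1 by (simp add: A_def)
qed

text \<open>Interpolating towards \<open>\<Omega>\<close> restores a missing amount of area and decreases the energy at a
  rate proportional to that amount. This plays the role of a Lagrange multiplier for the area.\<close>

lemma energy_area_penalisation:
  assumes \<Omega>: "convex_body \<Omega>" and p: "1 \<le> p" and c: "c < area \<Omega>"
    and sol: "is_solution \<Omega> p c \<omega>" and r: "0 < r"
  obtains \<kappa> where "0 < \<kappa>"
    "\<And>K z. \<lbrakk>convex_body K; K \<subseteq> \<Omega>; cball z r \<subseteq> K; area K \<le> c\<rbrakk>
      \<Longrightarrow> support_energy p \<Omega> \<omega> * (1 + \<kappa> * (c - area K)) \<le> support_energy p \<Omega> K"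
proof -
  obtain R0 where R0: "0 < R0" "\<Omega> \<subseteq> cball 0 R0" using convex_body_bound[OF \<Omega>] .
  \<comment> \<open>Doubled, so that the ball of radius \<open>R\<close> about any point of
    \<open>\<Omega>\<close> contains \<open>\<Omega>\<close>. This makes \<open>\<kappa>\<close>
    independent of \<open>z\<close>.\<close>
  define R where "R = 2 * R0"
  define \<rho> where "\<rho> = R / r"
  have \<rho>: "0 < \<rho>" using R0 r by (simp add: \<rho>_def R_def)
  have c0: "0 \<le> c" using sol area_nonneg by (auto simp: is_solution_def admissible_def)
  \<comment> \<open>The parameter \<open>s\<close> adds at most \<open>s / \<kappa>\<close> to the
    area, so restoring the deficit takes \<open>s \<ge> \<kappa> * (c - area K)\<close>.\<close>
  define \<kappa> where "\<kappa> = 1 / ((2 * \<rho> + \<rho>\<^sup>2) * area \<Omega>)"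
  have den: "0 < (2 * \<rho> + \<rho>\<^sup>2) * area \<Omega>"
    using \<rho> c c0 by (intro mult_pos_pos add_pos_pos) auto
  show ?thesis
  proof (rule that[of \<kappa>])
    show "0 < \<kappa>" using den by (simp add: \<kappa>_def)
    fix K z assume K: "convex_body K" "K \<subseteq> \<Omega>" "cball z r \<subseteq> K" "area K \<le> c"
    have "z \<in> K" using K r by auto
    hence "z \<in> cball 0 R0" using K R0 by blast
    hence \<Omega>R: "\<Omega> \<subseteq> cball z R"
    proof -
      have "norm (z - x) \<le> R" if "x \<in> \<Omega>" for x
      proof -
        have "norm x \<le> R0" "norm z \<le> R0" using that \<open>z \<in> cball 0 R0\<close> R0(2) by auto
        thus ?thesis using norm_triangle_ineq4[of z x] by (simp add: R_def)
      qed
      thus ?thesis by (auto simp: dist_norm)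
    qed
    obtain s where s: "0 \<le> s" "s < 1" "area (interpolate s K \<Omega>) = c"
      using interpolate_with_area[OF K(1,3) r K(2,4) \<Omega> \<Omega>R c] .
    have "c \<le> (1 + s * \<rho>)\<^sup>2 * area K"
      using area_interpolate_le[OF K(1,3) r \<Omega> \<Omega>R, of s] s by (simp add: \<rho>_def)
    also have "\<dots> \<le> area K + (2 * \<rho> + \<rho>\<^sup>2) * area \<Omega> * s"
      using s \<rho> K \<Omega> by (intro square_growth_le area_nonneg area_mono) auto
    finally have sk: "\<kappa> * (c - area K) \<le> s"
      using den by (simp add: \<kappa>_def field_simps)
    let ?J = "support_energy p \<Omega>"
    have "?J \<omega> \<le> ?J (interpolate s K \<Omega>)"
      using s K \<Omega> by (intro support_energy_minimal[OF sol] convex_body_interpolate interpolate_subset p)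
        (auto simp: convex_body_def)
    also have "\<dots> = (1 - s) powr p * ?J K"
    proof -
      have "\<bar>support_function \<Omega> x - support_function (interpolate s K \<Omega>) x\<bar> =
          (1 - s) * \<bar>support_function \<Omega> x - support_function K x\<bar>" for x
      proof -
        have "support_function \<Omega> x - support_function (interpolate s K \<Omega>) x =
          (1 - s) * (support_function \<Omega> x - support_function K x)"
          using s by (simp add: support_function_interpolate K \<Omega> algebra_simps)
        thus ?thesis using s by (simp add: abs_mult)
      qed
      thus ?thesis unfolding support_energy_def using s by (simp add: powr_mult)
    qed
    \<comment> \<open>\<open>1 - s\<close> lies in the unit interval and \<open>p \<ge> 1\<close>.
      The factor \<open>1 + s\<close> of the claim then arises from
      \<open>(1 - s) * (1 + s) \<le> 1\<close>.\<close>
    also have "\<dots> \<le> (1 - s) * ?J K"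
      using powr_mono'[of 1 p "1 - s"] p s by (intro mult_right_mono support_energy_nonneg) auto
    finally have le: "?J \<omega> \<le> (1 - s) * ?J K" .
    have "?J \<omega> * (1 + \<kappa> * (c - area K)) \<le> ?J \<omega> * (1 + s)"
      using sk by (intro mult_left_mono support_energy_nonneg) auto
    also have "\<dots> \<le> (1 - s) * ?J K * (1 + s)" using le s by (intro mult_right_mono) auto
    also have "\<dots> = (1 - s * s) * ?J K" by (simp add: algebra_simps)
    also have "\<dots> \<le> 1 * ?J K" using s by (intro mult_right_mono support_energy_nonneg) auto
    finally show "?J \<omega> * (1 + \<kappa> * (c - area K)) \<le> ?J K" by simp
  qed
qed

subsection \<open>Discrete Dirichlet energies and compactly supported perturbations\<close>

definition grid :: "real \<Rightarrow> real \<Rightarrow> nat \<Rightarrow> nat \<Rightarrow> real" where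
  "grid a b n k = a + real k * ((b - a) / real n)"

text \<open>Difference-quotient version of the bilinear form given by the integral of f' h' over
  [a, b].\<close>

definition dirichlet :: "real \<Rightarrow> real \<Rightarrow> nat \<Rightarrow> (real \<Rightarrow> real) \<Rightarrow> (real \<Rightarrow> real) \<Rightarrow> real" where
  "dirichlet a b n f h =
     (\<Sum>k<n. (f (grid a b n (Suc k)) - f (grid a b n k)) * (h (grid a b n (Suc k)) - h (grid a b n k))) / ((b - a) / real n)"

lemma grid_Suc: "grid a b n (Suc k) - grid a b n k = (b - a) / real n"
  by (simp add: grid_def distrib_right del: times_divide_eq_right)

lemma dirichlet_add_scaled:
  "dirichlet a b n (\<lambda>s. f s + t * v s) (\<lambda>s. f s + t * v s) =
     dirichlet a b n f f + 2 * t * dirichlet a b n f v + t\<^sup>2 * dirichlet a b n v v"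
proof -
  define d where "d = (b - a) / real n"
  have "(\<Sum>k<n. (f (grid a b n (Suc k)) + t * v (grid a b n (Suc k)) - (f (grid a b n k) + t * v (grid a b n k))) *
      (f (grid a b n (Suc k)) + t * v (grid a b n (Suc k)) - (f (grid a b n k) + t * v (grid a b n k)))) =
    (\<Sum>k<n. (f (grid a b n (Suc k)) - f (grid a b n k)) * (f (grid a b n (Suc k)) - f (grid a b n k)) +
      2 * t * ((f (grid a b n (Suc k)) - f (grid a b n k)) * (v (grid a b n (Suc k)) - v (grid a b n k))) +
      t\<^sup>2 * ((v (grid a b n (Suc k)) - v (grid a b n k)) * (v (grid a b n (Suc k)) - v (grid a b n k))))"
    by (intro sum.cong refl) (simp add: power2_eq_square algebra_simps)
  thus ?thesis
    unfolding dirichlet_def d_def[symmetric] sum.distrib sum_distrib_left[symmetric]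
    by (simp add: add_divide_distrib)
qed

lemma dirichlet_sum_right:
  "dirichlet a b n f (\<lambda>s. \<Sum>i<m. c i * h i s) = (\<Sum>i<m::nat. c i * dirichlet a b n f (h i))"
proof -
  have "(\<Sum>k<n. (f (grid a b n (Suc k)) - f (grid a b n k)) *
      ((\<Sum>i<m. c i * h i (grid a b n (Suc k))) - (\<Sum>i<m. c i * h i (grid a b n k)))) =
    (\<Sum>k<n. \<Sum>i<m. c i * ((f (grid a b n (Suc k)) - f (grid a b n k)) *
      (h i (grid a b n (Suc k)) - h i (grid a b n k))))"
    by (intro sum.cong refl) (simp add: sum_distrib_left algebra_simps flip: sum_subtractf)
  also have "\<dots> = (\<Sum>i<m. c i * (\<Sum>k<n. (f (grid a b n (Suc k)) - f (grid a b n k)) *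
      (h i (grid a b n (Suc k)) - h i (grid a b n k))))"
    by (subst sum.swap) (simp add: sum_distrib_left)
  finally show ?thesis
    by (simp only: dirichlet_def sum_divide_distrib[where A = "{..<m}"] times_divide_eq_right)
qed

text \<open>Each of the \<open>n\<close> products is at most \<open>L * M\<close> times the squared
  mesh width. The bound is uniform in \<open>n\<close>, as the extraction of convergent subsequences
  requires.\<close>

lemma dirichlet_bound:
  assumes "L-lipschitz_on UNIV f" "M-lipschitz_on UNIV h" "a < b"
  shows "\<bar>dirichlet a b n f h\<bar> \<le> L * M * (b - a)"
proof (cases "n = 0")
  case True
  thus ?thesis
    using assms(3) lipschitz_on_nonneg[OF assms(1)] lipschitz_on_nonneg[OF assms(2)]
    by (simp add: dirichlet_def)
next
  case False
  define d where "d = (b - a) / real n"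
  have d: "0 < d" using False assms(3) by (simp add: d_def)
  have L: "0 \<le> L" "0 \<le> M" using assms lipschitz_on_nonneg by blast+
  have "\<bar>(f (grid a b n (Suc k)) - f (grid a b n k)) * (h (grid a b n (Suc k)) - h (grid a b n k))\<bar>
      \<le> (L * d) * (M * d)" for k
  proof -
    have "\<bar>f (grid a b n (Suc k)) - f (grid a b n k)\<bar> \<le> L * d"
      using lipschitz_onD[OF assms(1), of "grid a b n (Suc k)" "grid a b n k"] d
      by (simp add: dist_real_def grid_Suc flip: d_def)
    moreover have "\<bar>h (grid a b n (Suc k)) - h (grid a b n k)\<bar> \<le> M * d"
      using lipschitz_onD[OF assms(2), of "grid a b n (Suc k)" "grid a b n k"] d
      by (simp add: dist_real_def grid_Suc flip: d_def)
    ultimately show ?thesis unfolding abs_mult using L d by (intro mult_mono) auto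
  qed
  hence "\<bar>\<Sum>k<n. (f (grid a b n (Suc k)) - f (grid a b n k)) * (h (grid a b n (Suc k)) - h (grid a b n k))\<bar>
      \<le> (\<Sum>k<n. (L * d) * (M * d))"
    by (intro order_trans[OF sum_abs] sum_mono)
  also have "\<dots> = L * M * (b - a) * d" using False by (simp add: d_def field_simps)
  finally show ?thesis
    unfolding dirichlet_def d_def[symmetric] using d by (simp add: abs_divide field_simps)
qed

text \<open>Telescoping from \<open>v a = 0\<close> and Cauchy-Schwarz: the discrete form of the
  one-dimensional Sobolev estimate.\<close>

lemma square_le_dirichlet_grid:
  assumes "a < b" "v a = 0" "k \<le> n"
  shows "(v (grid a b n k))\<^sup>2 \<le> (grid a b n k - a) * dirichlet a b n v v"
proof (cases "n = 0")
  case True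
  thus ?thesis using assms by (simp add: grid_def)
next
  case False
  define d where "d = (b - a) / real n"
  have d: "0 < d" using False assms(1) by (simp add: d_def)
  let ?w = "\<lambda>j. v (grid a b n (Suc j)) - v (grid a b n j)"
  have "v (grid a b n k) = (\<Sum>j<k. 1 * ?w j)"
    using assms(2) sum_lessThan_telescope[of "\<lambda>j. v (grid a b n j)" k]
    by (simp add: grid_def[of _ _ _ 0])
  hence "(v (grid a b n k))\<^sup>2 \<le> (\<Sum>j<k. 1\<^sup>2) * (\<Sum>j<k. (?w j)\<^sup>2)"
    using Cauchy_Schwarz_ineq_sum[of "\<lambda>_. 1" ?w "{..<k}"] by simp
  also have "\<dots> \<le> real k * (\<Sum>j<n. (?w j)\<^sup>2)"
    using assms(3) by (auto intro!: mult_left_mono sum_mono2)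
  also have "\<dots> = (grid a b n k - a) * dirichlet a b n v v"
    using d by (simp add: dirichlet_def grid_def power2_eq_square flip: d_def)
  finally show ?thesis .
qed

lemma square_le_dirichlet_limit:
  assumes ab: "a < b" and v: "v a = 0" "continuous_on UNIV v" and r: "strict_mono r"
    and lim: "(\<lambda>n. dirichlet a b (r n) v v) \<longlonglongrightarrow> E" and s: "s \<in> {a..b}"
  shows "(v s)\<^sup>2 \<le> (s - a) * E"
proof -
  \<comment> \<open>The last grid point not beyond \<open>s\<close>, within one mesh width of it.
    The shift to \<open>Suc n\<close> keeps the number of cells positive.\<close>
  define k where "k n = nat \<lfloor>(s - a) / (b - a) * real (r (Suc n))\<rfloor>" for n
  define x where "x n = grid a b (r (Suc n)) (k n)" for n
  have rn: "Suc n \<le> r (Suc n)" for n using seq_suble[OF r] by blast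
  have q: "0 \<le> (s - a) / (b - a)" "(s - a) / (b - a) \<le> 1" using s ab by auto
  have kn: "k n \<le> r (Suc n)" for n
  proof -
    have "(s - a) / (b - a) * real (r (Suc n)) \<le> 1 * real (r (Suc n))"
      using q by (intro mult_right_mono) auto
    thus ?thesis unfolding k_def by linarith
  qed
  have close: "\<bar>x n - s\<bar> \<le> (b - a) / real (Suc n)" for n
  proof -
    define N where "N = real (r (Suc n))"
    have N: "real (Suc n) \<le> N" using rn[of n] by (simp add: N_def)
    have "real (k n) = of_int \<lfloor>(s - a) / (b - a) * N\<rfloor>"
      using q(1) unfolding k_def N_def by (subst of_nat_nat) (auto simp: zero_le_floor intro!: mult_nonneg_nonneg simp del: times_divide_eq_left)
    hence "\<bar>real (k n) - (s - a) / (b - a) * N\<bar> \<le> 1" by linarith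
    moreover have "x n - s = (real (k n) - (s - a) / (b - a) * N) * ((b - a) / N)"
      using N ab by (simp add: x_def grid_def N_def[symmetric] field_simps)
    ultimately have "\<bar>x n - s\<bar> \<le> 1 * ((b - a) / N)"
      using N ab by (simp only: abs_mult) (intro mult_mono, auto)
    also have "\<dots> \<le> (b - a) / real (Suc n)"
      using N ab by (simp add: frac_le)
    finally show ?thesis .
  qed
  have "(\<lambda>n. x n - s) \<longlonglongrightarrow> 0"
  proof (rule Lim_null_comparison[of _ "\<lambda>n. (b - a) / real (Suc n)"])
    show "(\<lambda>n. (b - a) / real (Suc n)) \<longlonglongrightarrow> 0"
      by (rule LIMSEQ_Suc[OF lim_const_over_n])
  qed (use close in auto)
  hence x: "x \<longlonglongrightarrow> s" by (simp add: LIM_zero_iff)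
  have vx: "(\<lambda>n. v (x n)) \<longlonglongrightarrow> v s"
    using v(2) x by (simp add: continuous_on_eq_continuous_at isCont_tendsto_compose)
  have "(v (x n))\<^sup>2 \<le> (x n - a) * dirichlet a b (r (Suc n)) v v" for n
    unfolding x_def using square_le_dirichlet_grid[of a b v "k n" "r (Suc n)"] ab v(1) kn by simp
  thus ?thesis
    by (intro LIMSEQ_le[OF tendsto_power[OF vx, of 2] tendsto_mult[OF tendsto_diff[OF x tendsto_const] LIMSEQ_Suc[OF lim]]]) auto
qed

section \<open>A common subsequence for finitely many sequences, and three linear equations in four
  unknowns\<close>

lemma common_convergent_subsequence:
  fixes D :: "nat \<Rightarrow> nat \<Rightarrow> real"
  assumes "\<And>i. i < m \<Longrightarrow> bounded (range (D i))"
  shows "\<exists>r :: nat \<Rightarrow> nat. strict_mono r \<and> (\<forall>i<m. convergent (\<lambda>n. D i (r n)))"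
  using assms
proof (induction m)
  case 0
  show ?case by (auto intro!: exI[of _ id] simp: strict_mono_def)
next
  case (Suc m)
  then obtain r :: "nat \<Rightarrow> nat" where r: "strict_mono r" "\<And>i. i < m \<Longrightarrow> convergent (\<lambda>n. D i (r n))"
    by auto
  have "bounded (range (\<lambda>n. D m (r n)))"
    by (rule bounded_subset[OF Suc.prems[of m]]) auto
  then obtain l q where q: "strict_mono q" "((\<lambda>n. D m (r n)) \<circ> q) \<longlonglongrightarrow> l"
    using bounded_imp_convergent_subsequence by blast
  have "convergent (\<lambda>n. D i ((r \<circ> q) n))" if "i < Suc m" for i
  proof (cases "i = m")
    case True
    thus ?thesis using q(2) by (auto simp: convergent_def o_def)
  next
    case False
    hence "convergent (\<lambda>n. D i (r n))" using that r by simp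
    thus ?thesis using convergent_subseq_convergent[OF _ q(1), of "\<lambda>n. D i (r n)"] by (simp add: o_def)
  qed
  thus ?case using strict_mono_o[OF r(1) q(1)] by blast
qed

text \<open>Four vectors of a three-dimensional space are dependent. Since \<open>dependent\<close>
  speaks of sets, a repeated vector is treated apart, with coefficients 1 and -1.\<close>

lemma homogeneous_system_3_4:
  fixes p q r :: "nat \<Rightarrow> real"
  obtains c where "\<exists>i<4. c i \<noteq> 0" "(\<Sum>i<4. c i * p i) = 0" "(\<Sum>i<4. c i * q i) = 0" "(\<Sum>i<4. c i * r i) = 0"
proof -
  define v where "v i = (p i, q i, r i)" for i
  have sums: "(\<Sum>i<4. c i * p i) = 0 \<and> (\<Sum>i<4. c i * q i) = 0 \<and> (\<Sum>i<4. c i * r i) = 0"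
    if "(\<Sum>i<(4::nat). c i *\<^sub>R v i) = 0" for c
  proof -
    have "(\<Sum>i<(4::nat). c i *\<^sub>R v i) = ((\<Sum>i<4. c i * p i), (\<Sum>i<4. c i * q i), (\<Sum>i<4. c i * r i))"
      by (simp add: v_def numeral_eq_Suc)
    thus ?thesis using that by (simp add: zero_prod_def)
  qed
  have "\<exists>c. (\<exists>i<4. c i \<noteq> 0) \<and> (\<Sum>i<(4::nat). c i *\<^sub>R v i) = 0"
  proof (cases "inj_on v {..<4}")
    case True
    have "dependent (v ` {..<4})"
      by (rule dependent_biggerset) (simp_all add: card_image[OF True])
    hence "\<exists>u. (\<exists>w\<in>v ` {..<4}. u w \<noteq> 0) \<and> (\<Sum>x\<in>v ` {..<4}. u x *\<^sub>R x) = 0"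
      using dependent_finite[of "v ` {..<4}"] by simp
    then obtain u w where u: "w \<in> v ` {..<4}" "u w \<noteq> 0" "(\<Sum>x\<in>v ` {..<4}. u x *\<^sub>R x) = 0"
      by blast
    hence "(\<Sum>i<4. u (v i) *\<^sub>R v i) = 0"
      by (subst (asm) sum.reindex[OF True]) (simp add: o_def)
    thus ?thesis using u(1,2) by (intro exI[of _ "u \<circ> v"]) auto
  next
    case False
    then obtain i j where ij: "i < 4" "j < 4" "i \<noteq> j" "v i = v j" by (auto simp: inj_on_def)
    define c where "c k = (if k = i then 1 else if k = j then -1 else 0 :: real)" for k
    have "(\<Sum>k<(4::nat). c k *\<^sub>R v k) = (\<Sum>k\<in>{i, j}. c k *\<^sub>R v k)"
      using ij by (intro sum.mono_neutral_right) (auto simp: c_def)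
    also have "\<dots> = 0" using ij by (simp add: c_def)
    finally show ?thesis using ij by (intro exI[of _ c]) (auto simp: c_def)
  qed
  thus ?thesis using sums that by metis
qed

text \<open>Minus its supporting line at \<open>a\<close>, the function is convex, nonnegative and
  zero at \<open>a\<close>; cutting it to zero on one side of its minimum preserves
  convexity.\<close>

lemma convex_truncate_right:
  fixes f :: "real \<Rightarrow> real"
  assumes f: "convex_on UNIV f" and l: "\<And>s. \<alpha> + \<beta> * s \<le> f s" "\<alpha> + \<beta> * a = f a"
  shows "convex_on UNIV (\<lambda>s. if s \<le> a then 0 else f s - (\<alpha> + \<beta> * s))"
proof -
  define h where "h s = f s - (\<alpha> + \<beta> * s)" for s
  have "convex_on UNIV (\<lambda>s. f s + (- \<alpha> + - \<beta> * s))"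
    by (intro convex_on_add f) (auto simp: convex_on_def algebra_simps simp flip: distrib_right)
  moreover have "(\<lambda>s. f s + (- \<alpha> + - \<beta> * s)) = h" by (auto simp: h_def)
  ultimately have h: "convex_on UNIV h" by simp
  have h0: "0 \<le> h s" "h a = 0" for s using l by (auto simp: h_def)
  have "(if (1 - t) * x + t * y \<le> a then 0 else h ((1 - t) * x + t * y)) \<le>
      (1 - t) * (if x \<le> a then 0 else h x) + t * (if y \<le> a then 0 else h y)" (is "?l \<le> ?r")
    if t: "0 < t" "t < 1" and xy: "x < y" for t x y :: real
  proof -
    define z where "z = (1 - t) * x + t * y"
    have rhs: "0 \<le> (1 - t) * (if x \<le> a then 0 else h x)" "0 \<le> t * (if y \<le> a then 0 else h y)"
      using t h0(1) by auto
    consider "z \<le> a" | "a < x" | "x \<le> a" "a < z" by linarith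
    thus ?thesis
    proof cases
      case 1
      thus ?thesis using rhs by (simp add: z_def)
    next
      case 2
      hence "a < y" using xy by simp
      thus ?thesis using rhs 2 convex_onD[OF h, of t x y] t by auto
    next
      case 3
      have zy: "z < y"
      proof -
        have "y - z = (1 - t) * (y - x)" by (simp add: z_def algebra_simps)
        moreover have "0 < (1 - t) * (y - x)" using t xy by simp
        ultimately show ?thesis by linarith
      qed
      hence ay: "a < y" using 3 by simp
      \<comment> \<open>When the segment crosses \<open>a\<close>, convexity is applied from
        \<open>a\<close> instead of \<open>x\<close>. The weight of \<open>y\<close> drops from
        \<open>t\<close> to \<open>\<tau>\<close>, which is harmless because
        \<open>h \<ge> 0\<close>.\<close>
      define \<tau> where "\<tau> = (z - a) / (y - a)"
      have \<tau>: "0 \<le> \<tau>" "\<tau> \<le> 1" using 3 zy ay by (auto simp: \<tau>_def)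
      have "\<tau> * (y - a) = z - a" using ay by (simp add: \<tau>_def)
      hence "z = (1 - \<tau>) * a + \<tau> * y" by (simp add: algebra_simps)
      hence "h z \<le> \<tau> * h y" using convex_onD[OF h, of \<tau> a y] \<tau> h0(2) by simp
      also have "\<tau> \<le> t"
      proof -
        have "z - a \<le> t * (y - a)"
        proof -
          have "z - a - t * (y - a) = (1 - t) * (x - a)" by (simp add: z_def algebra_simps)
          also have "\<dots> \<le> 0" using t 3 by (simp add: mult_nonneg_nonpos)
          finally show ?thesis by simp
        qed
        thus ?thesis using ay by (simp add: \<tau>_def field_simps)
      qed
      hence "\<tau> * h y \<le> t * h y" using h0(1) by (intro mult_right_mono)
      finally show ?thesis using 3 ay by (simp add: z_def)
    qed
  qed
  note * = this
  have "convex_on UNIV (\<lambda>s. if s \<le> a then 0 else h s)"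
  proof (rule convex_on_linorderI)
    fix t x y :: real assume "0 < t" "t < 1" "x < y"
    from *[OF this]
    show "(if (1 - t) *\<^sub>R x + t *\<^sub>R y \<le> a then 0 else h ((1 - t) *\<^sub>R x + t *\<^sub>R y)) \<le>
        (1 - t) * (if x \<le> a then 0 else h x) + t * (if y \<le> a then 0 else h y)"
      by (simp only: real_scaleR_def)
  qed simp
  thus ?thesis unfolding h_def .
qed

lemma convex_truncate_left:
  fixes f :: "real \<Rightarrow> real"
  assumes f: "convex_on UNIV f" and l: "\<And>s. \<alpha> + \<beta> * s \<le> f s" "\<alpha> + \<beta> * a = f a"
  shows "convex_on UNIV (\<lambda>s. if a \<le> s then 0 else f s - (\<alpha> + \<beta> * s))"
proof -
  have refl: "convex_on UNIV (\<lambda>s. h (- s))" if "convex_on UNIV h" for h :: "real \<Rightarrow> real"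
  proof (rule convex_onI)
    fix t x y :: real assume "0 < t" "t < 1"
    thus "h (- ((1 - t) *\<^sub>R x + t *\<^sub>R y)) \<le> (1 - t) * h (- x) + t * h (- y)"
      using convex_onD[OF that, of t "-x" "-y"] by simp
  qed simp
  have "convex_on UNIV (\<lambda>s. if s \<le> - a then 0 else f (- s) - (\<alpha> + - \<beta> * s))"
    using l(2) by (intro convex_truncate_right refl f) (use l(1)[of "- s" for s] in auto)
  from refl[OF this] show ?thesis by (simp add: if_distrib cong: if_cong)
qed

lemma lipschitz_truncate_right:
  fixes f :: "real \<Rightarrow> real"
  assumes f: "L-lipschitz_on UNIV f" and a: "\<alpha> + \<beta> * a = f a"
  shows "(L + \<bar>\<beta>\<bar>)-lipschitz_on UNIV (\<lambda>s. if s \<le> a then 0 else f s - (\<alpha> + \<beta> * s))"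
proof -
  define h where "h s = f s - (\<alpha> + \<beta> * s)" for s
  have L: "0 \<le> L" using f lipschitz_on_nonneg by blast
  have h: "\<bar>h x - h y\<bar> \<le> (L + \<bar>\<beta>\<bar>) * \<bar>x - y\<bar>" for x y
  proof -
    have "\<bar>f x - f y\<bar> \<le> L * \<bar>x - y\<bar>" using lipschitz_onD[OF f, of x y] by (simp add: dist_real_def)
    moreover have "\<bar>\<beta> * (x - y)\<bar> = \<bar>\<beta>\<bar> * \<bar>x - y\<bar>" by (rule abs_mult)
    moreover have "h x - h y = (f x - f y) - \<beta> * (x - y)" by (simp add: h_def algebra_simps)
    ultimately show ?thesis by (simp add: distrib_right abs_le_iff) linarith
  qed
  have ha: "h a = 0" using a by (simp add: h_def)
  have *: "\<bar>(if x \<le> a then 0 else h x) - (if y \<le> a then 0 else h y)\<bar> \<le> (L + \<bar>\<beta>\<bar>) * \<bar>x - y\<bar>"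
    if "x \<le> y" for x y
  proof -
    consider "y \<le> a" | "a < x" | "x \<le> a" "a < y" by linarith
    thus ?thesis
    proof cases
      case 3
      have "\<bar>h a - h y\<bar> \<le> (L + \<bar>\<beta>\<bar>) * \<bar>a - y\<bar>" by (rule h)
      also have "\<dots> \<le> (L + \<bar>\<beta>\<bar>) * \<bar>x - y\<bar>" using 3 L by (intro mult_left_mono) auto
      finally show ?thesis using 3 ha by simp
    next
      case 2
      thus ?thesis using h[of x y] that by simp
    qed (use L that in simp)
  qed
  show ?thesis unfolding h_def[symmetric]
  proof (rule lipschitz_onI)
    fix x y :: real
    show "dist (if x \<le> a then 0 else h x) (if y \<le> a then 0 else h y) \<le> (L + \<bar>\<beta>\<bar>) * dist x y"
      using *[of x y] *[of y x] unfolding dist_real_def by (cases "x \<le> y") (simp_all add: abs_minus_commute)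
  qed (use L in simp)
qed

section \<open>Convex functions of one variable that are affine on no interval starting at 0\<close>

lemma convex_subgradient:
  fixes g :: "real \<Rightarrow> real"
  assumes "convex_on UNIV g"
  obtains \<beta> where "\<And>t. g s + \<beta> * (t - s) \<le> g t"
proof -
  have "g y \<ge> g s + Inf ((\<lambda>t. (g s - g t) / (s - t)) ` ({s<..} \<inter> UNIV)) * (y - s)" for y
    by (rule convex_le_Inf_differential[OF assms]) auto
  thus ?thesis using that by blast
qed

text \<open>The affine formulas for longer and longer tails all agree on \<open>{e/2..e}\<close>,
  hence coincide; continuity adds the end point 0.\<close>

lemma affine_on_closed_if_affine_on_tails:
  fixes g :: "real \<Rightarrow> real"
  assumes g: "continuous_on UNIV g" and e: "0 < e"
    and aff: "\<And>\<alpha>. \<lbrakk>0 < \<alpha>; \<alpha> < e\<rbrakk> \<Longrightarrow> \<exists>m q. \<forall>s\<in>{\<alpha>..e}. g s = m + q * s"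
  shows "\<exists>m q. \<forall>s\<in>{0..e}. g s = m + q * s"
proof -
  obtain m q where mq: "\<And>s. s \<in> {e/2..e} \<Longrightarrow> g s = m + q * s" using aff[of "e/2"] e by auto
  define C where "C = {s. g s = m + q * s}"
  have "closed C" unfolding C_def by (intro closed_Collect_eq g continuous_intros)
  moreover have "{0<..<e} \<subseteq> C"
  proof
    fix s assume s: "s \<in> {0<..<e}"
    obtain m' q' where mq': "\<And>t. t \<in> {min s (e/2)..e} \<Longrightarrow> g t = m' + q' * t"
    proof -
      have "0 < min s (e/2)" "min s (e/2) < e" using s e by auto
      thus ?thesis using aff that by blast
    qed
    have "m + q * (e/2) = m' + q' * (e/2)" using mq[of "e/2"] mq'[of "e/2"] e by simp
    moreover have "m + q * e = m' + q' * e" using mq[of e] mq'[of e] e by simp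
    ultimately have "q * e = q' * e" by linarith
    hence "q = q'" using e by simp
    moreover from this have "m = m'" using \<open>m + q * e = m' + q' * e\<close> by simp
    ultimately show "s \<in> C" using mq'[of s] s by (simp add: C_def)
  qed
  ultimately have "closure {0<..<e} \<subseteq> C" by (intro closure_minimal)
  also have "closure {0<..<e} = {0..e}" using e by (rule closure_greaterThanLessThan)
  finally show ?thesis by (auto simp: C_def)
qed

text \<open>By the preceding lemma every \<open>{0..x}\<close> contains a non-affine
  \<open>{\<alpha>..x}\<close> with \<open>\<alpha> > 0\<close>. Iteration produces adjacent
  intervals from right to left; the index \<open>m - i\<close> puts them in increasing
  order.\<close>

lemma nonaffine_intervals:
  fixes g :: "real \<Rightarrow> real"
  assumes g: "continuous_on UNIV g" and e: "0 < e"
    and na: "\<And>e. 0 < e \<Longrightarrow> \<not> (\<exists>m q. \<forall>s\<in>{0..e}. g s = m + q * s)"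
  obtains s :: "nat \<Rightarrow> real" where "0 < s 0" "s m \<le> e"
    "\<And>i. i < m \<Longrightarrow> s i < s (Suc i)"
    "\<And>i. i < m \<Longrightarrow> \<not> (\<exists>m q. \<forall>t\<in>{s i..s (Suc i)}. g t = m + q * t)"
proof -
  have "\<exists>f. \<forall>n. (0 < f n \<and> f n \<le> e) \<and> f (Suc n) < f n \<and> \<not> (\<exists>m q. \<forall>t\<in>{f (Suc n)..f n}. g t = m + q * t)"
  proof (rule dependent_nat_choice)
    show "\<exists>x. 0 < x \<and> x \<le> e" using e by blast
  next
    fix x :: real and n :: nat assume x: "0 < x \<and> x \<le> e"
    then obtain \<alpha> where "0 < \<alpha>" "\<alpha> < x" "\<not> (\<exists>m q. \<forall>t\<in>{\<alpha>..x}. g t = m + q * t)"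
      using affine_on_closed_if_affine_on_tails[OF g, of x] na[of x] by blast
    thus "\<exists>y. (0 < y \<and> y \<le> e) \<and> y < x \<and> \<not> (\<exists>m q. \<forall>t\<in>{y..x}. g t = m + q * t)"
      using x by (intro exI[of _ \<alpha>]) auto
  qed
  then obtain f where f: "\<And>n. 0 < f n" "\<And>n. f n \<le> e" "\<And>n. f (Suc n) < f n"
    "\<And>n. \<not> (\<exists>m q. \<forall>t\<in>{f (Suc n)..f n}. g t = m + q * t)" by blast
  show ?thesis
  proof (rule that[of "\<lambda>i. f (m - i)"])
    fix i assume "i < m"
    hence *: "m - i = Suc (m - Suc i)" by simp
    show "f (m - i) < f (m - Suc i)" unfolding * by (rule f)
    show "\<not> (\<exists>q r. \<forall>t\<in>{f (m - i)..f (m - Suc i)}. g t = q + r * t)" unfolding * by (rule f)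
  qed (use f in auto)
qed

lemma convex_on_nonneg_combination:
  fixes h :: "nat \<Rightarrow> real \<Rightarrow> real"
  assumes "convex_on UNIV f" "\<And>i. i < m \<Longrightarrow> convex_on UNIV (h i)" "\<And>i. i < m \<Longrightarrow> 0 \<le> w i"
  shows "convex_on UNIV (\<lambda>t. f t + (\<Sum>i<m. w i * h i t))"
  using assms
proof (induction m)
  case (Suc m)
  have "convex_on UNIV (\<lambda>t. f t + (\<Sum>i<m. w i * h i t))" using Suc by simp
  moreover have "convex_on UNIV (\<lambda>t. w m * h m t)" using Suc.prems by (intro convex_on_cmul) auto
  ultimately have "convex_on UNIV (\<lambda>t. (f t + (\<Sum>i<m. w i * h i t)) + w m * h m t)"
    by (rule convex_on_add)
  thus ?case by (simp add: add.assoc)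
qed simp

text \<open>The perturbation rescales four pieces of the boundary by independent factors \<open>c\<^sub>0, \<dots>, c\<^sub>3\<close>.
  Two linear conditions on the factors make it compactly supported and a third one makes the
  first variation of the area vanish.\<close>

lemma perturbation_exists:
  fixes g :: "real \<Rightarrow> real"
  assumes g: "convex_on UNIV g" "L-lipschitz_on UNIV g" and e: "0 < e"
    and na: "\<And>e. 0 < e \<Longrightarrow> \<not> (\<exists>m q. \<forall>s\<in>{0..e}. g s = m + q * s)"
  obtains a b \<alpha> \<beta> V t0 E r where "0 < a" "a < b" "b \<le> e"
    "\<And>s. g a + \<alpha> * (s - a) \<le> g s" "\<And>s. g b + \<beta> * (s - b) \<le> g s"
    "\<And>s. s \<le> a \<or> b \<le> s \<Longrightarrow> V s = 0" "continuous_on UNIV V"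
    "0 < t0" "\<And>t. \<bar>t\<bar> \<le> t0 \<Longrightarrow> convex_on UNIV (\<lambda>s. g s + t * V s)"
    "\<And>t s. \<bar>t\<bar> \<le> t0 \<Longrightarrow> g a + \<alpha> * (s - a) \<le> g s + t * V s"
    "\<And>t s. \<bar>t\<bar> \<le> t0 \<Longrightarrow> g b + \<beta> * (s - b) \<le> g s + t * V s"
    "strict_mono (r :: nat \<Rightarrow> nat)"
    "(\<lambda>n. dirichlet a b (r n) g V) \<longlonglongrightarrow> 0" "(\<lambda>n. dirichlet a b (r n) V V) \<longlonglongrightarrow> E"
    "0 < E" "\<And>s. s \<in> {a..b} \<Longrightarrow> (V s)\<^sup>2 \<le> (s - a) * E"
proof -
  have cg: "continuous_on UNIV g" by (rule lipschitz_on_continuous_on[OF g(2)])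
  obtain s :: "nat \<Rightarrow> real" where s0: "0 < s 0" "s 4 \<le> e"
    and s_less: "\<And>i. i < 4 \<Longrightarrow> s i < s (Suc i)"
    and s_na: "\<And>i. i < 4 \<Longrightarrow> \<not> (\<exists>m q. \<forall>t\<in>{s i..s (Suc i)}. g t = m + q * t)"
    using nonaffine_intervals[OF cg e na, of 4] by blast
  define a where "a = s 0"
  define b where "b = s 4"
  have s_mono: "s i \<le> s j" if "i \<le> j" "j \<le> 4" for i j
    using that
  proof (induction j rule: dec_induct)
    case (step n)
    thus ?case using s_less[of n] by simp
  qed simp
  have ab: "a < b" using s_less[of 0] s_mono[of 1 4] by (simp add: a_def b_def)
  have "\<exists>\<beta>. \<forall>t. g (s i) + \<beta> * (t - s i) \<le> g t" for i
    using convex_subgradient[OF g(1)] by metis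
  then obtain X where X: "\<And>i t. g (s i) + X i * (t - s i) \<le> g t" by metis
  \<comment> \<open>\<open>B i\<close> and \<open>X i\<close> are intercept and slope of a
    supporting line \<open>l i\<close> of \<open>g\<close> at the breakpoint
    \<open>s i\<close>.\<close>
  define B where "B i = g (s i) - X i * s i" for i
  define l where "l i t = B i + X i * t" for i t
  have l_le: "l i t \<le> g t" and l_eq: "l i (s i) = g (s i)" for i t
    using X[of i t] by (auto simp: l_def B_def algebra_simps)
  have X_mono: "X i \<le> X (Suc i)" if "i < 4" for i
  proof -
    have "X i * (s (Suc i) - s i) \<le> g (s (Suc i)) - g (s i)" using X[of i "s (Suc i)"] by linarith
    also have "\<dots> \<le> X (Suc i) * (s (Suc i) - s i)"
      using X[of "Suc i" "s i"] by (simp add: algebra_simps)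
    finally show ?thesis using s_less[OF that] by simp
  qed
  have l_mono: "l i t \<le> l (Suc i) t" if "i < 4" "s (Suc i) \<le> t" for i t
  proof -
    have "X i * (t - s (Suc i)) \<le> X (Suc i) * (t - s (Suc i))"
      using X_mono[OF that(1)] that(2) by (intro mult_right_mono) auto
    moreover have "l i (s (Suc i)) \<le> l (Suc i) (s (Suc i))" using l_le l_eq by simp
    ultimately show ?thesis by (simp add: l_def algebra_simps)
  qed
  have l_anti: "l (Suc i) t \<le> l i t" if "i < 4" "t \<le> s i" for i t
  proof -
    have "X i * (s i - t) \<le> X (Suc i) * (s i - t)"
      using X_mono[OF that(1)] that(2) by (intro mult_right_mono) auto
    moreover have "l (Suc i) (s i) \<le> l i (s i)" using l_le l_eq by simp
    ultimately show ?thesis by (simp add: l_def algebra_simps)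
  qed
  \<comment> \<open>The difference \<open>\<phi> i\<close> of consecutive \<open>\<psi>\<close> is
    zero, then \<open>g - l i\<close>, then affine. It is the share of \<open>g\<close> that comes
    from the boundary arc with normals between \<open>s i\<close> and \<open>s (Suc i)\<close>;
    multiplying it by a constant rescales this arc.\<close>
  define \<psi> where "\<psi> i t = (if t \<le> s i then 0 else g t - l i t)" for i t
  define \<phi> where "\<phi> i t = \<psi> i t - \<psi> (Suc i) t" for i t
  have \<psi>_nonneg: "0 \<le> \<psi> i t" for i t using l_le[of i t] by (auto simp: \<psi>_def)
  have \<phi>_left: "\<phi> i t = 0" if "i < 4" "t \<le> s i" for i t
    using that s_less[of i] by (auto simp: \<phi>_def \<psi>_def)
  have \<phi>_mid: "\<phi> i t = g t - l i t" if "i < 4" "s i \<le> t" "t \<le> s (Suc i)" for i t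
    using that l_eq[of i] by (auto simp: \<phi>_def \<psi>_def)
  have \<phi>_right: "\<phi> i t = l (Suc i) t - l i t" if "i < 4" "s (Suc i) \<le> t" for i t
    using that s_less[of i] l_eq[of "Suc i"] by (cases "t = s (Suc i)") (auto simp: \<phi>_def \<psi>_def)
  have \<phi>_convex: "convex_on UNIV (\<phi> i)" if i: "i < 4" for i
  proof -
    \<comment> \<open>\<open>g\<close> continued beyond \<open>s (Suc i)\<close> by its supporting
      line there. Truncating \<open>G\<close> at \<open>s i\<close> gives \<open>\<phi> i\<close>,
      so both truncation lemmas apply.\<close>
    define G where "G t = (if s (Suc i) \<le> t then 0 else g t - (B (Suc i) + X (Suc i) * t)) + l (Suc i) t" for t
    have "convex_on UNIV G" unfolding G_def[abs_def]
      by (intro convex_on_add convex_truncate_left g)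
        (use l_le[of "Suc i"] l_eq[of "Suc i"] in \<open>auto simp: l_def convex_on_def algebra_simps simp flip: distrib_right\<close>)
    hence "convex_on UNIV (\<lambda>t. if t \<le> s i then 0 else G t - (B i + X i * t))"
      using l_le[of i] l_eq[of i] l_mono[OF i] s_less[OF i]
      by (intro convex_truncate_right \<open>convex_on UNIV G\<close>) (auto simp: G_def l_def)
    moreover have "(\<lambda>t. if t \<le> s i then 0 else G t - (B i + X i * t)) = \<phi> i"
    proof
      fix t
      consider "t \<le> s i" | "s i < t" "t < s (Suc i)" | "s i < t" "s (Suc i) \<le> t" by linarith
      thus "(if t \<le> s i then 0 else G t - (B i + X i * t)) = \<phi> i t"
        using \<phi>_left[OF i] \<phi>_mid[OF i] \<phi>_right[OF i] by cases (auto simp: G_def l_def)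
    qed
    ultimately show ?thesis by simp
  qed
  have \<phi>_nonneg: "0 \<le> \<phi> i t" if i: "i < 4" for i t
    using \<phi>_left[OF i, of t] \<phi>_mid[OF i, of t] \<phi>_right[OF i, of t] l_le[of i t] l_mono[OF i, of t]
    by (cases "t \<le> s i"; cases "t \<le> s (Suc i)") auto
  have \<phi>_nonneg': "0 \<le> \<phi> i t - (l (Suc i) t - l i t)" if i: "i < 4" for i t
    using \<phi>_left[OF i, of t] \<phi>_mid[OF i, of t] \<phi>_right[OF i, of t] l_le[of "Suc i" t] l_anti[OF i, of t]
    by (cases "t \<le> s i"; cases "t \<le> s (Suc i)") auto
  \<comment> \<open>What is left of \<open>g\<close> when the four arcs are shrunk to nothing. It is
    still convex and above \<open>l 0\<close>.\<close>
  define \<rho> where "\<rho> t = g t - (\<Sum>i<4. \<phi> i t)" for t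
  have \<phi>_sum: "(\<Sum>i<4. \<phi> i t) = \<psi> 0 t - \<psi> 4 t" for t
    unfolding \<phi>_def by (rule sum_lessThan_telescope'[of "\<lambda>i. \<psi> i t"])
  have \<rho>_eq: "\<rho> t = ((if s 0 \<le> t then 0 else g t - l 0 t) + l 0 t) + \<psi> 4 t" for t
    using l_eq[of 0] by (cases "t = s 0") (auto simp: \<rho>_def \<phi>_sum \<psi>_def)
  have \<rho>_convex: "convex_on UNIV \<rho>"
    unfolding \<rho>_eq[abs_def] \<psi>_def l_def
    by (intro convex_on_add convex_truncate_left convex_truncate_right g)
      (use l_le l_eq in \<open>auto simp: l_def convex_on_def algebra_simps simp flip: distrib_right\<close>)
  have \<rho>_ge: "l 0 t \<le> \<rho> t" for t
    using l_le[of 0 t] \<psi>_nonneg[of 4 t] by (auto simp: \<rho>_eq)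
  have \<psi>_lip: "(L + \<bar>X i\<bar>)-lipschitz_on UNIV (\<psi> i)" for i
    unfolding \<psi>_def l_def using l_eq[of i] by (intro lipschitz_truncate_right g) (simp add: l_def)
  define M where "M i = (L + \<bar>X i\<bar>) + (L + \<bar>X (Suc i)\<bar>)" for i
  have \<phi>_lip: "(M i)-lipschitz_on UNIV (\<phi> i)" for i
    unfolding \<phi>_def M_def by (intro lipschitz_on_diff \<psi>_lip)
  have "\<exists>r :: nat \<Rightarrow> nat. strict_mono r \<and> (\<forall>i<4. convergent (\<lambda>n. dirichlet a b (r n) g (\<phi> i)))"
  proof (rule common_convergent_subsequence)
    fix i
    show "bounded (range (\<lambda>n. dirichlet a b n g (\<phi> i)))"
      using dirichlet_bound[OF g(2) \<phi>_lip ab] unfolding bounded_iff by auto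
  qed
  then obtain r :: "nat \<Rightarrow> nat" where r: "strict_mono r" "\<And>i. i < 4 \<Longrightarrow> convergent (\<lambda>n. dirichlet a b (r n) g (\<phi> i))"
    by blast
  define q where "q i = lim (\<lambda>n. dirichlet a b (r n) g (\<phi> i))" for i
  have q: "(\<lambda>n. dirichlet a b (r n) g (\<phi> i)) \<longlonglongrightarrow> q i" if "i < 4" for i
    using r(2)[OF that] by (simp add: q_def convergent_LIMSEQ_iff)
  \<comment> \<open>The first two equations kill intercept and slope of the affine function that
    \<open>V\<close> equals beyond \<open>b\<close>; the third makes
    \<open>dirichlet a b (r n) g V\<close> tend to 0.\<close>
  obtain c where c: "\<exists>i<4. c i \<noteq> 0" "(\<Sum>i<4. c i * (B (Suc i) - B i)) = 0"
    "(\<Sum>i<4. c i * (X (Suc i) - X i)) = 0" "(\<Sum>i<4. c i * q i) = 0"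
    by (rule homogeneous_system_3_4[of "\<lambda>i. B (Suc i) - B i" "\<lambda>i. X (Suc i) - X i" q])
  have l_sum: "(\<Sum>i\<in>A. c i * (l (Suc i) t - l i t)) =
      (\<Sum>i\<in>A. c i * (B (Suc i) - B i)) + (\<Sum>i\<in>A. c i * (X (Suc i) - X i)) * t" for A :: "nat set" and t
  proof -
    have "l (Suc i) t - l i t = (B (Suc i) - B i) + (X (Suc i) - X i) * t" for i
      by (simp add: l_def algebra_simps)
    thus ?thesis by (simp only: distrib_left sum.distrib sum_distrib_right mult.assoc)
  qed
  have c_l: "(\<Sum>i<4. c i * (l (Suc i) t - l i t)) = 0" for t
    using c by (simp add: l_sum)
  define V where "V t = (\<Sum>i<4. c i * \<phi> i t)" for t
  have V_zero: "V t = 0" if "t \<le> a \<or> b \<le> t" for t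
    using that
  proof
    assume "t \<le> a"
    hence "\<phi> i t = 0" if "i < 4" for i
      using \<phi>_left[OF that] s_mono[of 0 i] that by (simp add: a_def)
    thus ?thesis by (simp add: V_def)
  next
    assume "b \<le> t"
    hence "\<phi> i t = l (Suc i) t - l i t" if "i < 4" for i
      using \<phi>_right[OF that] s_mono[of "Suc i" 4] that by (simp add: b_def)
    thus ?thesis using c_l[of t] by (simp add: V_def)
  qed
  have V_cont: "continuous_on UNIV V" unfolding V_def
    using lipschitz_on_continuous_on[OF \<phi>_lip] by (intro continuous_intros)
  have "\<exists>M. M-lipschitz_on UNIV (\<lambda>t. \<Sum>i<m. c i * \<phi> i t)" for m :: nat
  proof (induction m)
    case 0
    have "0-lipschitz_on UNIV (\<lambda>t::real. 0::real)" by (rule lipschitz_onI) auto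
    thus ?case by auto
  next
    case (Suc m)
    then obtain K where "K-lipschitz_on UNIV (\<lambda>t. \<Sum>i<m. c i * \<phi> i t)" by blast
    moreover have "(\<bar>c m\<bar> * M m)-lipschitz_on UNIV (\<lambda>t. c m * \<phi> m t)"
      using lipschitz_on_cmult_real[OF \<phi>_lip[of m], of "c m"] by simp
    ultimately have "(K + \<bar>c m\<bar> * M m)-lipschitz_on UNIV (\<lambda>t. (\<Sum>i<m. c i * \<phi> i t) + c m * \<phi> m t)"
      by (rule lipschitz_on_add)
    thus ?case by auto
  qed
  then obtain K where K: "K-lipschitz_on UNIV V" unfolding V_def by blast
  have "bounded (range (\<lambda>n. dirichlet a b (r n) V V))"
    using dirichlet_bound[OF K K ab] unfolding bounded_iff by auto
  then obtain E r' where r': "strict_mono r'" "((\<lambda>n. dirichlet a b (r n) V V) \<circ> r') \<longlonglongrightarrow> E"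
    using bounded_imp_convergent_subsequence by blast
  have rr: "strict_mono (r \<circ> r')" by (intro strict_mono_o r r')
  have limV: "(\<lambda>n. dirichlet a b ((r \<circ> r') n) V V) \<longlonglongrightarrow> E" using r'(2) by (simp add: o_def)
  have limgV: "(\<lambda>n. dirichlet a b ((r \<circ> r') n) g V) \<longlonglongrightarrow> 0"
  proof -
    have "(\<lambda>n. \<Sum>i<4. c i * dirichlet a b (r n) g (\<phi> i)) \<longlonglongrightarrow> (\<Sum>i<4. c i * q i)"
      by (intro tendsto_intros q) auto
    hence "(\<lambda>n. dirichlet a b (r n) g V) \<longlonglongrightarrow> 0"
      unfolding V_def dirichlet_sum_right using c(4) by simp
    from LIMSEQ_subseq_LIMSEQ[OF this r'(1)] show ?thesis by (simp add: o_def)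
  qed
  have V_le: "(V t)\<^sup>2 \<le> (t - a) * E" if "t \<in> {a..b}" for t
    using square_le_dirichlet_limit[OF ab _ V_cont rr limV that] V_zero by simp
  \<comment> \<open>On an interval with \<open>c i \<noteq> 0\<close> the other pieces contribute
    affine functions only. If \<open>V\<close> vanished there, \<open>g\<close> would be affine
    there, against \<open>s_na\<close>. A point with \<open>V t \<noteq> 0\<close> forces
    \<open>E > 0\<close> by \<open>V_le\<close>.\<close>
  have "0 < E"
  proof -
    obtain i where i: "i < 4" "c i \<noteq> 0" using c(1) by blast
    have "\<exists>t\<in>{s i..s (Suc i)}. V t \<noteq> 0"
    proof (rule ccontr)
      assume "\<not> ?thesis"
      hence V0: "V t = 0" if "t \<in> {s i..s (Suc i)}" for t using that by blast
      define m where "m = B i - (\<Sum>j<i. c j * (B (Suc j) - B j)) / c i"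
      define k where "k = X i - (\<Sum>j<i. c j * (X (Suc j) - X j)) / c i"
      have "g t = m + k * t" if t: "t \<in> {s i..s (Suc i)}" for t
      proof -
        have split: "{..<4} = {..<i} \<union> {i} \<union> {Suc i..<4}" using i by auto
        have "V t = (\<Sum>j<i. c j * \<phi> j t) + c i * \<phi> i t + (\<Sum>j=Suc i..<4. c j * \<phi> j t)"
          unfolding V_def split by (subst sum.union_disjoint; simp?)+ auto
        also have "(\<Sum>j<i. c j * \<phi> j t) = (\<Sum>j<i. c j * (l (Suc j) t - l j t))"
        proof (intro sum.cong refl)
          fix j assume "j \<in> {..<i}"
          hence "\<phi> j t = l (Suc j) t - l j t"
            using \<phi>_right[of j t] s_mono[of "Suc j" i] t i by simp
          thus "c j * \<phi> j t = c j * (l (Suc j) t - l j t)" by simp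
        qed
        also have "(\<Sum>j=Suc i..<4. c j * \<phi> j t) = 0"
        proof (intro sum.neutral ballI)
          fix j assume "j \<in> {Suc i..<4}"
          hence "\<phi> j t = 0" using \<phi>_left[of j t] s_mono[of "Suc i" j] t i by simp
          thus "c j * \<phi> j t = 0" by simp
        qed
        also have "\<phi> i t = g t - l i t" using \<phi>_mid[OF i(1)] t by simp
        also have "(\<Sum>j<i. c j * (l (Suc j) t - l j t)) =
            (\<Sum>j<i. c j * (B (Suc j) - B j)) + (\<Sum>j<i. c j * (X (Suc j) - X j)) * t"
          by (rule l_sum)
        finally have "c i * g t = c i * l i t - (\<Sum>j<i. c j * (B (Suc j) - B j)) - (\<Sum>j<i. c j * (X (Suc j) - X j)) * t"
          using V0[OF t] by (simp add: algebra_simps)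
        hence "g t = (c i * l i t - (\<Sum>j<i. c j * (B (Suc j) - B j)) - (\<Sum>j<i. c j * (X (Suc j) - X j)) * t) / c i"
          using i by (simp add: field_simps)
        also have "\<dots> = m + k * t"
        proof -
          have "(w * (x + y * t) - u - v * t) / w = (x - u / w) + (y - v / w) * t"
            if "w \<noteq> 0" for u v w x y :: real
            using that by (simp add: field_simps)
          thus ?thesis unfolding m_def k_def l_def using i(2) by blast
        qed
        finally show ?thesis .
      qed
      thus False using s_na[OF i(1)] by blast
    qed
    then obtain t where t: "t \<in> {s i..s (Suc i)}" "V t \<noteq> 0" by blast
    have "t \<in> {a..b}" using t s_mono[of 0 i] s_mono[of "Suc i" 4] i by (auto simp: a_def b_def)
    hence "0 < (t - a) * E" using V_le[of t] t(2) by (smt (verit) zero_less_power2)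
    moreover have "0 \<le> t - a" using \<open>t \<in> {a..b}\<close> by simp
    ultimately show ?thesis by (simp add: zero_less_mult_iff)
  qed
  \<comment> \<open>Keeps every scaling factor \<open>1 + t * c i\<close> nonnegative, hence the
    perturbed function convex.\<close>
  define t0 where "t0 = 1 / (1 + (\<Sum>i<4. \<bar>c i\<bar>))"
  have t0_pos: "0 < t0" unfolding t0_def by (intro divide_pos_pos add_pos_nonneg sum_nonneg) auto
  have w: "0 \<le> 1 + t * c i" if "\<bar>t\<bar> \<le> t0" "i < 4" for t i
  proof -
    have "\<bar>c i\<bar> \<le> (\<Sum>i<4. \<bar>c i\<bar>)" using that by (intro member_le_sum) auto
    hence "\<bar>t\<bar> * \<bar>c i\<bar> \<le> t0 * (1 + (\<Sum>i<4. \<bar>c i\<bar>))" using that t0_pos by (intro mult_mono) auto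
    also have "\<dots> = 1"
    proof -
      have "0 < 1 + (\<Sum>i<4. \<bar>c i\<bar>)" by (intro add_pos_nonneg sum_nonneg) auto
      thus ?thesis by (simp add: t0_def)
    qed
    finally have "\<bar>t * c i\<bar> \<le> 1" by (simp add: abs_mult)
    thus ?thesis by linarith
  qed
  have decomp: "g x + t * V x = \<rho> x + (\<Sum>i<4. (1 + t * c i) * \<phi> i x)" for t x
    by (simp add: \<rho>_def V_def distrib_right sum.distrib sum_distrib_left algebra_simps)
  show ?thesis
  proof (rule that[of a b "X 0" "X 4" V t0 "r \<circ> r'" E])
    fix t x :: real assume t: "\<bar>t\<bar> \<le> t0"
    show "convex_on UNIV (\<lambda>x. g x + t * V x)"
      unfolding decomp by (intro convex_on_nonneg_combination \<rho>_convex \<phi>_convex w[OF t])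
    have "0 \<le> (\<Sum>i<4. (1 + t * c i) * \<phi> i x)"
      using w[OF t] \<phi>_nonneg by (intro sum_nonneg mult_nonneg_nonneg) auto
    hence "l 0 x \<le> g x + t * V x" unfolding decomp using \<rho>_ge[of x] by simp
    thus "g a + X 0 * (x - a) \<le> g x + t * V x" by (simp add: l_def B_def a_def algebra_simps)
    \<comment> \<open>The same estimate from the right end: the arcs are measured against
      \<open>l (Suc i)\<close>. The lines telescope to \<open>l 4 - l 0\<close>, and their
      combination with coefficients \<open>c i\<close> is zero by \<open>c_l\<close>.\<close>
    have "0 \<le> (\<Sum>i<4. (1 + t * c i) * (\<phi> i x - (l (Suc i) x - l i x)))"
      using w[OF t] \<phi>_nonneg' by (intro sum_nonneg mult_nonneg_nonneg) auto
    also have "\<dots> = (\<Sum>i<4. (1 + t * c i) * \<phi> i x) - (\<Sum>i<4. l (Suc i) x - l i x) - t * (\<Sum>i<4. c i * (l (Suc i) x - l i x))"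
      by (simp add: sum_distrib_left algebra_simps flip: sum_subtractf sum.distrib)
    also have "(\<Sum>i<4. l (Suc i) x - l i x) = l 4 x - l 0 x"
      by (rule sum_lessThan_telescope)
    finally have "l 4 x - l 0 x \<le> (\<Sum>i<4. (1 + t * c i) * \<phi> i x)" using c_l[of x] by simp
    hence "l 4 x \<le> g x + t * V x" unfolding decomp using \<rho>_ge[of x] by simp
    thus "g b + X 4 * (x - b) \<le> g x + t * V x" by (simp add: l_def B_def b_def algebra_simps)
  qed (use s0 ab X V_zero V_cont t0_pos rr limV limgV V_le \<open>0 < E\<close> in \<open>auto simp: a_def b_def\<close>)
qed

subsection \<open>Slices of planar sets\<close>

text \<open>An orthonormal frame. The directions with positive \<open>u\<close>-component are the
  positive multiples of \<open>u + s *\<^sub>R \<tau>\<close>, so on this half-plane a support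
  function amounts to a convex function of the single variable \<open>s\<close>.\<close>

locale frame =
  fixes u \<tau> :: "real^2"
  assumes uu: "u \<bullet> u = 1" and tt: "\<tau> \<bullet> \<tau> = 1" and ut: "u \<bullet> \<tau> = 0"
begin

lemma tu: "\<tau> \<bullet> u = 0"
  using ut by (simp add: inner_commute)

lemma expand: "y = (y \<bullet> \<tau>) *\<^sub>R \<tau> + (y \<bullet> u) *\<^sub>R u"
proof -
  have ne: "u \<noteq> \<tau>" "u \<noteq> 0" "\<tau> \<noteq> 0" using uu tt ut by auto
  have "independent {u, \<tau>}"
    using ut tu ne by (intro pairwise_orthogonal_independent) (auto simp: pairwise_def orthogonal_def)
  hence "span {u, \<tau>} = UNIV"
    using card_ge_dim_independent[of "{u, \<tau>}" UNIV] ne by (auto simp: card_insert_if)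
  moreover define w where "w = y - ((y \<bullet> \<tau>) *\<^sub>R \<tau> + (y \<bullet> u) *\<^sub>R u)"
  have "w \<bullet> u = 0" "w \<bullet> \<tau> = 0"
    by (simp_all add: w_def inner_diff_left inner_add_left uu tt ut tu)
  hence "\<And>z. z \<in> {u, \<tau>} \<Longrightarrow> orthogonal w z" by (auto simp: orthogonal_def)
  ultimately have "orthogonal w w" using orthogonal_to_span[of w "{u, \<tau>}" w] by auto
  hence "w = 0" by (simp add: orthogonal_def)
  thus ?thesis by (simp add: w_def)
qed

lemma inner_expand: "x \<bullet> y = (x \<bullet> \<tau>) * (y \<bullet> \<tau>) + (x \<bullet> u) * (y \<bullet> u)"
  by (subst expand[of x]) (simp add: inner_add_left inner_commute[of y])

lemma inner_dir [simp]: "(u + s *\<^sub>R \<tau>) \<bullet> y = y \<bullet> u + s * (y \<bullet> \<tau>)"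
  by (simp add: inner_add_left inner_commute[of y])

lemma inner_comb [simp]:
  "(x *\<^sub>R \<tau> + y *\<^sub>R u) \<bullet> \<tau> = x" "(x *\<^sub>R \<tau> + y *\<^sub>R u) \<bullet> u = y"
  by (simp_all add: inner_add_left uu tt ut tu)

lemma dir_decomp:
  assumes "0 < \<theta> \<bullet> u"
  shows "\<theta> = (\<theta> \<bullet> u) *\<^sub>R (u + ((\<theta> \<bullet> \<tau>) / (\<theta> \<bullet> u)) *\<^sub>R \<tau>)"
  using assms expand[of \<theta>] by (simp add: scaleR_add_right add.commute)

lemma norm_le: "norm y \<le> \<bar>y \<bullet> u\<bar> + \<bar>y \<bullet> \<tau>\<bar>"
proof -
  have "norm u = 1" "norm \<tau> = 1" using uu tt by (auto simp: norm_eq_1)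
  thus ?thesis
    using norm_triangle_ineq[of "(y \<bullet> \<tau>) *\<^sub>R \<tau>" "(y \<bullet> u) *\<^sub>R u"] expand[of y] by simp
qed

text \<open>Homogeneity gives the inequality on the half-plane around \<open>u\<close>. For any
  other \<open>\<theta>\<close>, a small multiple added to the touching direction stays in that
  half-plane, and by subadditivity the touching value cancels.\<close>

lemma sub_line_mem:
  assumes K: "convex_body K" and a: "(u + a *\<^sub>R \<tau>) \<bullet> p = support_function K (u + a *\<^sub>R \<tau>)"
    and le: "\<And>s. (u + s *\<^sub>R \<tau>) \<bullet> p \<le> support_function K (u + s *\<^sub>R \<tau>)"
  shows "p \<in> K"
proof (rule mem_if_le_support_function[OF K])
  fix \<theta> :: "real^2"
  have pos: "x \<bullet> p \<le> support_function K x" if "0 < x \<bullet> u" for x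
    using le[of "(x \<bullet> \<tau>) / (x \<bullet> u)"] that
    by (subst (1 2) dir_decomp[OF that])
      (simp add: support_function_scaleR[OF K] del: inner_dir scaleR_add_right)
  define e where "e = 1 / (1 + \<bar>\<theta> \<bullet> u\<bar>)"
  have e: "0 < e" by (simp add: e_def add_pos_nonneg)
  have "e * \<bar>\<theta> \<bullet> u\<bar> < 1" by (simp add: e_def)
  hence "\<bar>e * (\<theta> \<bullet> u)\<bar> < 1" using e by (simp only: abs_mult abs_of_pos)
  moreover have "(u + a *\<^sub>R \<tau> + e *\<^sub>R \<theta>) \<bullet> u = 1 + e * (\<theta> \<bullet> u)"
    by (simp add: inner_add_left uu tu del: inner_dir)
  ultimately have "0 < (u + a *\<^sub>R \<tau> + e *\<^sub>R \<theta>) \<bullet> u" by linarith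
  from pos[OF this] have "(u + a *\<^sub>R \<tau>) \<bullet> p + e * (\<theta> \<bullet> p) \<le> support_function K (u + a *\<^sub>R \<tau> + e *\<^sub>R \<theta>)"
    by (simp add: inner_add_left)
  also have "\<dots> \<le> support_function K (u + a *\<^sub>R \<tau>) + e * support_function K \<theta>"
    using support_function_add_le[OF K, of "u + a *\<^sub>R \<tau>" "e *\<^sub>R \<theta>"] support_function_scaleR[OF K, of e \<theta>] e
    by simp
  finally have "e * (\<theta> \<bullet> p) \<le> e * support_function K \<theta>" using a by simp
  thus "\<theta> \<bullet> p \<le> support_function K \<theta>" using e by simp
qed

lemma convex_on_support_line:
  assumes "convex_body K"
  shows "convex_on UNIV (\<lambda>s. support_function K (u + s *\<^sub>R \<tau>))"
proof (rule convex_onI)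
  fix t x y :: real assume t: "0 < t" "t < 1"
  have "u + ((1 - t) *\<^sub>R x + t *\<^sub>R y) *\<^sub>R \<tau> = (1 - t) *\<^sub>R (u + x *\<^sub>R \<tau>) + t *\<^sub>R (u + y *\<^sub>R \<tau>)"
    by (simp add: algebra_simps)
  thus "support_function K (u + ((1 - t) *\<^sub>R x + t *\<^sub>R y) *\<^sub>R \<tau>)
      \<le> (1 - t) * support_function K (u + x *\<^sub>R \<tau>) + t * support_function K (u + y *\<^sub>R \<tau>)"
    using support_function_add_le[OF assms, of "(1 - t) *\<^sub>R (u + x *\<^sub>R \<tau>)" "t *\<^sub>R (u + y *\<^sub>R \<tau>)"] t
    by (simp add: support_function_scaleR[OF assms])
qed simp

lemma lipschitz_support_line:
  assumes "convex_body K" "K \<subseteq> cball 0 R" "0 \<le> R"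
  shows "R-lipschitz_on UNIV (\<lambda>s. support_function K (u + s *\<^sub>R \<tau>))"
proof (rule lipschitz_onI[OF _ assms(3)])
  fix s t :: real
  have "norm \<tau> = 1" using tt by (simp add: norm_eq_1)
  hence "norm (u + s *\<^sub>R \<tau> - (u + t *\<^sub>R \<tau>)) = \<bar>s - t\<bar>"
    by (simp flip: scaleR_diff_left)
  thus "dist (support_function K (u + s *\<^sub>R \<tau>)) (support_function K (u + t *\<^sub>R \<tau>)) \<le> R * dist s t"
    using support_function_lipschitz[OF assms(1,2), of "u + s *\<^sub>R \<tau>" "u + t *\<^sub>R \<tau>"]
    by (simp add: dist_real_def)
qed

definition slice :: "(real^2) set \<Rightarrow> real \<Rightarrow> real set" where
  "slice K x = {y. x *\<^sub>R \<tau> + y *\<^sub>R u \<in> K}"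

lemma bounded_slice:
  assumes "bounded K"
  shows "bounded (slice K x)"
proof -
  obtain R where R: "\<And>y. y \<in> K \<Longrightarrow> norm y \<le> R" using assms bounded_iff by blast
  have nu: "norm u = 1" using uu by (simp add: norm_eq_1)
  have "norm y \<le> R" if "y \<in> slice K x" for y
  proof -
    have "norm (x *\<^sub>R \<tau> + y *\<^sub>R u) \<le> R" using that R by (auto simp: slice_def)
    moreover have "\<bar>(x *\<^sub>R \<tau> + y *\<^sub>R u) \<bullet> u\<bar> \<le> norm (x *\<^sub>R \<tau> + y *\<^sub>R u) * norm u"
      by (rule Cauchy_Schwarz_ineq2)
    ultimately show ?thesis using nu by simp
  qed
  thus ?thesis by (auto simp: bounded_iff)
qed

lemma slice_interval:
  assumes "convex_body K"
  obtains lo hi where "slice K x = {lo..hi}"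
proof -
  have "closed (slice K x)"
    unfolding slice_def using assms
    by (intro closed_vimage[of K, unfolded vimage_def] continuous_intros)
      (auto simp: convex_body_def compact_imp_closed)
  moreover have "bounded (slice K x)"
    using assms by (intro bounded_slice compact_imp_bounded) (simp add: convex_body_def)
  moreover have "convex (slice K x)"
  proof (rule convexI)
    fix y z s t :: real assume yz: "y \<in> slice K x" "z \<in> slice K x" and st: "0 \<le> s" "0 \<le> t" "s + t = 1"
    have "s *\<^sub>R (x *\<^sub>R \<tau> + y *\<^sub>R u) + t *\<^sub>R (x *\<^sub>R \<tau> + z *\<^sub>R u) \<in> K"
      by (rule convexD) (use yz st assms in \<open>auto simp: slice_def convex_body_def\<close>)
    also have "s *\<^sub>R (x *\<^sub>R \<tau> + y *\<^sub>R u) + t *\<^sub>R (x *\<^sub>R \<tau> + z *\<^sub>R u) =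
        (s + t) *\<^sub>R x *\<^sub>R \<tau> + (s * y + t * z) *\<^sub>R u"
      by (simp add: algebra_simps)
    finally show "s *\<^sub>R y + t *\<^sub>R z \<in> slice K x" using st by (simp add: slice_def)
  qed
  ultimately show ?thesis
    using connected_compact_interval_1[of "slice K x"] that convex_connected compact_eq_bounded_closed
    by metis
qed

end

text \<open>Carries Fubini's theorem from \<open>real \<times> real\<close> over to
  \<open>real^2\<close>.\<close>

lemma distr_lborel_vector: "distr (lborel :: (real \<times> real) measure) borel (\<lambda>z. vector [fst z, snd z] :: real^2) = lborel"
proof -
  let ?f = "\<lambda>z :: real \<times> real. vector [fst z, snd z] :: real^2"
  have f_eq: "?f = (\<lambda>z. fst z *\<^sub>R axis 1 1 + snd z *\<^sub>R axis 2 1)"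
    by (auto simp: fun_eq_iff vec_eq_iff forall_2 axis_def)
  have f: "?f \<in> borel_measurable borel"
    unfolding f_eq by (intro borel_measurable_continuous_onI continuous_intros)
  show ?thesis
  proof (rule lborel_eqI[symmetric])
    fix l r :: "real^2" assume lr: "\<And>b. b \<in> Basis \<Longrightarrow> l \<bullet> b \<le> r \<bullet> b"
    have le: "l $ i \<le> r $ i" for i using lr[of "axis i 1"] by (simp add: inner_axis axis_in_Basis_iff)
    have "?f -` box l r \<inter> space lborel = box (l $ 1) (r $ 1) \<times> box (l $ 2) (r $ 2)"
      by (auto simp: mem_box_cart forall_2 mem_box)
    hence "emeasure (distr lborel borel ?f) (box l r) =
        emeasure (lborel \<Otimes>\<^sub>M lborel) (box (l $ 1) (r $ 1) \<times> box (l $ 2) (r $ 2))"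
      using f by (subst emeasure_distr) (simp_all add: lborel_prod)
    also have "\<dots> = emeasure lborel (box (l $ 1) (r $ 1)) * emeasure lborel (box (l $ 2) (r $ 2))"
      by (rule lborel.emeasure_pair_measure_Times) auto
    also have "\<dots> = ennreal ((r $ 1 - l $ 1) * (r $ 2 - l $ 2))"
      using le by (simp add: ennreal_mult)
    also have "(r $ 1 - l $ 1) * (r $ 2 - l $ 2) = (\<Prod>b\<in>Basis. (r - l) \<bullet> b)"
      by (simp add: Basis_vec_def UNIV_2 inner_axis axis_eq_axis)
    finally show "emeasure (distr lborel borel ?f) (box l r) = ennreal (\<Prod>b\<in>Basis. (r - l) \<bullet> b)" .
  qed simp
qed

context frame
begin

text \<open>Cavalieri's principle after a rotation of the frame to the coordinate axes. It reduces
  the comparison of two areas to a comparison of intervals.\<close>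

lemma area_slices:
  assumes K: "compact K"
  shows "integrable lborel (\<lambda>x. measure lborel (slice K x))"
    and "area K = (\<integral>x. measure lborel (slice K x) \<partial>lborel)"
proof -
  define T :: "real^2 \<Rightarrow> real^2" where "T v = (v $ 1) *\<^sub>R \<tau> + (v $ 2) *\<^sub>R u" for v
  have T: "orthogonal_transformation T"
    unfolding orthogonal_transformation_def
  proof (intro conjI allI)
    show "linear T" by (rule linearI) (auto simp: T_def algebra_simps)
    fix v w
    have "T v \<bullet> T w = v $ 1 * w $ 1 + v $ 2 * w $ 2"
      unfolding T_def by (subst inner_expand) simp
    thus "T v \<bullet> T w = v \<bullet> w" by (simp add: inner_vec_def sum_2)
  qed
  define K' where "K' = T -` K"
  have "surj T" using T by (rule orthogonal_transformation_surj)
  hence TK: "T ` K' = K" by (simp add: K'_def surj_image_vimage_eq)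
  have "linear T" using T by (simp add: orthogonal_transformation_def)
  have K': "closed K'" unfolding K'_def
    using K \<open>linear T\<close> by (intro closed_vimage compact_imp_closed linear_continuous_on linear_conv_bounded_linear[THEN iffD1])
  have norm_T: "norm (T v) = norm v" for v using T by (simp add: orthogonal_transformation_norm)
  have bK': "bounded K'"
  proof -
    obtain R where "\<forall>x\<in>K. norm x \<le> R" using K compact_imp_bounded bounded_iff by blast
    hence "\<forall>x\<in>K'. norm x \<le> R" using norm_T by (auto simp: K'_def)
    thus ?thesis by (auto simp: bounded_iff)
  qed
  have cK': "compact K'" using K' bK' by (simp add: compact_eq_bounded_closed)
  have "area K = measure lebesgue K'"
    using measure_orthogonal_image[OF T lmeasurable_compact[OF cK']] TK by (simp add: area_def)
  also have "\<dots> = measure lborel K'" using K' by (simp add: measure_completion)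
  finally have area: "area K = measure lborel K'" .
  let ?f = "\<lambda>z :: real \<times> real. vector [fst z, snd z] :: real^2"
  have f_eq: "?f = (\<lambda>z. fst z *\<^sub>R axis 1 1 + snd z *\<^sub>R axis 2 1)"
    by (auto simp: fun_eq_iff vec_eq_iff forall_2 axis_def)
  have cf: "continuous_on UNIV ?f" unfolding f_eq by (intro continuous_intros)
  define A where "A = ?f -` K'"
  have A: "A \<in> sets (lborel \<Otimes>\<^sub>M lborel)"
    unfolding A_def lborel_prod using closed_vimage[OF K' cf] by simp
  have slice: "Pair x -` A = slice K x" for x
    by (auto simp: A_def K'_def T_def slice_def)
  have "emeasure lborel K' = emeasure (distr lborel borel ?f) K'" by (simp add: distr_lborel_vector)
  also have "\<dots> = emeasure (lborel \<Otimes>\<^sub>M lborel) A"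
    using K' cf by (subst emeasure_distr) (auto simp: A_def lborel_prod intro: borel_measurable_continuous_onI)
  also have "\<dots> = (\<integral>\<^sup>+x. emeasure lborel (slice K x) \<partial>lborel)"
    using lborel.emeasure_pair_measure_alt[OF A] by (simp add: slice)
  finally have em: "emeasure lborel K' = (\<integral>\<^sup>+x. emeasure lborel (slice K x) \<partial>lborel)" .
  have slice_meas: "(\<lambda>x. emeasure lborel (slice K x)) \<in> borel_measurable lborel"
    using lborel.measurable_emeasure_Pair[OF A] by (simp add: slice)
  have "emeasure lborel (slice K x) \<noteq> \<infinity>" for x
    using emeasure_bounded_finite[OF bounded_slice[OF compact_imp_bounded[OF K]]] by (auto simp: less_top)
  hence enn: "emeasure lborel (slice K x) = ennreal (measure lborel (slice K x))" for x
    by (simp add: emeasure_eq_ennreal_measure)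
  have meas: "(\<lambda>x. measure lborel (slice K x)) \<in> borel_measurable lborel"
    using slice_meas by (simp add: measure_def)
  have fin: "emeasure lborel K' < \<infinity>" using bK' emeasure_bounded_finite by blast
  show int: "integrable lborel (\<lambda>x. measure lborel (slice K x))"
    using fin meas unfolding em enn by (intro integrableI_nonneg) auto
  have "emeasure lborel K' = ennreal (\<integral>x. measure lborel (slice K x) \<partial>lborel)"
    unfolding em enn by (rule nn_integral_eq_integral[OF int]) simp
  hence "measure lborel K' = enn2real (ennreal (\<integral>x. measure lborel (slice K x) \<partial>lborel))"
    by (simp only: measure_def)
  thus "area K = (\<integral>x. measure lborel (slice K x) \<partial>lborel)"
    unfolding area by (simp add: integral_nonneg_AE)
qed

end

subsection \<open>Replacing a boundary arc\<close>

text \<open>\<open>G\<close> is to replace the support function of \<open>K\<close> between the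
  slopes \<open>a\<close> and \<open>b\<close>, where \<open>p\<close> and \<open>q\<close> are
  contact points. Its last two conditions keep \<open>p\<close> and \<open>q\<close> in the new
  body, so that only the arc between them moves.\<close>

locale surgery = frame +
  fixes K :: "(real^2) set" and a b :: real and p q :: "real^2" and G :: "real \<Rightarrow> real"
  assumes K: "convex_body K" and ab: "a < b"
    and p: "p \<in> K" "p \<bullet> u + a * (p \<bullet> \<tau>) = support_function K (u + a *\<^sub>R \<tau>)"
    and q: "q \<in> K" "q \<bullet> u + b * (q \<bullet> \<tau>) = support_function K (u + b *\<^sub>R \<tau>)"
    and G: "convex_on UNIV G" "\<And>s. s \<le> a \<or> b \<le> s \<Longrightarrow> G s = support_function K (u + s *\<^sub>R \<tau>)"
      "\<And>s. p \<bullet> u + s * (p \<bullet> \<tau>) \<le> G s" "\<And>s. q \<bullet> u + s * (q \<bullet> \<tau>) \<le> G s"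
begin

text \<open>The Wulff shape of the prescribed values. A Wulff shape may have a smaller support
  function than prescribed; the two lemmas on supports below show that here every value is
  attained.\<close>

definition modified :: "(real^2) set" where
  "modified = {y. (\<forall>\<theta>. \<theta> \<bullet> u \<le> 0 \<longrightarrow> \<theta> \<bullet> y \<le> support_function K \<theta>) \<and>
     (\<forall>s. y \<bullet> u + s * (y \<bullet> \<tau>) \<le> G s)}"

lemma le_support: "y \<in> K \<Longrightarrow> y \<bullet> u + s * (y \<bullet> \<tau>) \<le> support_function K (u + s *\<^sub>R \<tau>)"
  using support_function_upper[OF K, of y "u + s *\<^sub>R \<tau>"] by simp

lemma line_at_ends: "p \<bullet> u + a * (p \<bullet> \<tau>) = G a" "q \<bullet> u + b * (q \<bullet> \<tau>) = G b"
  using p q G(2) by auto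

text \<open>To the left of \<open>p\<close> the constraint of slope \<open>a\<close> is decisive:
  increasing the slope raises the line of \<open>p\<close> at least as fast as that of
  \<open>y\<close>. To the right of \<open>q\<close> the same holds with \<open>b\<close>.\<close>

lemma outside_le:
  assumes "p \<bullet> \<tau> \<ge> y \<bullet> \<tau> \<and> y \<bullet> u + a * (y \<bullet> \<tau>) \<le> G a \<or> q \<bullet> \<tau> \<le> y \<bullet> \<tau> \<and> y \<bullet> u + b * (y \<bullet> \<tau>) \<le> G b"
    and s: "a < s" "s < b"
  shows "y \<bullet> u + s * (y \<bullet> \<tau>) \<le> p \<bullet> u + s * (p \<bullet> \<tau>) \<or> y \<bullet> u + s * (y \<bullet> \<tau>) \<le> q \<bullet> u + s * (q \<bullet> \<tau>)"
  using assms(1)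
proof
  assume *: "p \<bullet> \<tau> \<ge> y \<bullet> \<tau> \<and> y \<bullet> u + a * (y \<bullet> \<tau>) \<le> G a"
  have "(s - a) * (y \<bullet> \<tau>) \<le> (s - a) * (p \<bullet> \<tau>)" using * s by (intro mult_left_mono) auto
  hence "y \<bullet> u + s * (y \<bullet> \<tau>) \<le> p \<bullet> u + s * (p \<bullet> \<tau>)" using * line_at_ends(1) by (simp add: algebra_simps)
  thus ?thesis ..
next
  assume *: "q \<bullet> \<tau> \<le> y \<bullet> \<tau> \<and> y \<bullet> u + b * (y \<bullet> \<tau>) \<le> G b"
  have "(b - s) * (q \<bullet> \<tau>) \<le> (b - s) * (y \<bullet> \<tau>)" using * s by (intro mult_left_mono) auto
  hence "y \<bullet> u + s * (y \<bullet> \<tau>) \<le> q \<bullet> u + s * (q \<bullet> \<tau>)" using * line_at_ends(2) by (simp add: algebra_simps)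
  thus ?thesis ..
qed

lemma modified_I:
  assumes y: "y \<in> K" and "\<And>s. a < s \<Longrightarrow> s < b \<Longrightarrow> y \<bullet> u + s * (y \<bullet> \<tau>) \<le> G s"
  shows "y \<in> modified"
  unfolding modified_def
proof (safe intro!: support_function_upper[OF K y])
  fix s
  show "y \<bullet> u + s * (y \<bullet> \<tau>) \<le> G s"
    using assms(2)[of s] le_support[OF y, of s] G(2)[of s] by (cases "s \<le> a \<or> b \<le> s") auto
qed

lemma modified_outside:
  assumes y: "y \<in> K" and "y \<bullet> \<tau> \<le> p \<bullet> \<tau> \<or> q \<bullet> \<tau> \<le> y \<bullet> \<tau>"
  shows "y \<in> modified"
proof (rule modified_I[OF y])
  fix s assume s: "a < s" "s < b"
  have "y \<bullet> u + a * (y \<bullet> \<tau>) \<le> G a" "y \<bullet> u + b * (y \<bullet> \<tau>) \<le> G b"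
    using le_support[OF y] G(2) by auto
  thus "y \<bullet> u + s * (y \<bullet> \<tau>) \<le> G s" using outside_le[OF _ s, of y] assms(2) G(3)[of s] G(4)[of s] by auto
qed

text \<open>The chord from \<open>p\<close> to \<open>q\<close> lies in the old body and obeys all
  constraints of \<open>G\<close>, so every slice between them has a point common to both
  bodies.\<close>

lemma chord:
  assumes "p \<bullet> \<tau> \<le> x" "x \<le> q \<bullet> \<tau>"
  obtains m where "m \<in> K" "m \<bullet> \<tau> = x" "\<And>s. m \<bullet> u + s * x \<le> G s"
proof -
  \<comment> \<open>If the two abscissas agree, division by zero gives \<open>t = 0\<close> and
    \<open>m = p\<close>, which has abscissa \<open>x\<close>.\<close>
  define t where "t = (x - p \<bullet> \<tau>) / (q \<bullet> \<tau> - p \<bullet> \<tau>)"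
  define m where "m = (1 - t) *\<^sub>R p + t *\<^sub>R q"
  have t: "0 \<le> t" "t \<le> 1" using assms by (auto simp: t_def divide_le_eq_1)
  have tx: "t * (q \<bullet> \<tau> - p \<bullet> \<tau>) = x - p \<bullet> \<tau>"
    using assms by (cases "q \<bullet> \<tau> = p \<bullet> \<tau>") (auto simp: t_def)
  have m\<tau>: "m \<bullet> \<tau> = x" using tx by (simp add: m_def inner_add_left algebra_simps)
  show ?thesis
  proof (rule that[OF _ m\<tau>])
    show "m \<in> K" unfolding m_def using K p q t by (intro convexD_alt) (auto simp: convex_body_def)
    fix s
    have "m \<bullet> u + s * x = (1 - t) * (p \<bullet> u + s * (p \<bullet> \<tau>)) + t * (q \<bullet> u + s * (q \<bullet> \<tau>))"
      unfolding m\<tau>[symmetric] by (simp add: m_def inner_add_left algebra_simps)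
    also have "\<dots> \<le> (1 - t) * G s + t * G s" using t G(3,4) by (intro add_mono mult_left_mono) auto
    finally show "m \<bullet> u + s * x \<le> G s" by (simp add: algebra_simps)
  qed
qed

lemma convex_body_modified: "convex_body modified"
proof -
  have eq: "modified = (\<Inter>\<theta>\<in>{\<theta>. \<theta> \<bullet> u \<le> 0}. {y. \<theta> \<bullet> y \<le> support_function K \<theta>}) \<inter> (\<Inter>s. {y. (u + s *\<^sub>R \<tau>) \<bullet> y \<le> G s})"
    by (auto simp: modified_def)
  have "closed modified" unfolding eq
    by (intro closed_Int closed_INT ballI closed_halfspace_le)
  moreover have "convex modified" unfolding eq
    by (intro convex_Int convex_INT convex_halfspace_le)
  moreover have "bounded modified"
  proof -
    have "norm y \<le> \<bar>G 0\<bar> + \<bar>support_function K (-u)\<bar> + \<bar>support_function K \<tau>\<bar> + \<bar>support_function K (-\<tau>)\<bar>"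
      if "y \<in> modified" for y
    proof -
      have 1: "\<theta> \<bullet> y \<le> support_function K \<theta>" if "\<theta> \<bullet> u \<le> 0" for \<theta>
        using that \<open>y \<in> modified\<close> by (auto simp: modified_def)
      have 2: "y \<bullet> u + 0 * (y \<bullet> \<tau>) \<le> G 0"
        using \<open>y \<in> modified\<close> unfolding modified_def by blast
      have "- (y \<bullet> u) \<le> support_function K (-u)" "y \<bullet> \<tau> \<le> support_function K \<tau>" "- (y \<bullet> \<tau>) \<le> support_function K (-\<tau>)"
        using 1[of "-u"] 1[of \<tau>] 1[of "-\<tau>"] by (auto simp: uu tu inner_commute[of _ y])
      thus ?thesis using 2 norm_le[of y] by linarith
    qed
    thus ?thesis by (auto simp: bounded_iff)
  qed
  moreover have "p \<in> modified" by (rule modified_outside[OF p(1)]) simp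
  ultimately show ?thesis by (auto simp: convex_body_def compact_eq_bounded_closed)
qed

text \<open>Outside the range of slopes an old contact point survives or is replaced by
  \<open>p\<close> or \<open>q\<close>. Inside it a subgradient of \<open>G\<close> supplies the
  contact point.\<close>

lemma support_modified_line: "support_function modified (u + s *\<^sub>R \<tau>) = G s"
proof -
  have "\<exists>y\<in>modified. y \<bullet> u + s * (y \<bullet> \<tau>) = G s"
  proof (cases "s \<le> a \<or> b \<le> s")
    case True
    obtain x where x: "x \<in> K" "x \<bullet> u + s * (x \<bullet> \<tau>) = G s"
      using support_function_attained[OF K, of "u + s *\<^sub>R \<tau>"] G(2)[OF True] by auto
    show ?thesis
    proof (cases "x \<bullet> \<tau> \<le> p \<bullet> \<tau> \<or> q \<bullet> \<tau> \<le> x \<bullet> \<tau>")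
      case True
      thus ?thesis using x modified_outside[OF x(1)] by blast
    next
      case False
      have mem: "p \<in> modified" "q \<in> modified" using modified_outside p q by auto
      from True show ?thesis
      proof
        assume s: "s \<le> a"
        have "x \<bullet> u + a * (x \<bullet> \<tau>) \<le> G a" using le_support[OF x(1), of a] G(2) by simp
        moreover have "(a - s) * (p \<bullet> \<tau>) \<le> (a - s) * (x \<bullet> \<tau>)" using s False by (intro mult_left_mono) auto
        ultimately have "G s \<le> p \<bullet> u + s * (p \<bullet> \<tau>)" using x(2) line_at_ends(1) by (simp add: algebra_simps)
        thus ?thesis using G(3)[of s] mem by (intro bexI[of _ p]) auto
      next
        assume s: "b \<le> s"
        have "x \<bullet> u + b * (x \<bullet> \<tau>) \<le> G b" using le_support[OF x(1), of b] G(2) by simp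
        moreover have "(s - b) * (x \<bullet> \<tau>) \<le> (s - b) * (q \<bullet> \<tau>)" using s False by (intro mult_left_mono) auto
        ultimately have "G s \<le> q \<bullet> u + s * (q \<bullet> \<tau>)" using x(2) line_at_ends(2) by (simp add: algebra_simps)
        thus ?thesis using G(4)[of s] mem by (intro bexI[of _ q]) auto
      qed
    qed
  next
    case False
    hence s: "a < s" "s < b" by auto
    obtain \<beta> where \<beta>: "\<And>t. G s + \<beta> * (t - s) \<le> G t" using convex_subgradient[OF G(1), of s] by blast
    \<comment> \<open>Legendre duality: the slope of a tangent of \<open>G\<close> is the abscissa
      of the contact point, and its intercept is the height.\<close>
    define y where "y = \<beta> *\<^sub>R \<tau> + (G s - s * \<beta>) *\<^sub>R u"
    have y: "y \<bullet> \<tau> = \<beta>" "y \<bullet> u = G s - s * \<beta>" by (simp_all add: y_def)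
    have "p \<bullet> \<tau> \<le> \<beta>"
    proof -
      have "(s - a) * (p \<bullet> \<tau>) \<le> (s - a) * \<beta>"
        using \<beta>[of a] G(3)[of s] line_at_ends(1) by (simp add: algebra_simps)
      thus ?thesis using s by simp
    qed
    moreover have "\<beta> \<le> q \<bullet> \<tau>"
    proof -
      have "(b - s) * \<beta> \<le> (b - s) * (q \<bullet> \<tau>)"
        using \<beta>[of b] G(4)[of s] line_at_ends(2) by (simp add: algebra_simps)
      thus ?thesis using s by simp
    qed
    ultimately obtain m where m: "m \<in> K" "m \<bullet> \<tau> = \<beta>" "\<And>s. m \<bullet> u + s * \<beta> \<le> G s"
      using chord[of \<beta>] by blast
    \<comment> \<open>The point \<open>y\<close> lies above the chord point \<open>m\<close> of
      \<open>K\<close>. Moving up does not increase the pairing with a direction whose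
      \<open>u\<close>-component is nonpositive.\<close>
    have mu: "m \<bullet> u \<le> y \<bullet> u" using m(3)[of s] y by simp
    have "y \<in> modified" unfolding modified_def
    proof safe
      fix t show "y \<bullet> u + t * (y \<bullet> \<tau>) \<le> G t" using \<beta>[of t] y by (simp add: algebra_simps)
    next
      fix \<theta> assume \<theta>: "\<theta> \<bullet> u \<le> 0"
      have "\<theta> \<bullet> y = (\<theta> \<bullet> \<tau>) * (m \<bullet> \<tau>) + (\<theta> \<bullet> u) * (y \<bullet> u)"
        by (subst inner_expand) (simp add: y m)
      also have "\<dots> \<le> (\<theta> \<bullet> \<tau>) * (m \<bullet> \<tau>) + (\<theta> \<bullet> u) * (m \<bullet> u)"
        using mu \<theta> by (intro add_left_mono mult_left_mono_neg)
      also have "\<dots> = \<theta> \<bullet> m" by (rule inner_expand[symmetric])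
      also have "\<dots> \<le> support_function K \<theta>" by (rule support_function_upper[OF K m(1)])
      finally show "\<theta> \<bullet> y \<le> support_function K \<theta>" .
    qed
    thus ?thesis using y by (intro bexI[of _ y]) auto
  qed
  then obtain y where "y \<in> modified" "y \<bullet> u + s * (y \<bullet> \<tau>) = G s" by blast
  moreover have "z \<bullet> u + s * (z \<bullet> \<tau>) \<le> G s" if "z \<in> modified" for z
    using that unfolding modified_def by blast
  ultimately show ?thesis
    by (intro support_function_eqI[OF convex_body_modified, of y]) simp_all
qed

text \<open>A contact point above the chord may be cut off. The chord point below it does at least
  as well in a direction with nonpositive \<open>u\<close>-component.\<close>

lemma support_modified_other:
  assumes "\<theta> \<bullet> u \<le> 0"
  shows "support_function modified \<theta> = support_function K \<theta>"
proof -
  obtain x where x: "x \<in> K" "\<theta> \<bullet> x = support_function K \<theta>" using support_function_attained[OF K] .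
  have "\<exists>y\<in>modified. \<theta> \<bullet> y = support_function K \<theta>"
  proof (cases "x \<bullet> \<tau> \<le> p \<bullet> \<tau> \<or> q \<bullet> \<tau> \<le> x \<bullet> \<tau>")
    case True
    thus ?thesis using modified_outside[OF x(1)] x(2) by blast
  next
    case False
    hence x\<tau>: "p \<bullet> \<tau> \<le> x \<bullet> \<tau>" "x \<bullet> \<tau> \<le> q \<bullet> \<tau>" by auto
    then obtain m where m: "m \<in> K" "m \<bullet> \<tau> = x \<bullet> \<tau>" "\<And>s. m \<bullet> u + s * (x \<bullet> \<tau>) \<le> G s"
      using chord[OF x\<tau>] by blast
    show ?thesis
    proof (cases "x \<bullet> u \<le> m \<bullet> u")
      case True
      have "x \<in> modified"
      proof (rule modified_I[OF x(1)])
        fix s show "x \<bullet> u + s * (x \<bullet> \<tau>) \<le> G s" using m(3)[of s] True by linarith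
      qed
      thus ?thesis using x(2) by blast
    next
      case False
      have "m \<in> modified" using m by (intro modified_I) auto
      moreover have "\<theta> \<bullet> m = support_function K \<theta>"
      proof (rule antisym)
        show "\<theta> \<bullet> m \<le> support_function K \<theta>" by (rule support_function_upper[OF K m(1)])
        have "\<theta> \<bullet> x = (\<theta> \<bullet> \<tau>) * (m \<bullet> \<tau>) + (\<theta> \<bullet> u) * (x \<bullet> u)" by (subst inner_expand) (simp add: m)
        also have "\<dots> \<le> (\<theta> \<bullet> \<tau>) * (m \<bullet> \<tau>) + (\<theta> \<bullet> u) * (m \<bullet> u)"
          using False assms by (intro add_left_mono mult_left_mono_neg) auto
        also have "\<dots> = \<theta> \<bullet> m" by (rule inner_expand[symmetric])
        finally show "support_function K \<theta> \<le> \<theta> \<bullet> m" using x(2) by simp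
      qed
      ultimately show ?thesis by blast
    qed
  qed
  then obtain y where "y \<in> modified" "\<theta> \<bullet> y = support_function K \<theta>" by blast
  moreover have "\<theta> \<bullet> z \<le> support_function K \<theta>" if "z \<in> modified" for z
    using that assms unfolding modified_def by blast
  ultimately show ?thesis
    by (intro support_function_eqI[OF convex_body_modified, of y])
qed

end

text \<open>The value at \<open>x\<close> of the minimum of the tangent lines with slopes \<open>- grid a b n k\<close>, written as a
  sum over the breakpoints \<open>Y\<^sub>k\<close> at which consecutive lines intersect.\<close>

definition circumscribed :: "real \<Rightarrow> real \<Rightarrow> nat \<Rightarrow> (real \<Rightarrow> real) \<Rightarrow> real \<Rightarrow> real" where
  "circumscribed a b n f x = f a - a * x - (b - a) / n *
     (\<Sum>k<n. max 0 (x - (f (grid a b n (Suc k)) - f (grid a b n k)) / ((b - a) / n)))"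

lemma grid_0: "grid a b n 0 = a" and grid_n: "0 < n \<Longrightarrow> grid a b n n = b"
  by (simp_all add: grid_def)

text \<open>The breakpoint sum rewritten by line values: each step counts only if the next line is
  lower. This form gives both comparisons with the tangent lines.\<close>

lemma circumscribed_eq_sum_min:
  assumes "a < b" "0 < n"
  shows "circumscribed a b n f x = (f (grid a b n 0) - grid a b n 0 * x) +
    (\<Sum>k<n. min 0 ((f (grid a b n (Suc k)) - grid a b n (Suc k) * x) - (f (grid a b n k) - grid a b n k * x)))"
proof -
  define d where "d = (b - a) / real n"
  have d: "0 < d" using assms by (simp add: d_def)
  have "min 0 ((f (grid a b n (Suc k)) - grid a b n (Suc k) * x) - (f (grid a b n k) - grid a b n k * x)) =
      - d * max 0 (x - (f (grid a b n (Suc k)) - f (grid a b n k)) / d)" for k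
  proof -
    have eq: "(f (grid a b n (Suc k)) - grid a b n (Suc k) * x) - (f (grid a b n k) - grid a b n k * x) =
        - (d * (x - (f (grid a b n (Suc k)) - f (grid a b n k)) / d))"
    proof -
      have "grid a b n (Suc k) = grid a b n k + d" using grid_Suc[of a b n k] by (simp add: d_def)
      moreover have "d * (x - F / d) = d * x - F" for F using d by (simp add: right_diff_distrib)
      ultimately show ?thesis by (simp only:) (simp add: algebra_simps)
    qed
    have "min 0 (- (d * y)) = - d * max 0 y" for y
      using d by (cases "0 \<le> y") (auto simp: min_def max_def zero_le_mult_iff mult_le_0_iff)
    thus ?thesis unfolding eq .
  qed
  thus ?thesis unfolding circumscribed_def d_def[symmetric] grid_0
    by (simp add: sum_negf flip: sum_distrib_left)
qed

lemma circumscribed_le_line: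
  assumes "a < b" "0 < n" "k \<le> n"
  shows "circumscribed a b n f x \<le> f (grid a b n k) - grid a b n k * x"
proof -
  define L where "L k = f (grid a b n k) - grid a b n k * x" for k
  have "circumscribed a b n f x = L 0 + (\<Sum>k<n. min 0 (L (Suc k) - L k))"
    using circumscribed_eq_sum_min[OF assms(1,2)] by (simp add: L_def)
  also have "(\<Sum>k<n. min 0 (L (Suc k) - L k)) \<le> (\<Sum>j<k. min 0 (L (Suc j) - L j))"
  proof -
    have "(\<Sum>j<k. - min 0 (L (Suc j) - L j)) \<le> (\<Sum>k<n. - min 0 (L (Suc k) - L k))"
      using assms(3) by (intro sum_mono2) auto
    thus ?thesis by (simp add: sum_negf)
  qed
  also have "\<dots> \<le> (\<Sum>j<k. L (Suc j) - L j)" by (intro sum_mono) auto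
  also have "\<dots> = L k - L 0" by (rule sum_lessThan_telescope)
  finally show ?thesis by (simp add: L_def)
qed

lemma convex_grid_increments:
  assumes "convex_on UNIV f" "j \<le> k"
  shows "f (grid a b n (Suc j)) - f (grid a b n j) \<le> f (grid a b n (Suc k)) - f (grid a b n k)"
proof -
  have step: "f (grid a b n (Suc j)) - f (grid a b n j) \<le> f (grid a b n (Suc (Suc j))) - f (grid a b n (Suc j))" for j
  proof -
    have "grid a b n (Suc j) = (1 - 1/2) * grid a b n j + 1/2 * grid a b n (Suc (Suc j))"
      using grid_Suc[of a b n j] grid_Suc[of a b n "Suc j"] by simp
    hence "f (grid a b n (Suc j)) \<le> (1 - 1/2) * f (grid a b n j) + 1/2 * f (grid a b n (Suc (Suc j)))"
      using convex_onD[OF assms(1), of "1/2" "grid a b n j" "grid a b n (Suc (Suc j))"] by simp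
    thus ?thesis by simp
  qed
  show ?thesis
    using lift_Suc_mono_le[of "\<lambda>j. f (grid a b n (Suc j)) - f (grid a b n j)", OF step assms(2)] .
qed

text \<open>For convex \<open>f\<close> the steps between consecutive lines increase. While they are
  negative the sum telescopes to a line value, which is at least \<open>y\<close>; nonnegative steps
  leave it unchanged.\<close>

lemma le_circumscribed:
  assumes f: "convex_on UNIV f" and ab: "a < b" "0 < n"
    and y: "\<And>s. y + s * x \<le> f s"
  shows "y \<le> circumscribed a b n f x"
proof -
  define L where "L k = f (grid a b n k) - grid a b n k * x" for k
  have yL: "y \<le> L k" for k using y[of "grid a b n k"] by (simp add: L_def)
  have mono: "L (Suc j) - L j \<le> L (Suc k) - L k" if "j \<le> k" for j k
  proof -
    have "grid a b n (Suc j) * x - grid a b n j * x = grid a b n (Suc k) * x - grid a b n k * x"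
      by (simp add: grid_Suc flip: left_diff_distrib)
    thus ?thesis using convex_grid_increments[OF f that, of a b n] by (simp add: L_def)
  qed
  have "y \<le> L 0 + (\<Sum>k<m. min 0 (L (Suc k) - L k))" for m
  proof (induction m)
    case (Suc m)
    show ?case
    proof (cases "0 \<le> L (Suc m) - L m")
      case True
      thus ?thesis using Suc by simp
    next
      case False
      hence neg: "L (Suc k) - L k < 0" if "k \<le> m" for k using mono[OF that] by linarith
      have "(\<Sum>k<Suc m. min 0 (L (Suc k) - L k)) = (\<Sum>k<Suc m. L (Suc k) - L k)"
      proof (intro sum.cong refl)
        fix k assume "k \<in> {..<Suc m}"
        hence "L (Suc k) - L k < 0" using neg by simp
        thus "min 0 (L (Suc k) - L k) = L (Suc k) - L k" by (simp only: min_def) simp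
      qed
      also have "\<dots> = L (Suc m) - L 0" by (rule sum_lessThan_telescope)
      finally show ?thesis using yL[of "Suc m"] by simp
    qed
  qed (simp add: yL)
  thus ?thesis using circumscribed_eq_sum_min[OF ab] by (simp add: L_def)
qed

lemma integral_positive_part:
  assumes "P \<le> Y" "Y \<le> Q"
  shows "((\<lambda>x::real. max 0 (x - Y)) has_integral (Q - Y)\<^sup>2 / 2) {P..Q}"
proof -
  have "((\<lambda>x. 0) has_integral 0) {P..Y}" by simp
  hence 1: "((\<lambda>x. max 0 (x - Y)) has_integral 0) {P..Y}"
    by (rule has_integral_eq[rotated]) auto
  have "((\<lambda>x. x - Y) has_integral ((Q - Y)\<^sup>2 / 2 - (Y - Y)\<^sup>2 / 2)) {Y..Q}"
    using assms(2) by (intro fundamental_theorem_of_calculus)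
      (auto intro!: derivative_eq_intros simp flip: has_real_derivative_iff_has_vector_derivative)
  hence "((\<lambda>x. x - Y) has_integral (Q - Y)\<^sup>2 / 2) {Y..Q}" by simp
  hence 2: "((\<lambda>x. max 0 (x - Y)) has_integral (Q - Y)\<^sup>2 / 2) {Y..Q}"
    by (rule has_integral_eq[rotated]) auto
  show ?thesis using has_integral_combine[OF assms 1 2] by simp
qed

text \<open>The breakpoints times the mesh width telescope to \<open>f b - f a\<close>, and their
  weighted squares add up to the Dirichlet sum. So for equal end values, polygon areas differ by
  half the difference of the energies.\<close>

lemma integral_circumscribed:
  assumes ab: "a < b" "0 < n"
    and Y: "\<And>k. k < n \<Longrightarrow> P \<le> (f (grid a b n (Suc k)) - f (grid a b n k)) / ((b - a) / n)"
      "\<And>k. k < n \<Longrightarrow> (f (grid a b n (Suc k)) - f (grid a b n k)) / ((b - a) / n) \<le> Q" and PQ: "P \<le> Q"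
  shows "(circumscribed a b n f has_integral
     (f a * (Q - P) - a * (Q\<^sup>2 - P\<^sup>2) / 2 - (b - a) * Q\<^sup>2 / 2 + Q * (f b - f a) - dirichlet a b n f f / 2)) {P..Q}"
proof -
  define d where "d = (b - a) / real n"
  define Y where "Y k = (f (grid a b n (Suc k)) - f (grid a b n k)) / d" for k
  have d: "0 < d" using ab by (simp add: d_def)
  have nd: "real n * d = b - a" using ab by (simp add: d_def)
  have "((\<lambda>x. f a - a * x) has_integral ((f a * Q - a * Q\<^sup>2 / 2) - (f a * P - a * P\<^sup>2 / 2))) {P..Q}"
    using PQ by (intro fundamental_theorem_of_calculus)
      (auto intro!: derivative_eq_intros simp flip: has_real_derivative_iff_has_vector_derivative)
  moreover have "((\<lambda>x. d * (\<Sum>k<n. max 0 (x - Y k))) has_integral (d * (\<Sum>k<n. (Q - Y k)\<^sup>2 / 2))) {P..Q}"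
    using assms(3,4) by (intro has_integral_mult_right has_integral_sum integral_positive_part) (auto simp: Y_def d_def)
  ultimately have "(circumscribed a b n f has_integral
      (((f a * Q - a * Q\<^sup>2 / 2) - (f a * P - a * P\<^sup>2 / 2)) - d * (\<Sum>k<n. (Q - Y k)\<^sup>2 / 2))) {P..Q}"
    unfolding circumscribed_def[abs_def] d_def[symmetric] Y_def[symmetric] by (rule has_integral_diff)
  moreover have "d * (\<Sum>k<n. (Q - Y k)\<^sup>2 / 2) = (b - a) * Q\<^sup>2 / 2 - Q * (f b - f a) + dirichlet a b n f f / 2"
  proof -
    have "(\<Sum>k<n. d * Y k) = f b - f a"
      using d sum_lessThan_telescope[of "\<lambda>k. f (grid a b n k)" n] ab
      by (simp add: Y_def grid_0 grid_n)
    moreover have "(\<Sum>k<n. d * (Y k)\<^sup>2) = dirichlet a b n f f"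
      unfolding dirichlet_def d_def[symmetric] sum_divide_distrib
      using d by (intro sum.cong) (auto simp: Y_def power2_eq_square)
    moreover have "d * (\<Sum>k<n. (Q - Y k)\<^sup>2 / 2) = (\<Sum>k<n. d * Q\<^sup>2 / 2 - Q * (d * Y k) + d * (Y k)\<^sup>2 / 2)"
      unfolding sum_distrib_left by (intro sum.cong) (auto simp: power2_eq_square algebra_simps add_divide_distrib diff_divide_distrib)
    moreover have "\<dots> = (\<Sum>k<n. d * Q\<^sup>2 / 2) - Q * (\<Sum>k<n. d * Y k) + (\<Sum>k<n. d * (Y k)\<^sup>2) / 2"
      by (simp add: sum.distrib sum_subtractf sum_distrib_left sum_divide_distrib)
    moreover have "(\<Sum>k<n. d * Q\<^sup>2 / 2) = (b - a) * Q\<^sup>2 / 2"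
    proof -
      have "(\<Sum>k<n. d * Q\<^sup>2 / 2) = (real n * d) * Q\<^sup>2 / 2" by simp
      thus ?thesis by (simp only: nd)
    qed
    ultimately show ?thesis by simp
  qed
  ultimately show ?thesis by (simp add: algebra_simps diff_divide_distrib)
qed

section \<open>Slices and area of the body before and after the replacement\<close>

context surgery
begin

abbreviation g :: "real \<Rightarrow> real" where
  "g s \<equiv> support_function K (u + s *\<^sub>R \<tau>)"

lemma p_le_q: "p \<bullet> \<tau> \<le> q \<bullet> \<tau>"
proof -
  have "(b - a) * (p \<bullet> \<tau>) \<le> (b - a) * (q \<bullet> \<tau>)"
    using G(3)[of b] G(4)[of a] line_at_ends by (simp add: algebra_simps)
  thus ?thesis using ab by simp
qed

text \<open>The breakpoints increase with \<open>k\<close>; the first is bounded by the line through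
  \<open>p\<close>, which meets \<open>f\<close> at \<open>a\<close>, and the last by the line
  through \<open>q\<close>, which meets \<open>f\<close> at \<open>b\<close>.\<close>

lemma increment_bounds:
  assumes f: "convex_on UNIV f" "f a = G a" "f b = G b"
    and le: "\<And>s. p \<bullet> u + s * (p \<bullet> \<tau>) \<le> f s" "\<And>s. q \<bullet> u + s * (q \<bullet> \<tau>) \<le> f s"
    and n: "k < n"
  shows "p \<bullet> \<tau> \<le> (f (grid a b n (Suc k)) - f (grid a b n k)) / ((b - a) / n)"
    and "(f (grid a b n (Suc k)) - f (grid a b n k)) / ((b - a) / n) \<le> q \<bullet> \<tau>"
proof -
  define d where "d = (b - a) / real n"
  have d: "0 < d" using ab n by (simp add: d_def)
  have "p \<bullet> \<tau> * d \<le> f (grid a b n (Suc 0)) - f (grid a b n 0)"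
    using le(1)[of "grid a b n (Suc 0)"] line_at_ends(1) grid_Suc[of a b n 0] f(2)
    by (simp add: grid_0 d_def[symmetric] algebra_simps)
  also have "\<dots> \<le> f (grid a b n (Suc k)) - f (grid a b n k)"
    by (rule convex_grid_increments[OF f(1)]) simp
  finally show "p \<bullet> \<tau> \<le> (f (grid a b n (Suc k)) - f (grid a b n k)) / ((b - a) / n)"
    using d by (simp add: d_def[symmetric] pos_le_divide_eq)
  have n1: "Suc (n - 1) = n" using n by simp
  have "f (grid a b n (Suc k)) - f (grid a b n k) \<le> f (grid a b n (Suc (n - 1))) - f (grid a b n (n - 1))"
    by (rule convex_grid_increments[OF f(1)]) (use n in simp)
  also have "\<dots> \<le> q \<bullet> \<tau> * d"
  proof -
    have "grid a b n (n - 1) = b - d" using grid_Suc[of a b n "n - 1"] n1 n grid_n[of n a b] by (simp add: d_def)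
    hence "q \<bullet> u + (b - d) * (q \<bullet> \<tau>) \<le> f (grid a b n (n - 1))" using le(2)[of "b - d"] by simp
    thus ?thesis using line_at_ends(2) f(3) n1 n grid_n[of n a b] by (simp add: algebra_simps)
  qed
  finally show "(f (grid a b n (Suc k)) - f (grid a b n k)) / ((b - a) / n) \<le> q \<bullet> \<tau>"
    using d by (simp add: d_def[symmetric] pos_divide_le_eq)
qed

lemma mem_K_if_modified:
  assumes y: "y \<in> modified" and "\<And>s. a < s \<Longrightarrow> s < b \<Longrightarrow> y \<bullet> u + s * (y \<bullet> \<tau>) \<le> g s"
  shows "y \<in> K"
proof (rule mem_if_le_support_function[OF K])
  fix \<theta> :: "real^2"
  show "\<theta> \<bullet> y \<le> support_function K \<theta>"
  proof (cases "\<theta> \<bullet> u \<le> 0")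
    case True
    thus ?thesis using y by (simp add: modified_def)
  next
    case False
    define s where "s = (\<theta> \<bullet> \<tau>) / (\<theta> \<bullet> u)"
    have \<theta>: "\<theta> = (\<theta> \<bullet> u) *\<^sub>R (u + s *\<^sub>R \<tau>)" unfolding s_def using dir_decomp False by simp
    have "y \<bullet> u + s * (y \<bullet> \<tau>) \<le> g s"
    proof (cases "s \<le> a \<or> b \<le> s")
      case True
      have "y \<bullet> u + s * (y \<bullet> \<tau>) \<le> G s" using y unfolding modified_def by blast
      thus ?thesis using G(2)[OF True] by simp
    qed (use assms(2) in auto)
    hence "(\<theta> \<bullet> u) * ((u + s *\<^sub>R \<tau>) \<bullet> y) \<le> (\<theta> \<bullet> u) * g s"
      using False by (intro mult_left_mono) auto
    moreover have "((\<theta> \<bullet> u) *\<^sub>R (u + s *\<^sub>R \<tau>)) \<bullet> y = (\<theta> \<bullet> u) * ((u + s *\<^sub>R \<tau>) \<bullet> y)"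
      by (rule inner_scaleR_left)
    moreover have "support_function K ((\<theta> \<bullet> u) *\<^sub>R (u + s *\<^sub>R \<tau>)) = (\<theta> \<bullet> u) * g s"
      using False by (intro support_function_scaleR[OF K]) simp
    ultimately show ?thesis using \<theta> by metis
  qed
qed

lemma slice_modified_outside:
  assumes "x \<le> p \<bullet> \<tau> \<or> q \<bullet> \<tau> \<le> x"
  shows "slice modified x \<subseteq> slice K x"
proof
  fix y assume "y \<in> slice modified x"
  hence z: "x *\<^sub>R \<tau> + y *\<^sub>R u \<in> modified" (is "?z \<in> _") by (simp add: slice_def)
  have "?z \<in> K"
  proof (rule mem_K_if_modified[OF z])
    fix s assume s: "a < s" "s < b"
    have "?z \<bullet> u + r * (?z \<bullet> \<tau>) \<le> G r" for r using z unfolding modified_def by blast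
    thus "?z \<bullet> u + s * (?z \<bullet> \<tau>) \<le> g s"
      using outside_le[OF _ s, of ?z] assms le_support[OF p(1), of s] le_support[OF q(1), of s] by force
  qed
  thus "y \<in> slice K x" by (simp add: slice_def)
qed

text \<open>A direction of some slope in \<open>{a..b}\<close> cuts off any point above the slice.
  Moving to a nearby grid slope costs one mesh width times \<open>R\<close> for \<open>g\<close> and
  as much again for the term \<open>s * x\<close>, whence \<open>2 * R\<close>.\<close>

lemma top_of_slice:
  assumes R: "K \<subseteq> cball 0 R" "0 \<le> R" and x: "p \<bullet> \<tau> \<le> x" "x \<le> q \<bullet> \<tau>" and n: "0 < n"
    and hi: "x *\<^sub>R \<tau> + hi *\<^sub>R u \<in> K" and top: "\<And>y. y > hi \<Longrightarrow> x *\<^sub>R \<tau> + y *\<^sub>R u \<notin> K"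
  shows "circumscribed a b n g x \<le> hi + 2 * R * ((b - a) / n)"
proof (rule field_le_epsilon)
  fix e :: real assume e: "0 < e"
  define d where "d = (b - a) / real n"
  have d: "0 < d" using ab n by (simp add: d_def)
  have nd: "real n * d = b - a" using n by (simp add: d_def)
  let ?z = "x *\<^sub>R \<tau> + (hi + e) *\<^sub>R u"
  have "?z \<notin> K" using top[of "hi + e"] e by simp
  then obtain \<theta> :: "real^2" where \<theta>: "support_function K \<theta> < \<theta> \<bullet> ?z"
    using mem_if_le_support_function[OF K, of ?z] not_le by blast
  have z: "\<theta> \<bullet> ?z = \<theta> \<bullet> (x *\<^sub>R \<tau> + hi *\<^sub>R u) + e * (\<theta> \<bullet> u)"
    by (simp add: inner_add_right algebra_simps)
  have "0 < e * (\<theta> \<bullet> u)" using support_function_upper[OF K hi, of \<theta>] \<theta> z by linarith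
  hence pos: "0 < \<theta> \<bullet> u" using e by (simp add: zero_less_mult_iff)
  define s' where "s' = (\<theta> \<bullet> \<tau>) / (\<theta> \<bullet> u)"
  have dec: "\<theta> = (\<theta> \<bullet> u) *\<^sub>R (u + s' *\<^sub>R \<tau>)" unfolding s'_def by (rule dir_decomp[OF pos])
  have "support_function K \<theta> = (\<theta> \<bullet> u) * g s'"
    by (subst dec) (rule support_function_scaleR[OF K less_imp_le[OF pos]])
  moreover have "\<theta> \<bullet> ?z = (\<theta> \<bullet> u) * ((u + s' *\<^sub>R \<tau>) \<bullet> ?z)"
    by (subst dec) (rule inner_scaleR_left)
  ultimately have "(\<theta> \<bullet> u) * g s' < (\<theta> \<bullet> u) * ((u + s' *\<^sub>R \<tau>) \<bullet> ?z)" using \<theta> by simp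
  hence s': "g s' < hi + e + s' * x" using pos by simp
  have "\<exists>s\<in>{a..b}. g s < hi + e + s * x"
  proof -
    \<comment> \<open>A slope outside the range is replaced by the nearer end: as \<open>x\<close>
      lies between the abscissas of \<open>p\<close> and \<open>q\<close>, the point is cut off
      there too.\<close>
    consider "s' < a" | "b < s'" | "s' \<in> {a..b}" by fastforce
    thus ?thesis
    proof cases
      case 1
      have "(a - s') * (p \<bullet> \<tau>) \<le> (a - s') * x" using 1 x by (intro mult_left_mono) auto
      hence "g a < hi + e + a * x"
        using s' le_support[OF p(1), of s'] p(2) by (simp add: algebra_simps)
      thus ?thesis using ab by auto
    next
      case 2
      have "(s' - b) * x \<le> (s' - b) * (q \<bullet> \<tau>)" using 2 x by (intro mult_left_mono) auto
      hence "g b < hi + e + b * x"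
        using s' le_support[OF q(1), of s'] q(2) by (simp add: algebra_simps)
      thus ?thesis using ab by auto
    qed (use s' in blast)
  qed
  then obtain s where s: "a \<le> s" "s \<le> b" "g s < hi + e + s * x" by auto
  define k where "k = nat \<lfloor>(s - a) / d\<rfloor>"
  have k: "real k \<le> (s - a) / d" "(s - a) / d < real k + 1"
    using s d unfolding k_def by (auto simp: of_nat_nat)
  have kd: "real k * d \<le> s - a" "s - a < (real k + 1) * d"
    using k d by (auto simp: field_simps)
  have "real k * d \<le> real n * d" using kd s nd by linarith
  hence kn: "k \<le> n" using d by simp
  have gk: "grid a b n k = a + real k * d" by (simp add: grid_def d_def)
  have close: "\<bar>grid a b n k - s\<bar> \<le> d" using kd gk d by (simp add: algebra_simps abs_le_iff)
  have xR: "\<bar>x\<bar> \<le> R"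
  proof -
    have "\<bar>p \<bullet> \<tau>\<bar> \<le> R" "\<bar>q \<bullet> \<tau>\<bar> \<le> R"
    proof -
      have nt: "norm \<tau> = 1" using tt by (simp add: norm_eq_1)
      have "norm p \<le> R" "norm q \<le> R" using p q R by auto
      thus "\<bar>p \<bullet> \<tau>\<bar> \<le> R" "\<bar>q \<bullet> \<tau>\<bar> \<le> R"
        using Cauchy_Schwarz_ineq2[of p \<tau>] Cauchy_Schwarz_ineq2[of q \<tau>] nt by auto
    qed
    thus ?thesis using x by linarith
  qed
  have "g (grid a b n k) - g s \<le> R * d"
  proof -
    have "g (grid a b n k) - g s \<le> R * \<bar>grid a b n k - s\<bar>"
      using lipschitz_onD[OF lipschitz_support_line[OF K R], of "grid a b n k" s] by (simp add: dist_real_def)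
    also have "\<dots> \<le> R * d" using close R by (intro mult_left_mono)
    finally show ?thesis .
  qed
  moreover have "(s - grid a b n k) * x \<le> R * d"
  proof -
    have "(s - grid a b n k) * x \<le> \<bar>s - grid a b n k\<bar> * \<bar>x\<bar>" by (metis abs_ge_self abs_mult)
    also have "\<dots> \<le> d * R" using close xR d by (intro mult_mono) auto
    finally show ?thesis by (simp add: mult.commute)
  qed
  moreover have "circumscribed a b n g x \<le> g (grid a b n k) - grid a b n k * x"
    by (rule circumscribed_le_line[OF ab n kn])
  ultimately show "circumscribed a b n g x \<le> hi + 2 * R * ((b - a) / n) + e"
    using s(3) unfolding d_def[symmetric] by (simp add: algebra_simps)
qed

text \<open>The lower end of the slice does not move down. The new upper end is below the polygon of
  \<open>G\<close>, and the old one is above the polygon of \<open>g\<close> up to the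
  discretisation error.\<close>

lemma slice_modified_inside:
  assumes R: "K \<subseteq> cball 0 R" "0 \<le> R" and x: "p \<bullet> \<tau> \<le> x" "x \<le> q \<bullet> \<tau>" and n: "0 < n"
  shows "measure lborel (slice modified x) \<le>
    measure lborel (slice K x) + (circumscribed a b n G x - circumscribed a b n g x + 2 * R * ((b - a) / n))"
proof -
  obtain lo hi where lh: "slice K x = {lo..hi}" using slice_interval[OF K] .
  obtain m where m: "m \<in> K" "m \<bullet> \<tau> = x" "\<And>s. m \<bullet> u + s * x \<le> G s" using chord[OF x] by blast
  have mem: "x *\<^sub>R \<tau> + y *\<^sub>R u \<in> K \<longleftrightarrow> lo \<le> y \<and> y \<le> hi" for y
    using lh by (auto simp: slice_def set_eq_iff)
  have "m = x *\<^sub>R \<tau> + (m \<bullet> u) *\<^sub>R u" using expand[of m] m(2) by simp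
  hence mlo: "lo \<le> m \<bullet> u" "m \<bullet> u \<le> hi" using m(1) mem[of "m \<bullet> u"] by auto
  have hi: "circumscribed a b n g x \<le> hi + 2 * R * ((b - a) / n)"
    by (rule top_of_slice[OF R x n]) (use mlo mem in auto)
  have mG: "m \<bullet> u \<le> circumscribed a b n G x"
    by (rule le_circumscribed[OF G(1) ab n m(3)])
  have sub: "slice modified x \<subseteq> {lo..circumscribed a b n G x}"
  proof
    fix y assume "y \<in> slice modified x"
    hence z: "x *\<^sub>R \<tau> + y *\<^sub>R u \<in> modified" (is "?z \<in> _") by (simp add: slice_def)
    have "?z \<bullet> u + r * (?z \<bullet> \<tau>) \<le> G r" for r using z unfolding modified_def by blast
    hence "y + r * x \<le> G r" for r by simp
    hence up: "y \<le> circumscribed a b n G x" by (rule le_circumscribed[OF G(1) ab n])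
    have "lo \<le> y"
    proof (rule ccontr)
      assume c: "\<not> lo \<le> y"
      have "x *\<^sub>R \<tau> + hi *\<^sub>R u \<in> K" using mem mlo by auto
      hence "hi + s * x \<le> g s" for s using le_support[of "x *\<^sub>R \<tau> + hi *\<^sub>R u" s] by simp
      hence "y + s * x \<le> g s" for s using c mlo by (smt (verit))
      hence "?z \<in> K" using mem_K_if_modified[OF z] by simp
      thus False using mem c by simp
    qed
    with up show "y \<in> {lo..circumscribed a b n G x}" by simp
  qed
  obtain lo' hi' where lh': "slice modified x = {lo'..hi'}" using slice_interval[OF convex_body_modified] .
  have "measure lborel (slice modified x) \<le> circumscribed a b n G x - lo"
    using sub mlo mG unfolding lh' by (cases "lo' \<le> hi'") auto
  moreover have "measure lborel (slice K x) = hi - lo" using mlo unfolding lh by simp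
  ultimately show ?thesis using hi by linarith
qed

text \<open>Integrates the slice estimates. The boundary terms, collected in \<open>c\<close>, agree
  because \<open>G\<close> and \<open>g\<close> coincide at \<open>a\<close> and \<open>b\<close>,
  and the last summand vanishes as the grid is refined.\<close>

lemma area_modified_le_dirichlet:
  assumes R: "K \<subseteq> cball 0 R" "0 \<le> R" and n: "0 < n"
  shows "area modified \<le> area K - (dirichlet a b n G G - dirichlet a b n g g) / 2
    + 2 * R * ((b - a) / n) * (q \<bullet> \<tau> - p \<bullet> \<tau>)"
proof -
  define P where "P = p \<bullet> \<tau>"
  define Q where "Q = q \<bullet> \<tau>"
  define e where "e = 2 * R * ((b - a) / n)"
  define D where "D x = circumscribed a b n G x - circumscribed a b n g x + e" for x
  have PQ: "P \<le> Q" using p_le_q by (simp add: P_def Q_def)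
  have gc: "convex_on UNIV g" by (rule convex_on_support_line[OF K])
  have ends: "g a = G a" "g b = G b" using G(2) by auto
  have le: "p \<bullet> u + s * (p \<bullet> \<tau>) \<le> g s" "q \<bullet> u + s * (q \<bullet> \<tau>) \<le> g s" for s
    using le_support p q by auto
  define c where "c = G a * (Q - P) - a * (Q\<^sup>2 - P\<^sup>2) / 2 - (b - a) * Q\<^sup>2 / 2 + Q * (G b - G a)"
  have "(circumscribed a b n G has_integral (c - dirichlet a b n G G / 2)) {P..Q}"
    unfolding c_def
    by (rule integral_circumscribed[OF ab n _ _ PQ]; unfold P_def Q_def;
        rule increment_bounds[OF G(1) refl refl G(3,4)])
  moreover have "(circumscribed a b n g has_integral (c - dirichlet a b n g g / 2)) {P..Q}"
    unfolding c_def ends[symmetric]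
    by (rule integral_circumscribed[OF ab n _ _ PQ]; unfold P_def Q_def;
        rule increment_bounds[OF gc ends le])
  moreover have "((\<lambda>x. e) has_integral e * (Q - P)) {P..Q}"
    using has_integral_const_real[of e P Q] PQ by (simp add: mult.commute)
  ultimately have "(D has_integral ((c - dirichlet a b n G G / 2) - (c - dirichlet a b n g g / 2) + e * (Q - P))) {P..Q}"
    unfolding D_def by (intro has_integral_add has_integral_diff)
  hence intD: "integral {P..Q} D = - (dirichlet a b n G G - dirichlet a b n g g) / 2 + e * (Q - P)"
    by (simp add: integral_unique diff_divide_distrib)
  have "continuous_on {P..Q} D"
    unfolding D_def circumscribed_def by (intro continuous_intros)
  hence sD: "set_integrable lborel {P..Q} D"
    unfolding set_integrable_def by (intro borel_integrable_compact) auto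
  have bound: "measure lborel (slice modified x) \<le> measure lborel (slice K x) + indicator {P..Q} x *\<^sub>R D x" for x
  proof (cases "x \<in> {P..Q}")
    case True
    thus ?thesis using slice_modified_inside[OF R _ _ n, of x] by (simp add: P_def Q_def D_def e_def)
  next
    case False
    hence "slice modified x \<subseteq> slice K x" by (intro slice_modified_outside) (auto simp: P_def Q_def)
    moreover obtain lo hi where "slice K x = {lo..hi}" using slice_interval[OF K] .
    moreover obtain lo' hi' where "slice modified x = {lo'..hi'}" using slice_interval[OF convex_body_modified] .
    ultimately have "measure lborel (slice modified x) \<le> measure lborel (slice K x)"
      by (cases "lo' \<le> hi'") auto
    thus ?thesis using False by simp
  qed
  have cK: "compact K" "compact modified" using K convex_body_modified by (auto simp: convex_body_def)
  have "area modified \<le> (\<integral>x. measure lborel (slice K x) + indicator {P..Q} x *\<^sub>R D x \<partial>lborel)"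
    unfolding area_slices(2)[OF cK(2)] using sD bound
    by (intro integral_mono area_slices(1) cK Bochner_Integration.integrable_add) (auto simp: set_integrable_def)
  also have "\<dots> = area K + (LINT x:{P..Q}|lborel. D x)"
    unfolding area_slices(2)[OF cK(1)] set_lebesgue_integral_def using sD
    by (intro Bochner_Integration.integral_add area_slices(1) cK) (auto simp: set_integrable_def)
  also have "(LINT x:{P..Q}|lborel. D x) = integral {P..Q} D"
    by (rule set_borel_integral_eq_integral(2)[OF sD])
  also note intD
  finally show ?thesis by (simp add: P_def Q_def e_def diff_divide_distrib)
qed

end

subsection \<open>Perturbed bodies\<close>

context frame
begin

text \<open>The positively homogeneous function of degree 1 given by \<open>V\<close> on the line of
  directions, extended by zero to the opposite half-plane.\<close>

definition lift :: "(real \<Rightarrow> real) \<Rightarrow> real^2 \<Rightarrow> real" where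
  "lift V \<theta> = (if 0 < \<theta> \<bullet> u then (\<theta> \<bullet> u) * V ((\<theta> \<bullet> \<tau>) / (\<theta> \<bullet> u)) else 0)"

text \<open>Realises the one-dimensional perturbation by bodies and lets the grid get finer along
  the subsequence: the mixed Dirichlet term and the error vanish, and the energy of \<open>V\<close>
  remains as loss of area.\<close>

lemma perturbed_bodies:
  assumes K: "convex_body K" and e: "0 < e"
    and na: "\<And>e. 0 < e \<Longrightarrow> \<not> (\<exists>m q. \<forall>s\<in>{0..e}. support_function K (u + s *\<^sub>R \<tau>) = m + q * s)"
  obtains a b V t0 E M where "0 < a" "a < b" "b \<le> e" "\<And>s. s \<le> a \<or> b \<le> s \<Longrightarrow> V s = 0"
    "continuous_on UNIV V" "0 < (t0 :: real)" "0 < E" "\<And>s. s \<in> {a..b} \<Longrightarrow> (V s)\<^sup>2 \<le> (s - a) * E"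
    "\<And>t. \<bar>t\<bar> \<le> t0 \<Longrightarrow> convex_body (M t)"
    "\<And>t \<theta>. \<bar>t\<bar> \<le> t0 \<Longrightarrow> support_function (M t) \<theta> = support_function K \<theta> + t * lift V \<theta>"
    "\<And>t. \<bar>t\<bar> \<le> t0 \<Longrightarrow> area (M t) \<le> area K - t\<^sup>2 * E / 2"
proof -
  define g where "g s = support_function K (u + s *\<^sub>R \<tau>)" for s
  obtain R where R: "0 < R" "K \<subseteq> cball 0 R" using convex_body_bound[OF K] .
  have g_convex: "convex_on UNIV g" unfolding g_def by (rule convex_on_support_line[OF K])
  have g_lip: "R-lipschitz_on UNIV g" unfolding g_def by (rule lipschitz_support_line[OF K R(2)]) (use R in simp)
  have na': "\<not> (\<exists>m q. \<forall>s\<in>{0..e}. g s = m + q * s)" if "0 < e" for e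
    using na[OF that] by (simp add: g_def)
  show ?thesis
  proof (rule perturbation_exists[OF g_convex g_lip e na'])
    fix a b \<alpha> \<beta> V t0 E and r :: "nat \<Rightarrow> nat"
    assume ab: "0 < a" "a < b" "b \<le> e"
      and \<alpha>: "\<And>s. g a + \<alpha> * (s - a) \<le> g s" and \<beta>: "\<And>s. g b + \<beta> * (s - b) \<le> g s"
      and V: "\<And>s. s \<le> a \<or> b \<le> s \<Longrightarrow> V s = 0" "continuous_on UNIV V"
      and t0: "0 < t0" "\<And>t. \<bar>t\<bar> \<le> t0 \<Longrightarrow> convex_on UNIV (\<lambda>s. g s + t * V s)"
      "\<And>t s. \<bar>t\<bar> \<le> t0 \<Longrightarrow> g a + \<alpha> * (s - a) \<le> g s + t * V s"
      "\<And>t s. \<bar>t\<bar> \<le> t0 \<Longrightarrow> g b + \<beta> * (s - b) \<le> g s + t * V s"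
      and r: "strict_mono r"
      and lim: "(\<lambda>n. dirichlet a b (r n) g V) \<longlonglongrightarrow> 0" "(\<lambda>n. dirichlet a b (r n) V V) \<longlonglongrightarrow> E"
      and E: "0 < E" "\<And>s. s \<in> {a..b} \<Longrightarrow> (V s)\<^sup>2 \<le> (s - a) * E"
    \<comment> \<open>The point whose pairing with \<open>u + s *\<^sub>R \<tau>\<close> is the
      supporting line of \<open>g\<close> at \<open>a\<close>; \<open>sub_line_mem\<close> puts it
      into \<open>K\<close>.\<close>
    define p where "p = \<alpha> *\<^sub>R \<tau> + (g a - a * \<alpha>) *\<^sub>R u"
    define q where "q = \<beta> *\<^sub>R \<tau> + (g b - b * \<beta>) *\<^sub>R u"
    have p: "p \<bullet> \<tau> = \<alpha>" "p \<bullet> u = g a - a * \<alpha>" and q: "q \<bullet> \<tau> = \<beta>" "q \<bullet> u = g b - b * \<beta>"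
      by (simp_all add: p_def q_def)
    have p_line: "(u + s *\<^sub>R \<tau>) \<bullet> p = g a + \<alpha> * (s - a)" for s
      by (simp only: inner_dir p) (simp add: algebra_simps)
    have q_line: "(u + s *\<^sub>R \<tau>) \<bullet> q = g b + \<beta> * (s - b)" for s
      by (simp only: inner_dir q) (simp add: algebra_simps)
    have pK: "p \<in> K"
      by (rule sub_line_mem[OF K, of a]; unfold p_line g_def[symmetric]) (use \<alpha> in simp_all)
    have qK: "q \<in> K"
      by (rule sub_line_mem[OF K, of b]; unfold q_line g_def[symmetric]) (use \<beta> in simp_all)
    have surg: "surgery u \<tau> K a b p q (\<lambda>s. g s + t * V s)" if t: "\<bar>t\<bar> \<le> t0" for t
    proof unfold_locales
      show "p \<bullet> u + s * (p \<bullet> \<tau>) \<le> g s + t * V s" for s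
        using t0(3)[OF t, of s] p_line[of s] by (simp only: inner_dir)
      show "q \<bullet> u + s * (q \<bullet> \<tau>) \<le> g s + t * V s" for s
        using t0(4)[OF t, of s] q_line[of s] by (simp only: inner_dir)
      show "g s + t * V s = support_function K (u + s *\<^sub>R \<tau>)" if "s \<le> a \<or> b \<le> s" for s
        using V(1)[OF that] by (simp add: g_def)
    qed (use K ab pK qK t0(2)[OF t] p q in \<open>simp_all add: g_def\<close>)
    define M where "M t = surgery.modified u \<tau> K (\<lambda>s. g s + t * V s)" for t
    show ?thesis
    proof (rule that[OF ab V t0(1) E, of M])
      fix t assume t: "\<bar>t\<bar> \<le> t0"
      interpret surgery u \<tau> K a b p q "\<lambda>s. g s + t * V s" by (rule surg[OF t])
      show "convex_body (M t)" unfolding M_def by (rule convex_body_modified)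
      show "support_function (M t) \<theta> = support_function K \<theta> + t * lift V \<theta>" for \<theta>
      proof (cases "0 < \<theta> \<bullet> u")
        case True
        define s where "s = (\<theta> \<bullet> \<tau>) / (\<theta> \<bullet> u)"
        have \<theta>: "\<theta> = (\<theta> \<bullet> u) *\<^sub>R (u + s *\<^sub>R \<tau>)" unfolding s_def by (rule dir_decomp[OF True])
        have "support_function (M t) \<theta> = (\<theta> \<bullet> u) * support_function (M t) (u + s *\<^sub>R \<tau>)"
          by (subst \<theta>) (rule support_function_scaleR, unfold M_def, rule convex_body_modified, use True in simp)
        also have "\<dots> = (\<theta> \<bullet> u) * (g s + t * V s)" unfolding M_def support_modified_line ..
        also have "\<dots> = (\<theta> \<bullet> u) * g s + t * lift V \<theta>" using True by (simp add: lift_def s_def algebra_simps)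
        also have "(\<theta> \<bullet> u) * g s = support_function K \<theta>"
          unfolding g_def by (subst (2) \<theta>) (rule support_function_scaleR[symmetric, OF K], use True in simp)
        finally show ?thesis .
      next
        case False
        thus ?thesis using support_modified_other[of \<theta>] by (simp add: M_def lift_def)
      qed
      show "area (M t) \<le> area K - t\<^sup>2 * E / 2"
      proof (rule LIMSEQ_le_const)
        have bnd: "area (M t) \<le> area K - (2 * t * dirichlet a b (r (Suc n)) g V + t\<^sup>2 * dirichlet a b (r (Suc n)) V V) / 2
            + 2 * R * (b - a) * (q \<bullet> \<tau> - p \<bullet> \<tau>) / real (r (Suc n))" for n
        proof -
          have "0 < r (Suc n)" using seq_suble[OF r, of "Suc n"] by simp
          from area_modified_le_dirichlet[OF R(2) less_imp_le[OF R(1)] this]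
          show ?thesis unfolding dirichlet_add_scaled M_def g_def[symmetric] by simp
        qed
        show "\<exists>N. \<forall>n\<ge>N. area (M t) \<le> area K - (2 * t * dirichlet a b (r (Suc n)) g V + t\<^sup>2 * dirichlet a b (r (Suc n)) V V) / 2
            + 2 * R * (b - a) * (q \<bullet> \<tau> - p \<bullet> \<tau>) / real (r (Suc n))"
          using bnd by blast
        have "filterlim (\<lambda>n. r (Suc n)) at_top sequentially"
          using filterlim_subseq[OF r] by (rule filterlim_compose) (rule filterlim_Suc)
        hence "filterlim (\<lambda>n. real (r (Suc n))) at_infinity sequentially"
          by (intro filterlim_at_top_imp_at_infinity filterlim_compose[OF filterlim_real_sequentially])
        hence "(\<lambda>n. 2 * R * (b - a) * (q \<bullet> \<tau> - p \<bullet> \<tau>) / real (r (Suc n))) \<longlonglongrightarrow> 0"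
          by (intro tendsto_divide_0[OF tendsto_const])
        hence "(\<lambda>n. area K - (2 * t * dirichlet a b (r (Suc n)) g V + t\<^sup>2 * dirichlet a b (r (Suc n)) V V) / 2
            + 2 * R * (b - a) * (q \<bullet> \<tau> - p \<bullet> \<tau>) / real (r (Suc n)))
            \<longlonglongrightarrow> area K - (2 * t * 0 + t\<^sup>2 * E) / 2 + 0"
          by (intro tendsto_add tendsto_diff tendsto_divide tendsto_mult tendsto_const LIMSEQ_Suc[OF lim(1)] LIMSEQ_Suc[OF lim(2)]) auto
        thus "(\<lambda>n. area K - (2 * t * dirichlet a b (r (Suc n)) g V + t\<^sup>2 * dirichlet a b (r (Suc n)) V V) / 2
            + 2 * R * (b - a) * (q \<bullet> \<tau> - p \<bullet> \<tau>) / real (r (Suc n)))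
            \<longlonglongrightarrow> area K - t\<^sup>2 * E / 2" by simp
      qed
    qed
  qed
qed

end

section \<open>Second-order bounds for real powers\<close>

lemma powr_one_minus_le:
  fixes p :: real
  assumes p: "1 \<le> p" and x: "\<bar>x\<bar> \<le> 1 / 2"
  shows "(1 - x) powr p \<le> 1 - p * x + p * (p - 1) * 2 powr \<bar>p - 2\<bar> * x\<^sup>2"
proof -
  define diff where "diff m t = (if m = 0 then (1 - t) powr p else if m = 1 then - (p * (1 - t) powr (p - 1))
    else p * (p - 1) * (1 - t) powr (p - 2))" for m :: nat and t :: real
  have d0: "diff 0 = (\<lambda>t. (1 - t) powr p)" and d1: "diff (Suc 0) = (\<lambda>t. - (p * (1 - t) powr (p - 1)))"
    and d2: "diff (Suc (Suc 0)) = (\<lambda>t. p * (p - 1) * (1 - t) powr (p - 2))"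
    by (auto simp: diff_def fun_eq_iff)
  have "\<exists>t. \<bar>t\<bar> \<le> \<bar>x\<bar> \<and> (1 - x) powr p = (\<Sum>m<2. diff m 0 / fact m * x ^ m) + diff 2 t / fact 2 * x ^ 2"
  proof (rule Maclaurin_bi_le[where f = "\<lambda>t. (1 - t) powr p"])
    show "diff 0 = (\<lambda>t. (1 - t) powr p)" by (rule d0)
    show "\<forall>m t. m < 2 \<and> \<bar>t\<bar> \<le> \<bar>x\<bar> \<longrightarrow> DERIV (diff m) t :> diff (Suc m) t"
    proof safe
      fix m :: nat and t :: real assume m: "m < 2" and t: "\<bar>t\<bar> \<le> \<bar>x\<bar>"
      have pos: "0 < 1 - t" using t x by linarith
      consider "m = 0" | "m = 1" using m by linarith
      thus "DERIV (diff m) t :> diff (Suc m) t"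
      proof cases
        case 1
        show ?thesis unfolding 1 d0 d1 using pos by (auto intro!: derivative_eq_intros)
      next
        case 2
        show ?thesis unfolding 2 One_nat_def d1 d2 using pos by (auto intro!: derivative_eq_intros)
      qed
    qed
  qed
  then obtain t where t: "\<bar>t\<bar> \<le> \<bar>x\<bar>"
    "(1 - x) powr p = (\<Sum>m<2. diff m 0 / fact m * x ^ m) + diff 2 t / fact 2 * x ^ 2" by blast
  have eq: "(1 - x) powr p = 1 - p * x + p * (p - 1) * (1 - t) powr (p - 2) / 2 * x\<^sup>2"
    unfolding t(2) by (simp add: diff_def numeral_2_eq_2)
  have t12: "1/2 \<le> 1 - t" "1 - t \<le> 2" using t(1) x by auto
  \<comment> \<open>The exponent may have either sign; as \<open>1 - t\<close> stays between 1/2 and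
    2, one constant serves both cases.\<close>
  have "(1 - t) powr (p - 2) \<le> 2 powr \<bar>p - 2\<bar>"
  proof (cases "2 \<le> p")
    case True
    thus ?thesis using t12 by (auto intro!: powr_mono2)
  next
    case False
    have "(1 - t) powr (p - 2) \<le> (1/2) powr (p - 2)"
      using False t12 by (intro powr_mono2') auto
    also have "\<dots> = 2 powr \<bar>p - 2\<bar>" using False powr_minus_divide[of 2 "p - 2"] by (simp add: powr_divide)
    finally show ?thesis .
  qed
  hence "p * (p - 1) * x\<^sup>2 * (1 - t) powr (p - 2) \<le> p * (p - 1) * x\<^sup>2 * 2 powr \<bar>p - 2\<bar>"
    using p by (intro mult_left_mono) auto
  moreover have "0 \<le> p * (p - 1) * x\<^sup>2 * 2 powr \<bar>p - 2\<bar>" using p by simp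
  ultimately have "p * (p - 1) * x\<^sup>2 * (1 - t) powr (p - 2) / 2 \<le> p * (p - 1) * x\<^sup>2 * 2 powr \<bar>p - 2\<bar>"
    by linarith
  thus ?thesis unfolding eq by (simp add: algebra_simps)
qed

text \<open>Rescaling by \<open>d\<close>. At \<open>d = 0\<close> also \<open>y = 0\<close>, and
  the convention that powers of 0 are 0 makes both sides vanish.\<close>

lemma powr_minus_le:
  fixes p :: real
  assumes p: "1 \<le> p" and y: "\<bar>y\<bar> \<le> d / 2"
  shows "(d - y) powr p \<le> d powr p - p * (d powr (p - 1) * y) + p * (p - 1) * 2 powr \<bar>p - 2\<bar> * (d powr (p - 2) * y\<^sup>2)"
proof (cases "d = 0")
  case True
  thus ?thesis using y by simp
next
  case False
  hence d: "0 < d" using y by linarith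
  have "\<bar>y / d\<bar> \<le> 1 / 2" using y d by (simp add: abs_divide divide_le_eq)
  from powr_one_minus_le[OF p this]
  have "d powr p * (1 - y / d) powr p \<le> d powr p * (1 - p * (y / d) + p * (p - 1) * 2 powr \<bar>p - 2\<bar> * (y / d)\<^sup>2)"
    by (intro mult_left_mono) auto
  moreover have "d powr p * (1 - y / d) powr p = (d - y) powr p"
  proof -
    have "0 \<le> 1 - y / d" using y d by (simp add: divide_le_eq)
    hence "d powr p * (1 - y / d) powr p = (d * (1 - y / d)) powr p" using d by (simp add: powr_mult)
    also have "d * (1 - y / d) = d - y" using d by (simp add: right_diff_distrib)
    finally show ?thesis .
  qed
  moreover have "d powr p * (y / d) = d powr (p - 1) * y" using d by (simp add: powr_diff)
  moreover have "d powr p * (y / d)\<^sup>2 = d powr (p - 2) * y\<^sup>2" using d by (simp add: powr_diff power_divide)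
  moreover have "x * (1 - p * r + K * r\<^sup>2) = x - p * (x * r) + K * (x * r\<^sup>2)" for x r K :: real
    by (simp add: algebra_simps)
  ultimately show ?thesis by (simp only:)
qed

subsection \<open>The support function is piecewise linear\<close>

context frame
begin

text \<open>The one-sided arcs exclude \<open>u\<close> itself, so they decrease to the empty set
  and their lengths tend to 0.\<close>

lemma small_arc:
  assumes "0 < \<eta>"
  obtains e A where "0 < e" "e \<le> 1" "A \<in> sets circle_measure" "measure circle_measure A < \<eta>"
    "\<And>\<theta>. \<lbrakk>norm \<theta> = 1; 0 < \<theta> \<bullet> u; 0 < \<theta> \<bullet> \<tau>; \<theta> \<bullet> \<tau> \<le> e * (\<theta> \<bullet> u)\<rbrakk> \<Longrightarrow> \<theta> \<in> A"
proof -
  define A where "A n = unit_circle \<inter> ({\<theta>. 0 < u \<bullet> \<theta>} \<inter> {\<theta>. 0 < \<tau> \<bullet> \<theta>} \<inter> {\<theta>. \<tau> \<bullet> \<theta> \<le> (u \<bullet> \<theta>) / real (Suc n)})" for n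
  have "A n \<in> sets borel" for n unfolding A_def
    by (intro sets.Int borel_closed borel_open open_Collect_less closed_Collect_le closed_sphere continuous_intros) auto
  hence sets: "A n \<in> sets circle_measure" for n
    unfolding sets_circle_measure by (subst sets_restrict_space_iff) (auto simp: A_def)
  have dec: "decseq A"
  proof (rule decseq_SucI)
    fix n
    show "A (Suc n) \<subseteq> A n"
    proof
      fix \<theta> assume *: "\<theta> \<in> A (Suc n)"
      hence "u \<bullet> \<theta> / real (Suc (Suc n)) \<le> u \<bullet> \<theta> / real (Suc n)"
        by (intro divide_left_mono) (auto simp: A_def)
      thus "\<theta> \<in> A n" using * by (auto simp: A_def)
    qed
  qed
  have "(\<Inter>n. A n) = {}"
  proof (rule ccontr)
    assume "(\<Inter>n. A n) \<noteq> {}"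
    then obtain \<theta> where \<theta>: "\<And>n. \<theta> \<in> A n" by blast
    hence pos: "0 < \<tau> \<bullet> \<theta>" by (auto simp: A_def)
    obtain n where "u \<bullet> \<theta> < real n * (\<tau> \<bullet> \<theta>)" using reals_Archimedean3[OF pos] by blast
    moreover have "\<tau> \<bullet> \<theta> * real (Suc n) \<le> u \<bullet> \<theta>" using \<theta>[of n] by (simp add: A_def pos_le_divide_eq)
    ultimately show False using pos by (simp add: algebra_simps)
  qed
  hence "(\<lambda>n. measure circle_measure (A n)) \<longlonglongrightarrow> 0"
    using finite_measure.finite_Lim_measure_decseq[OF finite_measure_circle_measure, of A] sets dec by auto
  then obtain n where n: "measure circle_measure (A n) < \<eta>"
    using order_tendstoD(2)[OF _ assms] eventually_sequentially by (metis order_refl)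
  show ?thesis
  proof (rule that[of "1 / real (Suc n)" "A n"])
    fix \<theta> :: "real^2" assume "norm \<theta> = 1" "0 < \<theta> \<bullet> u" "0 < \<theta> \<bullet> \<tau>" "\<theta> \<bullet> \<tau> \<le> 1 / real (Suc n) * (\<theta> \<bullet> u)"
    thus "\<theta> \<in> A n" by (simp add: A_def inner_commute[of _ u] inner_commute[of _ \<tau>])
  qed (use n sets in auto)
qed

text \<open>One-sided vertex condition: turning slightly from \<open>u\<close> towards
  \<open>\<tau>\<close> keeps one and the same contact point.\<close>

definition linear_at :: "(real^2) set \<Rightarrow> bool" where
  "linear_at K \<longleftrightarrow> (\<exists>e>0. \<exists>x\<in>K. \<forall>s\<in>{0..e}. support_function K (u + s *\<^sub>R \<tau>) = (u + s *\<^sub>R \<tau>) \<bullet> x)"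

text \<open>Contact at \<open>s = 0\<close> is allowed; this is what occurs when the container has
  an edge with normal \<open>u\<close>.\<close>

definition linear_gap :: "(real^2) set \<Rightarrow> (real^2) set \<Rightarrow> bool" where
  "linear_gap L K \<longleftrightarrow> (\<exists>m>0. \<exists>e>0. \<forall>s. 0 < s \<and> s \<le> e \<longrightarrow>
     m * s \<le> support_function L (u + s *\<^sub>R \<tau>) - support_function K (u + s *\<^sub>R \<tau>))"

text \<open>If the support function of \<open>\<omega>\<close> were not linear near \<open>u\<close>, a perturbation by
  \<open>t * lift V\<close> would lose area at least \<open>t\<^sup>2 E / 2\<close>, while the energy grows by at most
  \<open>t\<^sup>2 E\<close> times a constant times the length of the arc carrying the perturbation. For a short arc
  this contradicts the penalisation inequality.\<close>

lemma support_linear_near: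
  assumes \<Omega>: "convex_body \<Omega>" and p: "1 \<le> p" and sol: "is_solution \<Omega> p c \<omega>"
    and c: "0 < c" "c < area \<Omega>" and gap: "linear_gap \<Omega> \<omega>"
  shows "linear_at \<omega>"
proof (rule ccontr)
  assume contra: "\<not> ?thesis"
  obtain m e0 where m: "0 < m" and e0: "0 < e0"
    and gap: "\<And>s. \<lbrakk>0 < s; s \<le> e0\<rbrakk> \<Longrightarrow> m * s \<le> support_function \<Omega> (u + s *\<^sub>R \<tau>) - support_function \<omega> (u + s *\<^sub>R \<tau>)"
    using gap unfolding linear_gap_def by blast
  have \<omega>: "convex_body \<omega>" "\<omega> \<subseteq> \<Omega>" "area \<omega> = c"
    using sol by (auto simp: is_solution_def admissible_def)
  have na: "\<not> (\<exists>m q. \<forall>s\<in>{0..e}. support_function \<omega> (u + s *\<^sub>R \<tau>) = m + q * s)" if e: "0 < e" for e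
  proof
    assume "\<exists>m q. \<forall>s\<in>{0..e}. support_function \<omega> (u + s *\<^sub>R \<tau>) = m + q * s"
    then obtain k l where kl: "\<And>s. s \<in> {0..e} \<Longrightarrow> support_function \<omega> (u + s *\<^sub>R \<tau>) = k + l * s" by blast
    \<comment> \<open>The line of a contact point at the midpoint is below the affine function at
      both ends and equal to it in the middle, hence equal throughout.\<close>
    obtain x where x: "x \<in> \<omega>" "(u + (e/2) *\<^sub>R \<tau>) \<bullet> x = support_function \<omega> (u + (e/2) *\<^sub>R \<tau>)"
      using support_function_attained[OF \<omega>(1)] .
    have mid: "x \<bullet> u + e / 2 * (x \<bullet> \<tau>) = k + l * (e / 2)" using x(2) kl[of "e/2"] e by simp
    have "x \<bullet> u \<le> k" "x \<bullet> u + e * (x \<bullet> \<tau>) \<le> k + l * e"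
      using support_function_upper[OF \<omega>(1) x(1), of "u + 0 *\<^sub>R \<tau>"] kl[of 0]
        support_function_upper[OF \<omega>(1) x(1), of "u + e *\<^sub>R \<tau>"] kl[of e] e unfolding inner_dir by auto
    moreover have "2 * (x \<bullet> u) + e * (x \<bullet> \<tau>) = 2 * k + l * e" using mid by (simp add: field_simps)
    ultimately have "x \<bullet> u = k" "e * (x \<bullet> \<tau>) = l * e" by linarith+
    hence "x \<bullet> u = k" "x \<bullet> \<tau> = l" using e by auto
    hence "\<forall>s\<in>{0..e}. support_function \<omega> (u + s *\<^sub>R \<tau>) = (u + s *\<^sub>R \<tau>) \<bullet> x" using kl by (simp add: mult.commute)
    thus False using contra e x(1) unfolding linear_at_def by blast
  qed
  define J where "J = support_energy p \<Omega> \<omega>"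
  have "\<omega> \<noteq> \<Omega>" using \<omega>(3) c by auto
  hence "J \<noteq> 0" using support_energy_zero[OF \<Omega> \<omega>(1) p] unfolding J_def by blast
  hence J: "0 < J" using support_energy_nonneg[of p \<Omega> \<omega>] by (simp add: J_def)
  obtain z r where zr: "0 < r" "cball z r \<subseteq> \<omega>"
    using interior_nonempty_if_area_pos[OF \<omega>(1)] \<omega>(3) c mem_interior_cball by blast
  obtain \<kappa> where \<kappa>: "0 < \<kappa>"
    "\<And>K z. \<lbrakk>convex_body K; K \<subseteq> \<Omega>; cball z (r / 2) \<subseteq> K; area K \<le> c\<rbrakk> \<Longrightarrow> J * (1 + \<kappa> * (c - area K)) \<le> support_energy p \<Omega> K"
    using energy_area_penalisation[OF \<Omega> p c(2) sol, of "r / 2"] zr(1) unfolding J_def by (metis half_gt_zero)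
  obtain R where R: "0 < R" "\<Omega> \<subseteq> cball 0 R" using convex_body_bound[OF \<Omega>] .
  define d where "d \<theta> = support_function \<Omega> \<theta> - support_function \<omega> \<theta>" for \<theta>
  have d_nonneg: "0 \<le> d \<theta>" for \<theta> using support_function_mono[OF \<omega>(1) \<Omega> \<omega>(2)] by (simp add: d_def)
  have d_cont: "continuous_on A d" for A
    unfolding d_def using \<Omega> \<omega> by (intro continuous_intros continuous_support_function)
  have d_scale: "d (x *\<^sub>R \<theta>) = x * d \<theta>" if "0 \<le> x" for x \<theta>
    using support_function_scaleR[OF \<Omega> that] support_function_scaleR[OF \<omega>(1) that] by (simp add: d_def algebra_simps)
  have d_le: "d \<theta> \<le> 2 * R * norm \<theta>" for \<theta>
  proof -
    have sf0: "support_function K 0 = 0" if "convex_body K" for K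
      using support_function_scaleR[OF that, of 0 0] by simp
    have "\<omega> \<subseteq> cball 0 R" using \<omega>(2) R(2) by blast
    thus ?thesis
      using support_function_lipschitz[OF \<Omega> R(2), of \<theta> 0] support_function_lipschitz[OF \<omega>(1), of R \<theta> 0] sf0[OF \<Omega>] sf0[OF \<omega>(1)]
      by (simp add: d_def abs_le_iff)
  qed
  \<comment> \<open>\<open>C\<close> is the Taylor constant. \<open>C'\<close> will bound
    \<open>D powr (p - 2) * s\<close>: its first summand for \<open>p \<ge> 2\<close>, using
    \<open>D \<le> 4 * R\<close>, and its second for p < 2, using
    \<open>m * s \<le> D\<close>.\<close>
  define C where "C = p * (p - 1) * 2 powr \<bar>p - 2\<bar>"
  define C' where "C' = (4 * R) powr (p - 2) + m powr (p - 2)"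
  have C: "0 \<le> C" "0 < C'" using p R m by (auto simp: C_def C'_def add_pos_nonneg)
  \<comment> \<open>Chosen so that \<open>C * C' * \<eta> < J * \<kappa> / 2\<close>. The summand 1
    covers p = 1, where \<open>C = 0\<close>.\<close>
  define \<eta> where "\<eta> = J * \<kappa> / (2 * (C * C' + 1))"
  have CC: "0 < C * C' + 1" using C by (simp add: add_nonneg_pos)
  have \<eta>: "0 < \<eta>" using J \<kappa> CC by (simp add: \<eta>_def)
  obtain e1 A where e1: "0 < e1" "e1 \<le> 1" and A: "A \<in> sets circle_measure" "measure circle_measure A < \<eta>"
    "\<And>\<theta>. \<lbrakk>norm \<theta> = 1; 0 < \<theta> \<bullet> u; 0 < \<theta> \<bullet> \<tau>; \<theta> \<bullet> \<tau> \<le> e1 * (\<theta> \<bullet> u)\<rbrakk> \<Longrightarrow> \<theta> \<in> A"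
    using small_arc[OF \<eta>] by blast
  have e: "0 < min e0 e1" using e0 e1 by simp
  show False
  proof (rule perturbed_bodies[OF \<omega>(1) e na])
    fix a b V E and t0 :: real and M
    assume ab: "0 < a" "a < b" "b \<le> min e0 e1" and V0: "\<And>s. s \<le> a \<or> b \<le> s \<Longrightarrow> V s = 0"
      and V: "continuous_on UNIV V" and t0: "0 < t0" and E: "0 < E" "\<And>s. s \<in> {a..b} \<Longrightarrow> (V s)\<^sup>2 \<le> (s - a) * E"
      and M: "\<And>t. \<bar>t\<bar> \<le> t0 \<Longrightarrow> convex_body (M t)"
      "\<And>t \<theta>. \<bar>t\<bar> \<le> t0 \<Longrightarrow> support_function (M t) \<theta> = support_function \<omega> \<theta> + t * lift V \<theta>"
      "\<And>t. \<bar>t\<bar> \<le> t0 \<Longrightarrow> area (M t) \<le> area \<omega> - t\<^sup>2 * E / 2"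
    have "compact (V ` {a..b})" by (intro compact_continuous_image continuous_on_subset[OF V]) auto
    then obtain B where B: "0 < B" "\<And>s. s \<in> {a..b} \<Longrightarrow> \<bar>V s\<bar> \<le> B"
      using compact_imp_bounded bounded_pos by (metis imageI real_norm_def)
    have VB: "\<bar>V s\<bar> \<le> B" for s using B V0[of s] by (cases "s \<in> {a..b}") auto
    \<comment> \<open>The second bound keeps the perturbation below half of \<open>d\<close>, hence
      the body inside \<open>\<Omega>\<close>; the third preserves a ball of radius
      \<open>r / 2\<close>.\<close>
    define t1 where "t1 = min t0 (min (m * a / (2 * B)) (r / (2 * B)))"
    have t1: "0 < t1" using t0 m ab zr B by (simp add: t1_def)
    have t1B: "t1 * B \<le> m * a / 2" "t1 * B \<le> r / 2"
    proof -
      have "t1 * B \<le> m * a / (2 * B) * B" "t1 * B \<le> r / (2 * B) * B"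
        using B(1) by (intro mult_right_mono; simp add: t1_def)+
      thus "t1 * B \<le> m * a / 2" "t1 * B \<le> r / 2" using B(1) by auto
    qed
    have cases: "lift V \<theta> = 0 \<or> (\<exists>l s. 0 < l \<and> l \<le> 1 \<and> s \<in> {a..b} \<and> lift V \<theta> = l * V s \<and>
        d \<theta> = l * d (u + s *\<^sub>R \<tau>) \<and> \<theta> \<in> A)" if n: "norm \<theta> = 1" for \<theta>
    proof (cases "0 < \<theta> \<bullet> u \<and> V ((\<theta> \<bullet> \<tau>) / (\<theta> \<bullet> u)) \<noteq> 0")
      case False
      thus ?thesis by (auto simp: lift_def)
    next
      case True
      define s where "s = (\<theta> \<bullet> \<tau>) / (\<theta> \<bullet> u)"
      have s: "a < s" "s < b" using V0[of s] True by (auto simp: s_def not_le[symmetric])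
      have \<theta>: "\<theta> = (\<theta> \<bullet> u) *\<^sub>R (u + s *\<^sub>R \<tau>)" unfolding s_def using dir_decomp True by blast
      have st: "\<theta> \<bullet> \<tau> = s * (\<theta> \<bullet> u)" using True by (simp add: s_def)
      have "\<theta> \<in> A"
      proof (rule A(3)[OF n])
        show "0 < \<theta> \<bullet> u" using True by blast
        show "0 < \<theta> \<bullet> \<tau>" unfolding st using s ab True by simp
        show "\<theta> \<bullet> \<tau> \<le> e1 * (\<theta> \<bullet> u)" unfolding st using s ab True by (intro mult_right_mono) auto
      qed
      moreover have "\<theta> \<bullet> u \<le> 1"
        using Cauchy_Schwarz_ineq2[of \<theta> u] n uu by (simp add: norm_eq_sqrt_inner)
      moreover have "d \<theta> = (\<theta> \<bullet> u) * d (u + s *\<^sub>R \<tau>)"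
        by (subst \<theta>) (rule d_scale, use True in simp)
      ultimately show ?thesis using True s by (intro disjI2 exI[of _ "\<theta> \<bullet> u"] exI[of _ s]) (auto simp: lift_def s_def)
    qed
    have gap': "m * s \<le> d (u + s *\<^sub>R \<tau>)" if "s \<in> {a..b}" for s
      using gap[of s] that ab by (simp add: d_def)
    have small: "\<bar>t * lift V \<theta>\<bar> \<le> d \<theta> / 2" if "norm \<theta> = 1" "\<bar>t\<bar> \<le> t1" for t \<theta>
      using cases[OF that(1)]
    proof
      assume "\<exists>l s. 0 < l \<and> l \<le> 1 \<and> s \<in> {a..b} \<and> lift V \<theta> = l * V s \<and> d \<theta> = l * d (u + s *\<^sub>R \<tau>) \<and> \<theta> \<in> A"
      then obtain l s where ls: "0 < l" "s \<in> {a..b}" "lift V \<theta> = l * V s" "d \<theta> = l * d (u + s *\<^sub>R \<tau>)" by blast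
      have "\<bar>t\<bar> * \<bar>V s\<bar> \<le> t1 * B" using that(2) VB t1 by (intro mult_mono) auto
      also have "\<dots> \<le> m * a / 2" by (rule t1B)
      also have "\<dots> \<le> m * s / 2" using m ls(2) by simp
      also have "\<dots> \<le> d (u + s *\<^sub>R \<tau>) / 2" using gap'[OF ls(2)] by simp
      finally have "l * (\<bar>t\<bar> * \<bar>V s\<bar>) \<le> l * (d (u + s *\<^sub>R \<tau>) / 2)" using ls(1) by (intro mult_left_mono) auto
      thus ?thesis using ls by (simp add: abs_mult algebra_simps)
    qed (use d_nonneg in simp)
    have small': "\<bar>t * lift V \<theta>\<bar> \<le> r / 2" if "norm \<theta> = 1" "\<bar>t\<bar> \<le> t1" for t \<theta>
      using cases[OF that(1)]
    proof
      assume "\<exists>l s. 0 < l \<and> l \<le> 1 \<and> s \<in> {a..b} \<and> lift V \<theta> = l * V s \<and> d \<theta> = l * d (u + s *\<^sub>R \<tau>) \<and> \<theta> \<in> A"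
      then obtain l s where ls: "0 < l" "l \<le> 1" "lift V \<theta> = l * V s" by blast
      have "\<bar>t\<bar> * (l * \<bar>V s\<bar>) \<le> t1 * (1 * B)"
        using that(2) VB t1 ls B by (intro mult_mono) auto
      thus ?thesis using t1B ls by (simp add: abs_mult)
    qed (use zr in simp)
    have quad: "d \<theta> powr (p - 2) * (lift V \<theta>)\<^sup>2 \<le> C' * E * indicator A \<theta>" if n: "norm \<theta> = 1" for \<theta>
      using cases[OF n]
    proof
      assume "lift V \<theta> = 0"
      thus ?thesis using C E by (simp add: indicator_def)
    next
      assume "\<exists>l s. 0 < l \<and> l \<le> 1 \<and> s \<in> {a..b} \<and> lift V \<theta> = l * V s \<and> d \<theta> = l * d (u + s *\<^sub>R \<tau>) \<and> \<theta> \<in> A"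
      then obtain l s where ls: "0 < l" "l \<le> 1" "s \<in> {a..b}" "lift V \<theta> = l * V s" "d \<theta> = l * d (u + s *\<^sub>R \<tau>)" "\<theta> \<in> A"
        by blast
      define D where "D = d (u + s *\<^sub>R \<tau>)"
      have s: "0 < s" "s \<le> 1" using ls(3) ab e1 by auto
      have D: "m * s \<le> D" using gap'[OF ls(3)] by (simp add: D_def)
      hence D0: "0 < D" using m s by (meson less_le_trans mult_pos_pos)
      have DR: "D \<le> 4 * R"
      proof -
        have nn: "norm u = 1" "norm \<tau> = 1" using uu tt by (auto simp: norm_eq_1)
        have "norm (u + s *\<^sub>R \<tau>) \<le> 2" using norm_triangle_ineq[of u "s *\<^sub>R \<tau>"] s nn by simp
        hence "2 * R * norm (u + s *\<^sub>R \<tau>) \<le> 2 * R * 2" using R by (intro mult_left_mono) auto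
        thus ?thesis using d_le[of "u + s *\<^sub>R \<tau>"] by (simp add: D_def)
      qed
      have Ds: "D powr (p - 2) * s \<le> C'"
      proof (cases "2 \<le> p")
        case True
        have "D powr (p - 2) * s \<le> (4 * R) powr (p - 2) * 1"
          using True D0 DR s by (intro mult_mono powr_mono2) auto
        thus ?thesis by (simp add: C'_def add_increasing2)
      next
        case False
        have "D powr (p - 2) * s \<le> (m * s) powr (p - 2) * s"
          using False D D0 m s by (intro mult_right_mono powr_mono2') auto
        also have "\<dots> = m powr (p - 2) * s powr (p - 1)"
          using m s by (simp add: powr_mult powr_diff power2_eq_square)
        also have "\<dots> \<le> m powr (p - 2) * 1"
          using p s by (intro mult_left_mono powr_le1) auto
        finally show ?thesis by (simp add: C'_def add_increasing)
      qed
      have "(V s)\<^sup>2 \<le> s * E"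
      proof -
        have "(s - a) * E \<le> s * E" using ab E by (intro mult_right_mono) auto
        thus ?thesis using E(2)[OF ls(3)] by linarith
      qed
      hence "D powr (p - 2) * (V s)\<^sup>2 \<le> D powr (p - 2) * (s * E)" by (intro mult_left_mono) auto
      also have "\<dots> = D powr (p - 2) * s * E" by simp
      also have "\<dots> \<le> C' * E" using Ds E by (intro mult_right_mono) auto
      finally have DV: "D powr (p - 2) * (V s)\<^sup>2 \<le> C' * E" .
      \<comment> \<open>\<open>d\<close> and \<open>lift V\<close> are both homogeneous of degree 1,
        so passing from \<open>u + s *\<^sub>R \<tau>\<close> to the unit vector costs
        \<open>l powr p \<le> 1\<close>.\<close>
      have "d \<theta> powr (p - 2) * (lift V \<theta>)\<^sup>2 = l powr p * (D powr (p - 2) * (V s)\<^sup>2)"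
        using ls(1) D0 by (simp add: ls(4,5) D_def[symmetric] powr_mult power_mult_distrib powr_diff)
      also have "\<dots> \<le> 1 * (C' * E)"
        by (rule mult_mono[OF powr_le1 DV]) (use p ls(1,2) in auto)
      finally show ?thesis using ls(6) by simp
    qed
    have v_cont: "continuous_on unit_circle (lift V)"
    proof -
      have "lift V \<theta> = (support_function (M t0) \<theta> - support_function \<omega> \<theta>) / t0" for \<theta>
        using M(2)[of t0 \<theta>] t0 by simp
      hence "lift V = (\<lambda>\<theta>. (support_function (M t0) \<theta> - support_function \<omega> \<theta>) / t0)" by blast
      thus ?thesis using t0 M(1)[of t0] \<omega>(1) by (auto intro!: continuous_intros continuous_support_function)
    qed
    interpret fm: finite_measure circle_measure by (rule finite_measure_circle_measure)
    define F where "F = (\<integral>\<theta>. d \<theta> powr (p - 1) * lift V \<theta> \<partial>circle_measure)"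
    \<comment> \<open>For p = 1 the factor \<open>d powr 0\<close> jumps to 0 at zeros of
      \<open>d\<close>. Integrability therefore rests on measurability and boundedness instead of
      continuity.\<close>
    have F_int: "integrable circle_measure (\<lambda>\<theta>. d \<theta> powr (p - 1) * lift V \<theta>)"
    proof (rule fm.integrable_const_bound[of _ "(2 * R) powr (p - 1) * B"])
      show "(\<lambda>\<theta>. d \<theta> powr (p - 1) * lift V \<theta>) \<in> borel_measurable circle_measure"
        by (intro borel_measurable_times powr_real_measurable borel_measurable_circle_measure d_cont v_cont) auto
      show "AE \<theta> in circle_measure. norm (d \<theta> powr (p - 1) * lift V \<theta>) \<le> (2 * R) powr (p - 1) * B"
      proof (intro AE_I2)
        fix \<theta> assume "\<theta> \<in> space circle_measure"
        hence n: "norm \<theta> = 1" by (simp add: space_circle_measure)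
        have "\<bar>lift V \<theta>\<bar> \<le> B"
          using cases[OF n]
        proof
          assume "\<exists>l s. 0 < l \<and> l \<le> 1 \<and> s \<in> {a..b} \<and> lift V \<theta> = l * V s \<and> d \<theta> = l * d (u + s *\<^sub>R \<tau>) \<and> \<theta> \<in> A"
          then obtain l s where ls: "0 < l" "l \<le> 1" "lift V \<theta> = l * V s" by blast
          have "l * \<bar>V s\<bar> \<le> 1 * B" using ls VB by (intro mult_mono) auto
          thus ?thesis using ls by (simp add: abs_mult)
        qed (use B in simp)
        moreover have "d \<theta> powr (p - 1) \<le> (2 * R) powr (p - 1)"
          using d_le[of \<theta>] d_nonneg[of \<theta>] n p by (intro powr_mono2) auto
        ultimately show "norm (d \<theta> powr (p - 1) * lift V \<theta>) \<le> (2 * R) powr (p - 1) * B"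
          by (simp add: abs_mult mult_mono)
      qed
    qed
    \<comment> \<open>The sign makes the first-order change \<open>- p * t * F\<close> of the energy
      nonpositive.\<close>
    define t where "t = (if 0 \<le> F then t1 else - t1)"
    have t: "\<bar>t\<bar> = t1" "0 \<le> t * F" "t\<^sup>2 = t1\<^sup>2"
      using t1 by (auto simp: t_def mult_nonneg_nonpos)
    have tt0: "\<bar>t\<bar> \<le> t0" unfolding t(1) by (simp add: t1_def)
    have Mt: "convex_body (M t)" by (rule M(1)[OF tt0])
    have sf: "support_function (M t) \<theta> = support_function \<omega> \<theta> + t * lift V \<theta>" for \<theta> by (rule M(2)[OF tt0])
    have area_M: "area (M t) \<le> c - t1\<^sup>2 * E / 2" using M(3)[OF tt0] \<omega>(3) t(3) by simp
    have "M t \<subseteq> \<Omega>"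
    proof (rule subset_if_support_function_le[OF Mt \<Omega>])
      fix \<theta> :: "real^2" assume n: "norm \<theta> = 1"
      have "t * lift V \<theta> \<le> d \<theta>" using small[OF n, of t] t(1) d_nonneg[of \<theta>] by (auto simp: abs_le_iff)
      thus "support_function (M t) \<theta> \<le> support_function \<Omega> \<theta>" by (simp add: sf d_def)
    qed
    moreover have "cball z (r / 2) \<subseteq> M t"
    proof (rule subset_if_support_function_le[OF convex_body_cball Mt])
      fix \<theta> :: "real^2" assume n: "norm \<theta> = 1"
      have "support_function (cball z r) \<theta> \<le> support_function \<omega> \<theta>"
        using zr by (intro support_function_mono convex_body_cball \<omega>) auto
      moreover have "- (r / 2) \<le> t * lift V \<theta>" using small'[OF n, of t] t(1) by (auto simp: abs_le_iff)
      ultimately show "support_function (cball z (r / 2)) \<theta> \<le> support_function (M t) \<theta>"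
        using zr n by (simp add: sf support_function_cball)
    qed (use zr in simp)
    moreover have "area (M t) \<le> c" using area_M E by (simp add: order_trans[OF area_M])
    ultimately have lower: "J * (1 + \<kappa> * (c - area (M t))) \<le> support_energy p \<Omega> (M t)"
      by (intro \<kappa>(2) Mt)
    have upper: "support_energy p \<Omega> (M t) \<le> J - p * t * F + C * t1\<^sup>2 * (C' * E * measure circle_measure A)"
    proof -
      have i1: "integrable circle_measure (\<lambda>\<theta>. \<bar>support_function \<Omega> \<theta> - support_function \<omega> \<theta>\<bar> powr p)"
        by (intro integrable_circle_measure continuous_support_energy_integrand \<Omega> \<omega> p)
      have i2: "integrable circle_measure (\<lambda>\<theta>. p * t * (d \<theta> powr (p - 1) * lift V \<theta>))"
        by (intro integrable_mult_right F_int)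
      have i3: "integrable circle_measure (\<lambda>\<theta>. C * t1\<^sup>2 * (C' * E * indicator A \<theta>))"
        using A(1) by (intro integrable_mult_right integrable_real_indicator) (auto simp: less_top[symmetric])
      have "support_energy p \<Omega> (M t) \<le> (\<integral>\<theta>. \<bar>support_function \<Omega> \<theta> - support_function \<omega> \<theta>\<bar> powr p
          - p * t * (d \<theta> powr (p - 1) * lift V \<theta>) + C * t1\<^sup>2 * (C' * E * indicator A \<theta>) \<partial>circle_measure)"
        unfolding support_energy_def
      proof (rule integral_mono)
        show "integrable circle_measure (\<lambda>\<theta>. \<bar>support_function \<Omega> \<theta> - support_function (M t) \<theta>\<bar> powr p)"
          by (intro integrable_circle_measure continuous_support_energy_integrand \<Omega> Mt p)
        show "integrable circle_measure (\<lambda>\<theta>. \<bar>support_function \<Omega> \<theta> - support_function \<omega> \<theta>\<bar> powr p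
          - p * t * (d \<theta> powr (p - 1) * lift V \<theta>) + C * t1\<^sup>2 * (C' * E * indicator A \<theta>))"
          by (intro Bochner_Integration.integrable_add Bochner_Integration.integrable_diff i1 i2 i3)
        fix \<theta> assume "\<theta> \<in> space circle_measure"
        hence n: "norm \<theta> = 1" by (simp add: space_circle_measure)
        have sm: "\<bar>t * lift V \<theta>\<bar> \<le> d \<theta> / 2" using small[OF n, of t] t(1) by simp
        have "support_function \<Omega> \<theta> - support_function (M t) \<theta> = d \<theta> - t * lift V \<theta>" by (simp add: sf d_def)
        moreover have "0 \<le> d \<theta> - t * lift V \<theta>" using sm d_nonneg[of \<theta>] by linarith
        ultimately have "\<bar>support_function \<Omega> \<theta> - support_function (M t) \<theta>\<bar> powr p = (d \<theta> - t * lift V \<theta>) powr p" by simp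
        also have "\<dots> \<le> d \<theta> powr p - p * (d \<theta> powr (p - 1) * (t * lift V \<theta>)) + C * (d \<theta> powr (p - 2) * (t * lift V \<theta>)\<^sup>2)"
          unfolding C_def by (rule powr_minus_le[OF p sm])
        also have "d \<theta> powr p = \<bar>support_function \<Omega> \<theta> - support_function \<omega> \<theta>\<bar> powr p"
          using d_nonneg[of \<theta>] by (simp add: d_def)
        also have "C * (d \<theta> powr (p - 2) * (t * lift V \<theta>)\<^sup>2) = C * t1\<^sup>2 * (d \<theta> powr (p - 2) * (lift V \<theta>)\<^sup>2)"
          by (simp add: power_mult_distrib t(3))
        also have "\<dots> \<le> C * t1\<^sup>2 * (C' * E * indicator A \<theta>)"
          using C by (intro mult_left_mono quad[OF n]) auto
        finally show "\<bar>support_function \<Omega> \<theta> - support_function (M t) \<theta>\<bar> powr p \<le>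
            \<bar>support_function \<Omega> \<theta> - support_function \<omega> \<theta>\<bar> powr p
          - p * t * (d \<theta> powr (p - 1) * lift V \<theta>) + C * t1\<^sup>2 * (C' * E * indicator A \<theta>)" by (simp add: mult.assoc mult.left_commute[of t])
      qed
      also have "\<dots> = J - p * t * F + C * t1\<^sup>2 * (C' * E * measure circle_measure A)"
        using i1 i2 i3 A(1) by (simp add: J_def F_def support_energy_def)
      finally show ?thesis .
    qed
    \<comment> \<open>Penalty against second-order cost: both carry the factor
      \<open>t1\<^sup>2 * E\<close>, and dividing it out contradicts the choice of
      \<open>\<eta>\<close>.\<close>
    have "J * (\<kappa> * (t1\<^sup>2 * E / 2)) \<le> J * (\<kappa> * (c - area (M t)))"
      using J \<kappa> area_M by (intro mult_left_mono) auto
    also have "\<dots> \<le> C * t1\<^sup>2 * (C' * E * measure circle_measure A)"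
    proof -
      have "0 \<le> p * t * F" using t(2) p by (simp add: mult.assoc)
      thus ?thesis using lower upper by (simp add: distrib_left)
    qed
    also have "\<dots> = (t1\<^sup>2 * E) * (C * C' * measure circle_measure A)" by simp
    finally have "(t1\<^sup>2 * E) * (J * \<kappa> / 2) \<le> (t1\<^sup>2 * E) * (C * C' * measure circle_measure A)"
      by (simp add: algebra_simps)
    hence "J * \<kappa> / 2 \<le> C * C' * measure circle_measure A" using t1 E by simp
    also have "\<dots> \<le> C * C' * \<eta>" using C A(2) by (intro mult_left_mono) auto
    also have "\<dots> < (C * C' + 1) * \<eta>" using \<eta> by (simp add: distrib_right)
    also have "\<dots> = J * \<kappa> / 2"
    proof -
      have "w * (x / (2 * w)) = x / 2" if "w \<noteq> 0" for w x :: real using that by simp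
      thus ?thesis using CC unfolding \<eta>_def by (metis less_irrefl)
    qed
    finally show False by simp
  qed assumption
qed

end

subsection \<open>Locally finite unions of segments\<close>

lemma polygonal_line_closed_segment:
  assumes "a \<noteq> b"
  shows "polygonal_line (closed_segment a b)"
  unfolding polygonal_line_def using assms by (intro exI[of _ "[a, b]"]) (auto simp: less_Suc_eq)

lemma segment_Int_cball:
  fixes a b :: "real^2"
  obtains "closed_segment a b \<inter> cball x r = {}" | c d where "closed_segment a b \<inter> cball x r = closed_segment c d"
proof (cases "closed_segment a b \<inter> cball x r = {}")
  case False
  have "collinear (closed_segment a b \<inter> cball x r)"
    by (rule collinear_subset[OF collinear_closed_segment]) blast
  then obtain c d where "closed_segment a b \<inter> cball x r = closed_segment c d"
    using compact_convex_collinear_segment[OF False] by (meson compact_Int compact_cball compact_segment convex_Int convex_cball convex_closed_segment)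
  thus ?thesis by (rule that(2))
qed (use that in blast)

text \<open>Local finiteness comes from covering the part of \<open>C\<close> at distance about \<open>1 / n\<close> from the
  complement of \<open>G\<close> by finitely many pieces that stay at a comparable distance.\<close>

lemma locally_finite_segments:
  fixes C G :: "(real^2) set"
  assumes C: "compact C" and G: "open G" "G \<noteq> UNIV"
    and loc: "\<And>x. x \<in> C \<inter> G \<Longrightarrow> \<exists>\<delta>>0. \<exists>F. finite F \<and> (\<forall>(a, b)\<in>F. closed_segment a b \<subseteq> C) \<and>
      C \<inter> ball x \<delta> \<subseteq> (\<Union>(a, b)\<in>F. closed_segment a b)"
  obtains \<Q> where "\<And>Q. Q \<in> \<Q> \<Longrightarrow> Q = {} \<or> (\<exists>a b. Q = closed_segment a b)" "\<Union>\<Q> = C \<inter> G"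
    "\<And>y. y \<in> C \<inter> G \<Longrightarrow> \<exists>V. open V \<and> y \<in> V \<and> finite {Q \<in> \<Q>. Q \<inter> V \<noteq> {}}"
proof -
  define \<rho> where "\<rho> x = infdist x (- G)" for x
  have G': "closed (- G)" "- G \<noteq> {}" using G by auto
  have \<rho>_pos: "0 < \<rho> x \<longleftrightarrow> x \<in> G" for x
    using infdist_pos_not_in_closed[OF G', of x] infdist_zero[of x "- G"] unfolding \<rho>_def
    by (cases "x \<in> G") auto
  have \<rho>_lip: "\<rho> x \<le> \<rho> y + dist x y" for x y unfolding \<rho>_def by (rule infdist_triangle)
  have \<rho>_cont: "continuous_on A \<rho>" for A unfolding \<rho>_def by (intro continuous_intros)
  obtain \<delta> F where \<delta>: "\<And>x. x \<in> C \<inter> G \<Longrightarrow> 0 < \<delta> x" and F: "\<And>x. x \<in> C \<inter> G \<Longrightarrow> finite (F x)"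
    "\<And>x a b. \<lbrakk>x \<in> C \<inter> G; (a, b) \<in> F x\<rbrakk> \<Longrightarrow> closed_segment a b \<subseteq> C"
    "\<And>x. x \<in> C \<inter> G \<Longrightarrow> C \<inter> ball x (\<delta> x) \<subseteq> (\<Union>(a, b)\<in>F x. closed_segment a b)"
    using loc by (metis (no_types, lifting) case_prodD)
  \<comment> \<open>The first half fits a closed ball into \<open>ball x (\<delta> x)\<close>; the
    second keeps the piece inside \<open>G\<close> and \<open>\<rho>\<close> on it at most 3/2 of
    its value at \<open>x\<close>.\<close>
  define r where "r x = min (\<delta> x / 2) (\<rho> x / 2)" for x
  have r: "0 < r x" "r x < \<delta> x" "r x \<le> \<rho> x / 2" if "x \<in> C \<inter> G" for x
    using \<delta>[OF that] \<rho>_pos[of x] that by (auto simp: r_def)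
  \<comment> \<open>Compact shells that exhaust \<open>C \<inter> G\<close>; the shell
    \<open>n = 0\<close> has no upper bound and takes all points far from the complement.\<close>
  define T where "T n = {x \<in> C. 1 / real (n + 2) \<le> \<rho> x \<and> (n = 0 \<or> \<rho> x \<le> 1 / real (n + 1))}" for n
  have TC: "T n \<subseteq> C \<inter> G" for n
  proof
    fix x assume "x \<in> T n"
    hence "x \<in> C" "1 / real (n + 2) \<le> \<rho> x" by (auto simp: T_def)
    moreover have "0 < 1 / real (n + 2)" by simp
    ultimately show "x \<in> C \<inter> G" using \<rho>_pos[of x] by (meson IntI less_le_trans)
  qed
  have Tcov: "\<exists>n. x \<in> T n" if "x \<in> C \<inter> G" for x
  proof -
    have pos: "0 < \<rho> x" using \<rho>_pos that by blast
    define k where "k = nat \<lfloor>1 / \<rho> x\<rfloor>"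
    have k: "real k \<le> 1 / \<rho> x" "1 / \<rho> x < real k + 1"
      using pos unfolding k_def by (auto simp: of_nat_nat)
    show ?thesis
    proof (cases "k = 0")
      case True
      hence "1 < \<rho> x" using k(2) pos by (simp add: field_simps)
      thus ?thesis using that by (intro exI[of _ 0]) (auto simp: T_def)
    next
      case False
      have "1 / real (k - 1 + 2) \<le> \<rho> x" using k(2) pos False by (simp add: field_simps of_nat_diff)
      moreover have "\<rho> x \<le> 1 / real (k - 1 + 1)" using k(1) pos False by (simp add: field_simps)
      ultimately show ?thesis using that unfolding T_def by (intro exI[of _ "k - 1"]) blast
    qed
  qed
  have "\<exists>X. X \<subseteq> T n \<and> finite X \<and> T n \<subseteq> (\<Union>x\<in>X. ball x (r x))" for n
  proof -
    have eq: "T n = C \<inter> ({x. 1 / real (n + 2) \<le> \<rho> x} \<inter> (if n = 0 then UNIV else {x. \<rho> x \<le> 1 / real (n + 1)}))"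
      by (auto simp: T_def)
    have cl: "closed {x. k \<le> \<rho> x}" "closed {x. \<rho> x \<le> k}" for k
      by (intro closed_Collect_le \<rho>_cont continuous_intros)+
    have "closed ({x. 1 / real (n + 2) \<le> \<rho> x} \<inter> (if n = 0 then UNIV else {x. \<rho> x \<le> 1 / real (n + 1)}))"
      by (intro closed_Int cl) (split if_split, intro conjI impI closed_UNIV cl)
    hence cT: "compact (T n)" unfolding eq by (intro compact_Int_closed C)
    have sub: "T n \<subseteq> (\<Union>x\<in>T n. ball x (r x))" using r(1) TC by force
    obtain X where "X \<subseteq> T n" "finite X" "T n \<subseteq> (\<Union>x\<in>X. ball x (r x))"
      by (rule compactE_image[OF cT _ sub]) (simp, blast)
    thus ?thesis by blast
  qed
  then obtain X where X: "\<And>n. X n \<subseteq> T n" "\<And>n. finite (X n)" "\<And>n. T n \<subseteq> (\<Union>x\<in>X n. ball x (r x))"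
    by metis
  define \<Q>n where "\<Q>n n = (\<Union>x\<in>X n. (\<lambda>(a, b). closed_segment a b \<inter> cball x (r x)) ` F x)" for n
  define \<Q> where "\<Q> = (\<Union>n. \<Q>n n)"
  have XC: "x \<in> C \<inter> G" if "x \<in> X n" for x n using that X(1) TC by blast
  have fin: "finite (\<Q>n n)" for n
    unfolding \<Q>n_def using X(2) F(1) XC by (intro finite_UN_I finite_imageI) blast+
  have Q_near: "\<exists>x\<in>X n. \<exists>a b. (a, b) \<in> F x \<and> Q = closed_segment a b \<inter> cball x (r x)" if "Q \<in> \<Q>n n" for Q n
    using that by (auto simp: \<Q>n_def)
  have Q_upper: "\<rho> y \<le> 2 / real (n + 1)" if Q: "Q \<in> \<Q>n n" "n \<noteq> 0" "y \<in> Q" for Q n y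
  proof -
    obtain x where x: "x \<in> X n" "y \<in> cball x (r x)" using Q_near[OF Q(1)] Q(3) by blast
    have "\<rho> x \<le> 1 / real (n + 1)" using x(1) X(1)[of n] Q(2) unfolding T_def by blast
    moreover have "\<rho> y \<le> \<rho> x + \<rho> x / 2"
      using \<rho>_lip[of y x] x(2) r(3)[OF XC[OF x(1)]] by (simp add: dist_commute)
    moreover have "0 \<le> 1 / real (n + 1)" "2 / real (n + 1) = 2 * (1 / real (n + 1))" by simp_all
    ultimately show ?thesis by linarith
  qed
  show ?thesis
  proof (rule that[of \<Q>])
    fix Q assume "Q \<in> \<Q>"
    then obtain n where "Q \<in> \<Q>n n" by (auto simp: \<Q>_def)
    then obtain x a b where "Q = closed_segment a b \<inter> cball x (r x)" using Q_near by blast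
    thus "Q = {} \<or> (\<exists>a b. Q = closed_segment a b)" by (metis segment_Int_cball)
  next
    show "\<Union>\<Q> = C \<inter> G"
    proof (intro subset_antisym subsetI)
      fix y assume "y \<in> \<Union>\<Q>"
      then obtain n Q where Q: "Q \<in> \<Q>n n" "y \<in> Q" by (auto simp: \<Q>_def)
      then obtain x a b where x: "x \<in> X n" "(a, b) \<in> F x" "Q = closed_segment a b \<inter> cball x (r x)"
        using Q_near by blast
      have "y \<in> C" using F(2)[OF XC[OF x(1)] x(2)] x(3) Q(2) by blast
      moreover have "y \<in> G"
      proof -
        have "\<rho> x \<le> \<rho> y + r x" using \<rho>_lip[of x y] Q(2) x(3) by simp
        moreover have "0 < \<rho> x" using \<rho>_pos XC[OF x(1)] by blast
        ultimately have "0 < \<rho> y" using r(3)[OF XC[OF x(1)]] by linarith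
        thus ?thesis by (simp add: \<rho>_pos)
      qed
      ultimately show "y \<in> C \<inter> G" by blast
    next
      fix y assume y: "y \<in> C \<inter> G"
      obtain n where "y \<in> T n" using Tcov[OF y] by blast
      then obtain x where x: "x \<in> X n" "y \<in> ball x (r x)" using X(3) by blast
      have "y \<in> C \<inter> ball x (\<delta> x)" using x(2) r(2)[OF XC[OF x(1)]] y by auto
      then obtain a b where ab: "(a, b) \<in> F x" "y \<in> closed_segment a b" using F(3)[OF XC[OF x(1)]] by blast
      have "closed_segment a b \<inter> cball x (r x) \<in> \<Q>n n" unfolding \<Q>n_def using x(1) ab(1) by force
      moreover have "y \<in> closed_segment a b \<inter> cball x (r x)" using ab x by auto
      ultimately show "y \<in> \<Union>\<Q>" unfolding \<Q>_def by blast
    qed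
  next
    fix y assume y: "y \<in> C \<inter> G"
    have pos: "0 < \<rho> y" using \<rho>_pos y by blast
    \<comment> \<open>By \<open>Q_upper\<close>, pieces from shells of large index have small
      \<open>\<rho>\<close> and cannot meet this neighbourhood.\<close>
    define V where "V = {z. \<rho> y / 2 < \<rho> z}"
    obtain N where N: "4 < real N * \<rho> y" using reals_Archimedean3[OF pos] by blast
    have "{Q \<in> \<Q>. Q \<inter> V \<noteq> {}} \<subseteq> (\<Union>n\<le>N. \<Q>n n)"
    proof
      fix Q assume Q: "Q \<in> {Q \<in> \<Q>. Q \<inter> V \<noteq> {}}"
      then obtain n z where n: "Q \<in> \<Q>n n" "z \<in> Q" "\<rho> y / 2 < \<rho> z" by (auto simp: \<Q>_def V_def)
      have "n \<le> N"
      proof (rule ccontr)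
        assume "\<not> n \<le> N"
        hence "\<rho> z \<le> 2 / real (n + 1)" using Q_upper[OF n(1) _ n(2)] by simp
        moreover have "4 / real (n + 1) = 2 * (2 / real (n + 1))" by simp
        ultimately have "\<rho> y < 4 / real (n + 1)" using n(3) by linarith
        hence "\<rho> y * real (n + 1) < 4" by (simp add: pos_less_divide_eq)
        moreover have "real N * \<rho> y \<le> real (n + 1) * \<rho> y"
          using \<open>\<not> n \<le> N\<close> pos by (intro mult_right_mono) auto
        ultimately show False using N by (simp add: mult.commute)
      qed
      thus "Q \<in> (\<Union>n\<le>N. \<Q>n n)" using n(1) by blast
    qed
    hence "finite {Q \<in> \<Q>. Q \<inter> V \<noteq> {}}" by (rule finite_subset) (use fin in auto)
    moreover have "open V" unfolding V_def by (intro open_Collect_less continuous_intros \<rho>_cont)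
    ultimately show "\<exists>V. open V \<and> y \<in> V \<and> finite {Q \<in> \<Q>. Q \<inter> V \<noteq> {}}"
      using pos by (intro exI[of _ V]) (auto simp: V_def)
  qed
qed

text \<open>Degenerate pieces must be discarded. Near \<open>y\<close> they form a finite set, so
  \<open>y\<close>, being a limit point of \<open>C\<close>, is a limit point of the nondegenerate
  pieces, whose finite union is closed.\<close>

lemma union_of_polygonal_lines_if_local:
  fixes C G :: "(real^2) set"
  assumes C: "compact C" and G: "open G" "G \<noteq> UNIV"
    and loc: "\<And>x. x \<in> C \<inter> G \<Longrightarrow> \<exists>\<delta>>0. \<exists>F. finite F \<and> (\<forall>(a, b)\<in>F. closed_segment a b \<subseteq> C) \<and>
      C \<inter> ball x \<delta> \<subseteq> (\<Union>(a, b)\<in>F. closed_segment a b)"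
    and lim: "\<And>x. x \<in> C \<inter> G \<Longrightarrow> x islimpt C"
  shows "union_of_polygonal_lines (C \<inter> G)"
proof -
  obtain \<Q> where \<Q>: "\<And>Q. Q \<in> \<Q> \<Longrightarrow> Q = {} \<or> (\<exists>a b. Q = closed_segment a b)" "\<Union>\<Q> = C \<inter> G"
    "\<And>y. y \<in> C \<inter> G \<Longrightarrow> \<exists>V. open V \<and> y \<in> V \<and> finite {Q \<in> \<Q>. Q \<inter> V \<noteq> {}}"
    using locally_finite_segments[OF C G loc] by blast
  define \<P> where "\<P> = {Q \<in> \<Q>. \<exists>a b. a \<noteq> b \<and> Q = closed_segment a b}"
  have sub: "\<Union>\<P> \<subseteq> C \<inter> G" using \<Q>(2) by (auto simp: \<P>_def)
  have sup: "y \<in> \<Union>\<P>" if y: "y \<in> C \<inter> G" for y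
  proof -
    obtain V where V: "open V" "y \<in> V" "finite {Q \<in> \<Q>. Q \<inter> V \<noteq> {}}" using \<Q>(3)[OF y] by blast
    define \<N> where "\<N> = {Q \<in> \<Q>. Q \<inter> V \<noteq> {}}"
    have deg: "finite Q" if QN: "Q \<in> \<N> - \<P>" for Q
    proof (cases "Q = {}")
      case False
      then obtain a b where ab: "Q = closed_segment a b" using \<Q>(1)[of Q] QN by (auto simp: \<N>_def)
      have "a = b"
      proof (rule ccontr)
        assume "a \<noteq> b"
        hence "Q \<in> \<P>" unfolding \<P>_def using ab QN \<N>_def by blast
        thus False using QN by blast
      qed
      thus ?thesis using ab by simp
    qed simp
    have GV: "open (G \<inter> V)" "y \<in> G \<inter> V" using G V y by auto
    have "y islimpt (C \<inter> (G \<inter> V))"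
    proof (rule islimptI)
      fix T assume "y \<in> T" "open T"
      thus "\<exists>z\<in>C \<inter> (G \<inter> V). z \<in> T \<and> z \<noteq> y"
        using islimptE[OF lim[OF y], of "T \<inter> (G \<inter> V)"] GV by blast
    qed
    moreover have "C \<inter> (G \<inter> V) \<subseteq> \<Union>(\<N> - \<P>) \<union> \<Union>(\<N> \<inter> \<P>)"
    proof
      fix z assume "z \<in> C \<inter> (G \<inter> V)"
      hence "z \<in> \<Union>\<Q>" "z \<in> V" using \<Q>(2) by auto
      thus "z \<in> \<Union>(\<N> - \<P>) \<union> \<Union>(\<N> \<inter> \<P>)" by (auto simp: \<N>_def)
    qed
    ultimately have "y islimpt (\<Union>(\<N> - \<P>) \<union> \<Union>(\<N> \<inter> \<P>))" by (rule islimpt_subset)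
    moreover have "finite (\<Union>(\<N> - \<P>))" using V(3) deg by (auto simp: \<N>_def)
    ultimately have "y islimpt \<Union>(\<N> \<inter> \<P>)" by (simp add: islimpt_Un_finite)
    moreover have "closed (\<Union>(\<N> \<inter> \<P>))"
      using V(3) by (intro closed_Union) (auto simp: \<N>_def \<P>_def)
    ultimately show ?thesis by (auto simp: closed_limpt)
  qed
  have "locally_finite_in (top_of_set (C \<inter> G)) \<P>"
    unfolding locally_finite_in_def
  proof (intro conjI ballI)
    show "\<Union>\<P> \<subseteq> topspace (top_of_set (C \<inter> G))" using sub by simp
    fix y assume "y \<in> topspace (top_of_set (C \<inter> G))"
    hence y: "y \<in> C \<inter> G" by simp
    obtain V where V: "open V" "y \<in> V" "finite {Q \<in> \<Q>. Q \<inter> V \<noteq> {}}" using \<Q>(3)[OF y] by blast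
    have "{U \<in> \<P>. U \<inter> ((C \<inter> G) \<inter> V) \<noteq> {}} \<subseteq> {Q \<in> \<Q>. Q \<inter> V \<noteq> {}}" by (auto simp: \<P>_def)
    hence "finite {U \<in> \<P>. U \<inter> ((C \<inter> G) \<inter> V) \<noteq> {}}" using V(3) by (rule finite_subset)
    moreover have "openin (top_of_set (C \<inter> G)) ((C \<inter> G) \<inter> V)" using V(1) by (rule openin_open_Int)
    ultimately show "\<exists>V. openin (top_of_set (C \<inter> G)) V \<and> y \<in> V \<and> finite {U \<in> \<P>. U \<inter> V \<noteq> {}}"
      using V(2) y by (intro exI[of _ "(C \<inter> G) \<inter> V"]) auto
  qed
  moreover have "\<forall>P\<in>\<P>. polygonal_line P" by (auto simp: \<P>_def polygonal_line_closed_segment)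
  moreover have "\<Union>\<P> = C \<inter> G" using sub sup by blast
  ultimately show ?thesis unfolding union_of_polygonal_lines_def by blast
qed

text \<open>A punctured disc about \<open>x\<close> is connected and meets both the body and its
  complement, hence the frontier.\<close>

lemma frontier_convex_body_islimpt:
  assumes K: "convex_body K" "interior K \<noteq> {}" and x: "x \<in> frontier K"
  shows "x islimpt frontier K"
proof (rule islimptI)
  fix T :: "(real^2) set" assume T: "x \<in> T" "open T"
  then obtain e where e: "0 < e" "ball x e \<subseteq> T" using open_contains_ball by blast
  have closed: "closed K" and convex: "convex K" using K by (auto simp: convex_body_def compact_imp_closed)
  have xK: "x \<in> K" "x \<notin> interior K" using x closed by (auto simp: frontier_def)
  have "connected (ball x e - {x})" 
    using e aff_dim_open[of "ball x e"] by (intro connected_punctured_convex convex_ball) auto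
  moreover have "(ball x e - {x}) \<inter> K \<noteq> {}"
  proof -
    have "x \<in> closure (interior K)" using convex_closure_interior[OF convex K(2)] xK closure_subset by blast
    then obtain y where "y \<in> interior K" "dist y x < e" using e closure_approachable by blast
    thus ?thesis using xK interior_subset[of K] by (auto simp: dist_commute)
  qed
  moreover have "(ball x e - {x}) - K \<noteq> {}"
  proof -
    have "x \<in> closure (- K)" using x by (simp add: frontier_closures)
    then obtain y where "y \<in> - K" "dist y x < e" using e closure_approachable by blast
    thus ?thesis using xK by (auto simp: dist_commute)
  qed
  ultimately have "(ball x e - {x}) \<inter> frontier K \<noteq> {}" by (rule connected_Int_frontier)
  thus "\<exists>y\<in>frontier K. y \<in> T \<and> y \<noteq> x" using e by blast
qed

subsection \<open>Corners and the main theorem\<close>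

text \<open>Seen from the directions in \<open>U\<close>, the body looks like the segment from
  \<open>x\<close> to \<open>y\<close>; \<open>x = y\<close> is a plain vertex.\<close>

definition corner :: "(real^2) set \<Rightarrow> (real^2) set \<Rightarrow> real^2 \<Rightarrow> real^2 \<Rightarrow> bool" where
  "corner K U x y \<longleftrightarrow> x \<in> K \<and> y \<in> K \<and> (\<forall>\<theta>\<in>U. support_function K \<theta> = max (\<theta> \<bullet> x) (\<theta> \<bullet> y)) \<and>
     (\<forall>z\<in>K. \<forall>\<theta>\<in>U. \<theta> \<bullet> z = support_function K \<theta> \<longrightarrow> z \<in> closed_segment x y)"

context frame
begin

lemma frame_uminus: "frame u (- \<tau>)"
  by unfold_locales (simp_all add: uu tt ut)

text \<open>The contact points on the two sides of \<open>u\<close> are the ends of the face with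
  normal \<open>u\<close>, and all directions in a cone around \<open>u\<close> touch only this
  face.\<close>

lemma corner_if_linear:
  assumes K: "convex_body K" and e: "0 < e" and xy: "x \<in> K" "y \<in> K"
    and left: "\<And>s. s \<in> {0..e} \<Longrightarrow> support_function K (u + s *\<^sub>R (- \<tau>)) = (u + s *\<^sub>R (- \<tau>)) \<bullet> x"
    and right: "\<And>s. s \<in> {0..e} \<Longrightarrow> support_function K (u + s *\<^sub>R \<tau>) = (u + s *\<^sub>R \<tau>) \<bullet> y"
  shows "\<exists>U. open U \<and> u \<in> U \<and> corner K U x y \<and> (\<forall>z\<in>closed_segment x y. u \<bullet> z = support_function K u)"
proof -
  define U where "U = {\<theta>. 0 < u \<bullet> \<theta>} \<inter> {\<theta>. \<bar>\<tau> \<bullet> \<theta>\<bar> < e * (u \<bullet> \<theta>)}"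
  let ?h = "\<lambda>s. support_function K (u + s *\<^sub>R \<tau>)"
  have hr: "?h s = y \<bullet> u + s * (y \<bullet> \<tau>)" if "0 \<le> s" "s \<le> e" for s
    using right[of s] that by simp
  have hl: "?h s = x \<bullet> u + s * (x \<bullet> \<tau>)" if "- e \<le> s" "s \<le> 0" for s
  proof -
    have "u + (- s) *\<^sub>R (- \<tau>) = u + s *\<^sub>R \<tau>" by simp
    thus ?thesis using left[of "- s"] that inner_dir[of s x] by (simp del: inner_dir) 
  qed
  have up: "z \<bullet> u + s * (z \<bullet> \<tau>) \<le> ?h s" if "z \<in> K" for z s
    using support_function_upper[OF K that, of "u + s *\<^sub>R \<tau>"] by simp
  have xyu: "x \<bullet> u = y \<bullet> u" using hr[of 0] hl[of 0] e by simp
  have xy\<tau>: "x \<bullet> \<tau> \<le> y \<bullet> \<tau>"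
    using up[OF xy(1), of e] hr[of e] e xyu by simp
  have dec: "\<exists>l s. 0 < l \<and> \<bar>s\<bar> < e \<and> \<theta> = l *\<^sub>R (u + s *\<^sub>R \<tau>)" if "\<theta> \<in> U" for \<theta>
  proof (intro exI conjI)
    have pos: "0 < \<theta> \<bullet> u" and b: "\<bar>\<theta> \<bullet> \<tau>\<bar> < e * (\<theta> \<bullet> u)"
      using that by (auto simp: U_def inner_commute[of \<theta>])
    show "0 < \<theta> \<bullet> u" by (rule pos)
    show "\<bar>(\<theta> \<bullet> \<tau>) / (\<theta> \<bullet> u)\<bar> < e" using pos b by (simp add: abs_divide pos_divide_less_eq)
    show "\<theta> = (\<theta> \<bullet> u) *\<^sub>R (u + ((\<theta> \<bullet> \<tau>) / (\<theta> \<bullet> u)) *\<^sub>R \<tau>)" by (rule dir_decomp[OF pos])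
  qed
  have "open U" unfolding U_def by (intro open_Int open_Collect_less continuous_intros)
  moreover have "u \<in> U" using e by (simp add: U_def uu tu)
  moreover have "corner K U x y" unfolding corner_def
  proof (intro conjI ballI impI xy)
    fix \<theta> assume "\<theta> \<in> U"
    then obtain l s where ls: "0 < l" "\<bar>s\<bar> < e" and \<theta>: "\<theta> = l *\<^sub>R (u + s *\<^sub>R \<tau>)" using dec by blast
    have "?h s = max (x \<bullet> u + s * (x \<bullet> \<tau>)) (y \<bullet> u + s * (y \<bullet> \<tau>))"
      using hr[of s] hl[of s] up[OF xy(1), of s] up[OF xy(2), of s] ls by (cases "0 \<le> s") auto
    moreover have "support_function K \<theta> = l * ?h s"
      unfolding \<theta> using ls by (intro support_function_scaleR[OF K]) simp
    moreover have "\<theta> \<bullet> w = l * (w \<bullet> u + s * (w \<bullet> \<tau>))" for w unfolding \<theta> by simp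
    ultimately show "support_function K \<theta> = max (\<theta> \<bullet> x) (\<theta> \<bullet> y)"
      using ls by (simp add: max_def)
  next
    fix z \<theta> assume z: "z \<in> K" and "\<theta> \<in> U" and eq: "\<theta> \<bullet> z = support_function K \<theta>"
    then obtain l s where ls: "0 < l" "\<bar>s\<bar> < e" and \<theta>: "\<theta> = l *\<^sub>R (u + s *\<^sub>R \<tau>)" using dec by blast
    have "support_function K \<theta> = l * ?h s"
      unfolding \<theta> using ls by (intro support_function_scaleR[OF K]) simp
    moreover have "\<theta> \<bullet> z = l * (z \<bullet> u + s * (z \<bullet> \<tau>))" unfolding \<theta> by simp
    ultimately have zs: "z \<bullet> u + s * (z \<bullet> \<tau>) = ?h s" using eq ls by simp
    have z0: "z \<bullet> u \<le> y \<bullet> u" using up[OF z, of 0] hr[of 0] e by simp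
    have ze: "z \<bullet> u + e * (z \<bullet> \<tau>) \<le> y \<bullet> u + e * (y \<bullet> \<tau>)" using up[OF z, of e] hr[of e] e by simp
    have zme: "z \<bullet> u - e * (z \<bullet> \<tau>) \<le> x \<bullet> u - e * (x \<bullet> \<tau>)" using up[OF z, of "- e"] hl[of "- e"] e by simp
    have eqI: "z = w" if "z \<bullet> u = w \<bullet> u" "z \<bullet> \<tau> = w \<bullet> \<tau>" for w
      using expand[of z] expand[of w] that by simp
    \<comment> \<open>An affine function that is nonpositive at 0 and \<open>e\<close> and zero
      strictly between them is zero. Applied to differences of lines, it identifies the contact
      point.\<close>
    have lin: "A = 0 \<and> B = 0" if "A \<le> 0" "A + e * B \<le> 0" "A + r * B = 0" "0 < r" "r < e" for A B r :: real
    proof -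
      have "r * B \<ge> 0" using that by simp
      hence "0 \<le> B" using that by (simp add: zero_le_mult_iff)
      moreover have "(e - r) * B \<le> 0" using that by (simp add: algebra_simps)
      hence "B \<le> 0" using that by (simp add: mult_le_0_iff)
      ultimately show ?thesis using that by simp
    qed
    consider "0 < s" | "s < 0" | "s = 0" by linarith
    thus "z \<in> closed_segment x y"
    proof cases
      case 1
      have "z \<bullet> u - y \<bullet> u = 0 \<and> z \<bullet> \<tau> - y \<bullet> \<tau> = 0"
        by (rule lin[of _ _ s]) (use 1 ls z0 ze zs hr[of s] in \<open>auto simp: algebra_simps\<close>)
      thus ?thesis using eqI[of y] by simp
    next
      case 2
      have "z \<bullet> u - x \<bullet> u = 0 \<and> - (z \<bullet> \<tau> - x \<bullet> \<tau>) = 0"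
        by (rule lin[of _ _ "- s"]) (use 2 ls z0 zme zs hl[of s] xyu in \<open>auto simp: algebra_simps\<close>)
      thus ?thesis using eqI[of x] by simp
    next
      case 3
      have zu: "z \<bullet> u = y \<bullet> u" using zs hr[of 0] e 3 by simp
      have "e * (z \<bullet> \<tau>) \<le> e * (y \<bullet> \<tau>)" "e * (x \<bullet> \<tau>) \<le> e * (z \<bullet> \<tau>)" using ze zme zu xyu by auto
      hence z\<tau>: "z \<bullet> \<tau> \<le> y \<bullet> \<tau>" "x \<bullet> \<tau> \<le> z \<bullet> \<tau>" using e by auto
      define t where "t = (z \<bullet> \<tau> - x \<bullet> \<tau>) / (y \<bullet> \<tau> - x \<bullet> \<tau>)"
      have t: "0 \<le> t" "t \<le> 1" using z\<tau> by (auto simp: t_def divide_le_eq_1)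
      have "t * (y \<bullet> \<tau> - x \<bullet> \<tau>) = z \<bullet> \<tau> - x \<bullet> \<tau>"
        using z\<tau> by (cases "y \<bullet> \<tau> = x \<bullet> \<tau>") (auto simp: t_def)
      hence "z = (1 - t) *\<^sub>R x + t *\<^sub>R y"
        using zu xyu by (intro eqI) (simp_all add: inner_add_left algebra_simps)
      thus ?thesis using t by (auto simp: in_segment)
    qed
  qed
  moreover have "u \<bullet> z = support_function K u" if z: "z \<in> closed_segment x y" for z
  proof -
    obtain t where "z = (1 - t) *\<^sub>R x + t *\<^sub>R y" using z by (auto simp: in_segment)
    hence "u \<bullet> z = (1 - t) * (x \<bullet> u) + t * (y \<bullet> u)" by (simp add: inner_add_right inner_commute[of u])
    also have "\<dots> = y \<bullet> u" using xyu by (simp add: algebra_simps)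
    also have "\<dots> = support_function K u" using hr[of 0] e by simp
    finally show ?thesis .
  qed
  ultimately show ?thesis by blast
qed

text \<open>By continuity the gap stays above half of its value at \<open>u\<close>; the restriction
  \<open>s \<le> 1\<close> turns this constant bound into a linear one.\<close>

lemma gap_if_pos:
  assumes \<Omega>: "convex_body \<Omega>" and K: "convex_body K"
    and pos: "support_function K u < support_function \<Omega> u"
  shows "linear_gap \<Omega> K"
proof -
  define D where "D s = support_function \<Omega> (u + s *\<^sub>R \<tau>) - support_function K (u + s *\<^sub>R \<tau>)" for s :: real
  have "continuous_on UNIV D"
    unfolding D_def
    by (intro continuous_on_diff continuous_on_compose2[OF continuous_support_function[of _ UNIV]] \<Omega> K continuous_intros) auto
  hence "isCont D 0" by (simp add: continuous_on_eq_continuous_at)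
  moreover have D0: "0 < D 0" using pos by (simp add: D_def)
  ultimately obtain \<delta> where \<delta>: "0 < \<delta>" "\<And>s. dist s 0 < \<delta> \<Longrightarrow> dist (D s) (D 0) < D 0 / 2"
    unfolding continuous_at_eps_delta by (metis half_gt_zero)
  show ?thesis unfolding linear_gap_def
  proof (rule exI[of _ "D 0 / 2"], intro conjI exI[of _ "min (\<delta> / 2) 1"] allI impI)
    fix s :: real assume s: "0 < s \<and> s \<le> min (\<delta> / 2) 1"
    have "D 0 / 2 * s \<le> D 0 / 2 * 1" using s D0 by (intro mult_left_mono) auto
    moreover have "\<bar>D s - D 0\<bar> < D 0 / 2" using \<delta>(2)[of s] s \<delta>(1) by (simp add: dist_real_def)
    hence "D 0 / 2 < D s" by linarith
    ultimately show "D 0 / 2 * s \<le> support_function \<Omega> (u + s *\<^sub>R \<tau>) - support_function K (u + s *\<^sub>R \<tau>)"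
      by (simp add: D_def)
  qed (use D0 \<delta> in auto)
qed

text \<open>For a polygonal container a direction of contact is harmless: either the two bodies share the
  extreme contact vertex, or their support functions separate at a linear rate.\<close>

lemma linear_or_gap_polygon:
  assumes V: "finite V" "V \<noteq> {}" and \<Omega>: "convex_body (convex hull V)" and K: "convex_body K" "K \<subseteq> convex hull V"
  shows "linear_at K \<or> linear_gap (convex hull V) K"
proof (cases "support_function K u < support_function (convex hull V) u")
  case True
  thus ?thesis using gap_if_pos[OF \<Omega> K(1)] by blast
next
  case False
  let ?\<Omega> = "convex hull V"
  have eq: "support_function K u = support_function ?\<Omega> u"
    using False support_function_mono[OF K(1) \<Omega> K(2), of u] by simp
  define M where "M = Max ((\<lambda>v. u \<bullet> v) ` V)"
  define W where "W = {v \<in> V. u \<bullet> v = M}"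
  have uM: "u \<bullet> v \<le> M" if "v \<in> V" for v using V that by (simp add: M_def)
  have "M \<in> (\<lambda>v. u \<bullet> v) ` V" unfolding M_def using V by (intro Max_in) auto
  hence W: "W \<noteq> {}" "finite W" using V by (auto simp: W_def)
  \<comment> \<open>The end, on the \<open>\<tau>\<close> side, of the container's face with normal
    \<open>u\<close>. The point \<open>z\<close> below is its counterpart for \<open>K\<close>; the
    two cases are \<open>z = e\<close> and \<open>z\<close> strictly before
    \<open>e\<close>.\<close>
  obtain e where e: "e \<in> W" "\<And>v. v \<in> W \<Longrightarrow> v \<bullet> \<tau> \<le> e \<bullet> \<tau>"
  proof -
    have "Max ((\<lambda>v. v \<bullet> \<tau>) ` W) \<in> (\<lambda>v. v \<bullet> \<tau>) ` W" using W by (intro Max_in) auto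
    then obtain e where "e \<in> W" "e \<bullet> \<tau> = Max ((\<lambda>v. v \<bullet> \<tau>) ` W)" by auto
    thus ?thesis using that[of e] W by simp
  qed
  have eV: "e \<in> V" "e \<bullet> u = M" using e(1) by (auto simp: W_def inner_commute)
  have hull_le: "\<theta> \<bullet> z \<le> k" if "\<And>v. v \<in> V \<Longrightarrow> \<theta> \<bullet> v \<le> k" "z \<in> ?\<Omega>" for \<theta> k z
  proof -
    have "?\<Omega> \<subseteq> {z. \<theta> \<bullet> z \<le> k}" using that(1) by (intro hull_minimal convex_halfspace_le) auto
    thus ?thesis using that(2) by auto
  qed
  have e\<Omega>: "e \<in> ?\<Omega>" using eV hull_inc by metis
  have hu: "support_function ?\<Omega> u = M"
  proof (rule support_function_eqI[OF \<Omega> e\<Omega>])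
    show "u \<bullet> e = M" using eV by (simp add: inner_commute)
    show "u \<bullet> z \<le> M" if "z \<in> ?\<Omega>" for z by (rule hull_le[OF uM that])
  qed
  define F where "F = {z \<in> K. u \<bullet> z = M}"
  have "F = K \<inter> {z. u \<bullet> z = M}" by (auto simp: F_def)
  hence "compact F" using K(1) by (auto simp: convex_body_def intro!: compact_Int_closed closed_hyperplane)
  moreover have "F \<noteq> {}" 
  proof -
    obtain y where "y \<in> K" "u \<bullet> y = support_function K u" using support_function_attained[OF K(1)] .
    thus ?thesis using eq hu by (auto simp: F_def)
  qed
  ultimately obtain z where z: "z \<in> F" "\<And>w. w \<in> F \<Longrightarrow> w \<bullet> \<tau> \<le> z \<bullet> \<tau>"
    using continuous_attains_sup[of F "\<lambda>w. w \<bullet> \<tau>"] continuous_on_inner[OF continuous_on_id continuous_on_const]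
    by blast
  have zK: "z \<in> K" "z \<bullet> u = M" using z(1) by (auto simp: F_def inner_commute)
  obtain R where R: "0 < R" "?\<Omega> \<subseteq> cball 0 R" using convex_body_bound[OF \<Omega>] .
  have nt: "norm \<tau> = 1" using tt by (simp add: norm_eq_1)
  have R\<tau>: "\<bar>w \<bullet> \<tau>\<bar> \<le> R" if "w \<in> ?\<Omega>" for w
  proof -
    have "norm w \<le> R" using that R by auto
    thus ?thesis using Cauchy_Schwarz_ineq2[of w \<tau>] nt by simp
  qed
  define \<delta> where "\<delta> = Min (insert 1 ((\<lambda>v. M - u \<bullet> v) ` (V - W)))"
  have "\<delta> \<in> insert 1 ((\<lambda>v. M - u \<bullet> v) ` (V - W))" unfolding \<delta>_def using V by (intro Min_in) auto
  hence \<delta>0: "0 < \<delta>" using uM by (force simp: W_def)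
  have \<delta>: "u \<bullet> v \<le> M - \<delta>" if "v \<in> V - W" for v
  proof -
    have "\<delta> \<le> M - u \<bullet> v" unfolding \<delta>_def using V that by (intro Min_le) auto
    thus ?thesis by simp
  qed
  \<comment> \<open>Vertices off the face are lower by at least \<open>\<delta>\<close>, while the
    tilt \<open>s\<close> changes their advantage over \<open>e\<close> by at most
    \<open>2 * R * s\<close>.\<close>
  define s1 where "s1 = \<delta> / (2 * R)"
  have s1: "0 < s1" using \<delta>0 R by (simp add: s1_def)
  have line_e: "(u + s *\<^sub>R \<tau>) \<bullet> w \<le> M + s * (e \<bullet> \<tau>)" if s: "0 \<le> s" "s \<le> s1" and w: "w \<in> ?\<Omega>" for s w
  proof (rule hull_le[OF _ w])
    fix v assume v: "v \<in> V"
    show "(u + s *\<^sub>R \<tau>) \<bullet> v \<le> M + s * (e \<bullet> \<tau>)"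
    proof (cases "v \<in> W")
      case True
      hence "s * (v \<bullet> \<tau>) \<le> s * (e \<bullet> \<tau>)" using e(2) s by (intro mult_left_mono) auto
      moreover have "v \<bullet> u = M" using True by (simp add: W_def inner_commute[of v u])
      ultimately show ?thesis by simp
    next
      case False
      have "s * (v \<bullet> \<tau>) \<le> s * R" "s * (- R) \<le> s * (e \<bullet> \<tau>)"
        using R\<tau>[of v] R\<tau>[OF e\<Omega>] v s hull_inc[of v V] by (intro mult_left_mono; auto simp: abs_le_iff)+
      moreover have "s * (2 * R) \<le> \<delta>" using s R by (simp add: s1_def pos_le_divide_eq)
      moreover have "v \<bullet> u \<le> M - \<delta>" using \<delta>[of v] v False by (simp add: inner_commute)
      ultimately have "v \<bullet> u + s * (v \<bullet> \<tau>) \<le> M + s * (e \<bullet> \<tau>)" by (simp add: algebra_simps)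
      thus ?thesis by simp
    qed
  qed
  have "z \<in> ?\<Omega>" using zK K(2) by blast
  from line_e[OF less_imp_le[OF s1] order_refl this] have "s1 * (z \<bullet> \<tau>) \<le> s1 * (e \<bullet> \<tau>)" using zK by simp
  hence ez: "z \<bullet> \<tau> \<le> e \<bullet> \<tau>" using s1 by simp
  show ?thesis
  proof (cases "z \<bullet> \<tau> = e \<bullet> \<tau>")
    case True
    have "z = e" using expand[of z] expand[of e] True zK eV by simp
    hence eK: "e \<in> K" using zK by simp
    have "support_function K (u + s *\<^sub>R \<tau>) = (u + s *\<^sub>R \<tau>) \<bullet> e" if "s \<in> {0..s1}" for s
    proof (rule support_function_eqI[OF K(1) eK refl])
      fix w assume "w \<in> K"
      hence "w \<in> ?\<Omega>" using K(2) by blast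
      from line_e[OF _ _ this, of s] that show "(u + s *\<^sub>R \<tau>) \<bullet> w \<le> (u + s *\<^sub>R \<tau>) \<bullet> e" by (simp add: eV)
    qed
    thus ?thesis using s1 eK unfolding linear_at_def by blast
  next
    case False
    define \<gamma> where "\<gamma> = (e \<bullet> \<tau> - z \<bullet> \<tau>) / 2"
    have \<gamma>: "0 < \<gamma>" using False ez by (simp add: \<gamma>_def)
    \<comment> \<open>The part of \<open>K\<close> beyond the midpoint between \<open>z\<close> and
      \<open>e\<close>. It is compact and misses the contact line, so it stays below by some
      \<open>\<eta>\<close>; for small \<open>s\<close> the slope of \<open>K\<close> is then at
      most \<open>z \<bullet> \<tau> + \<gamma>\<close>.\<close>
    define Y where "Y = K \<inter> {w. \<tau> \<bullet> w \<ge> z \<bullet> \<tau> + \<gamma>}"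
    have "\<exists>\<eta>>0. \<forall>w\<in>Y. w \<bullet> u \<le> M - \<eta>"
    proof (cases "Y = {}")
      case True
      thus ?thesis by (intro exI[of _ 1]) auto
    next
      case False
      have "compact Y" unfolding Y_def using K(1)
        by (intro compact_Int_closed closed_halfspace_ge) (auto simp: convex_body_def)
      then obtain w where w: "w \<in> Y" "\<And>w'. w' \<in> Y \<Longrightarrow> w' \<bullet> u \<le> w \<bullet> u"
        using continuous_attains_sup[of Y "\<lambda>w. w \<bullet> u"] False continuous_on_inner[OF continuous_on_id continuous_on_const]
        by blast
      have "w \<bullet> u \<le> M" using w(1) support_function_upper[OF K(1), of w u] eq hu by (auto simp: Y_def inner_commute)
      moreover have "w \<bullet> u \<noteq> M"
      proof
        assume "w \<bullet> u = M"
        hence "w \<in> F" using w(1) by (auto simp: F_def Y_def inner_commute)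
        hence "w \<bullet> \<tau> \<le> z \<bullet> \<tau>" by (rule z(2))
        thus False using w(1) \<gamma> by (simp add: Y_def inner_commute)
      qed
      ultimately show ?thesis using w(2) by (intro exI[of _ "M - w \<bullet> u"]) auto
    qed
    then obtain \<eta> where \<eta>: "0 < \<eta>" "\<And>w. w \<in> Y \<Longrightarrow> w \<bullet> u \<le> M - \<eta>" by blast
    have "\<gamma> * s \<le> support_function ?\<Omega> (u + s *\<^sub>R \<tau>) - support_function K (u + s *\<^sub>R \<tau>)"
      if s: "0 < s" "s \<le> \<eta> / (2 * R)" for s
    proof -
      have "support_function K (u + s *\<^sub>R \<tau>) \<le> M + s * (z \<bullet> \<tau> + \<gamma>)"
      proof (rule support_function_least[OF K(1)])
        fix w assume w: "w \<in> K"
        show "(u + s *\<^sub>R \<tau>) \<bullet> w \<le> M + s * (z \<bullet> \<tau> + \<gamma>)"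
        proof (cases "w \<in> Y")
          case True
          have "w \<bullet> \<tau> \<le> R" "- R \<le> z \<bullet> \<tau>"
            using R\<tau>[of w] R\<tau>[of z] w zK(1) K(2) by (auto simp: abs_le_iff)
          hence "s * (w \<bullet> \<tau>) \<le> s * R" "s * (- R) \<le> s * (z \<bullet> \<tau>)"
            using s by (intro mult_left_mono; simp)+
          moreover have "0 \<le> s * \<gamma>" using s \<gamma> by simp
          moreover have "s * (2 * R) \<le> \<eta>" using s R by (simp add: pos_le_divide_eq)
          ultimately have "w \<bullet> u + s * (w \<bullet> \<tau>) \<le> M + s * (z \<bullet> \<tau> + \<gamma>)"
            using \<eta>(2)[OF True] by (simp add: algebra_simps)
          thus ?thesis by simp
        next
          case False
          hence "s * (w \<bullet> \<tau>) \<le> s * (z \<bullet> \<tau> + \<gamma>)"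
            using w s by (intro mult_left_mono) (auto simp: Y_def inner_commute)
          moreover have "w \<bullet> u \<le> M" using w support_function_upper[OF K(1), of w u] eq hu by (simp add: inner_commute)
          ultimately show ?thesis by simp
        qed
      qed
      moreover have "M + s * (e \<bullet> \<tau>) \<le> support_function ?\<Omega> (u + s *\<^sub>R \<tau>)"
        using support_function_upper[OF \<Omega> e\<Omega>, of "u + s *\<^sub>R \<tau>"] eV by simp
      moreover have "s * (e \<bullet> \<tau>) = s * (z \<bullet> \<tau> + \<gamma>) + \<gamma> * s" by (simp add: \<gamma>_def field_simps)
      ultimately show ?thesis by linarith
    qed
    thus ?thesis unfolding linear_gap_def
      using \<gamma> \<eta>(1) R(1) by (intro disjI2 exI[of _ \<gamma>] conjI exI[of _ "\<eta> / (2 * R)"]) auto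
  qed
qed

end

section \<open>Corners of solutions, and the free boundary for areas strictly between the
  extremes\<close>

lemma frame_exists:
  assumes "norm (u :: real^2) = 1"
  obtains \<tau> where "frame u \<tau>"
proof -
  have n: "u $ 1 * u $ 1 + u $ 2 * u $ 2 = 1"
    using assms by (simp add: norm_eq_1 inner_vec_def sum_2)
  have "frame u (vector [- (u $ 2), u $ 1])"
    by unfold_locales (use n in \<open>simp_all add: inner_vec_def sum_2 algebra_simps\<close>)
  thus ?thesis by (rule that)
qed

text \<open>The frames with \<open>\<tau>\<close> and \<open>- \<tau>\<close> give a contact point
  on either side of \<open>u\<close>, which together form a corner.\<close>

lemma solution_corner:
  assumes \<Omega>: "convex_body \<Omega>" and p: "1 \<le> p" and sol: "is_solution \<Omega> p c \<omega>"
    and c: "0 < c" "c < area \<Omega>" and u: "norm u = 1"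
    and dir: "\<And>\<tau>. frame u \<tau> \<Longrightarrow> frame.linear_at u \<tau> \<omega> \<or> frame.linear_gap u \<tau> \<Omega> \<omega>"
  shows "\<exists>U x y. open U \<and> u \<in> U \<and> corner \<omega> U x y \<and> (\<forall>z\<in>closed_segment x y. u \<bullet> z = support_function \<omega> u)"
proof -
  have \<omega>: "convex_body \<omega>" using sol by (auto simp: is_solution_def admissible_def)
  have lin: "\<exists>e>0. \<exists>x\<in>\<omega>. \<forall>s\<in>{0..e}. support_function \<omega> (u + s *\<^sub>R \<tau>) = (u + s *\<^sub>R \<tau>) \<bullet> x"
    if fr: "frame u \<tau>" for \<tau>
    using dir[OF fr] frame.support_linear_near[OF fr \<Omega> p sol c] frame.linear_at_def[OF fr] by blast
  obtain \<tau> where fr: "frame u \<tau>" using frame_exists[OF u] .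
  obtain e1 y where y: "0 < e1" "y \<in> \<omega>" "\<And>s. s \<in> {0..e1} \<Longrightarrow> support_function \<omega> (u + s *\<^sub>R \<tau>) = (u + s *\<^sub>R \<tau>) \<bullet> y"
    using lin[OF fr] by blast
  obtain e2 x where x: "0 < e2" "x \<in> \<omega>"
    "\<And>s. s \<in> {0..e2} \<Longrightarrow> support_function \<omega> (u + s *\<^sub>R (- \<tau>)) = (u + s *\<^sub>R (- \<tau>)) \<bullet> x"
    using lin[OF frame.frame_uminus[OF fr]] by blast
  have "\<exists>U. open U \<and> u \<in> U \<and> corner \<omega> U x y \<and> (\<forall>z\<in>closed_segment x y. u \<bullet> z = support_function \<omega> u)"
    by (rule frame.corner_if_linear[OF fr \<omega>, of "min e1 e2"]) (use x y in auto)
  thus ?thesis by blast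
qed

lemma solution_corner_if_gap:
  assumes \<Omega>: "convex_body \<Omega>" and p: "1 \<le> p" and sol: "is_solution \<Omega> p c \<omega>"
    and c: "0 < c" "c < area \<Omega>" and u: "norm u = 1" "support_function \<omega> u < support_function \<Omega> u"
  shows "\<exists>U x y. open U \<and> u \<in> U \<and> corner \<omega> U x y \<and> (\<forall>z\<in>closed_segment x y. u \<bullet> z = support_function \<omega> u)"
proof (rule solution_corner[OF \<Omega> p sol c u(1)])
  have \<omega>: "convex_body \<omega>" using sol by (auto simp: is_solution_def admissible_def)
  show "frame.linear_at u \<tau> \<omega> \<or> frame.linear_gap u \<tau> \<Omega> \<omega>" if "frame u \<tau>" for \<tau>
    using frame.gap_if_pos[OF that \<Omega> \<omega> u(2)] by blast
qed

lemma not_interior_if_contact: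
  assumes K: "convex_body K" and \<theta>: "\<theta> \<noteq> 0" "\<theta> \<bullet> z = support_function K \<theta>"
  shows "z \<notin> interior K"
proof
  assume "z \<in> interior K"
  then obtain e where e: "0 < e" "cball z e \<subseteq> K" using mem_interior_cball by blast
  define w where "w = z + (e / norm \<theta>) *\<^sub>R \<theta>"
  have "w \<in> cball z e" using \<theta>(1) e(1) by (simp add: w_def dist_norm)
  hence "\<theta> \<bullet> w \<le> support_function K \<theta>" using e(2) support_function_upper[OF K] by blast
  moreover have "0 < (e / norm \<theta>) * (\<theta> \<bullet> \<theta>)" using \<theta>(1) e(1) by simp
  ultimately show False using \<theta>(2) by (simp add: w_def inner_add_right)
qed

text \<open>For a relative boundary point this is the supporting hyperplane. Otherwise the body is
  lower-dimensional, and the normal of a line containing it serves.\<close>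

lemma normal_exists:
  assumes K: "convex_body K" and z: "z \<in> frontier K"
  obtains \<theta> where "norm \<theta> = 1" "\<theta> \<bullet> z = support_function K \<theta>"
proof -
  have closed: "closed K" and convex: "convex K" using K by (auto simp: convex_body_def compact_imp_closed)
  have zK: "z \<in> K" "z \<notin> interior K" using z closed by (auto simp: frontier_def)
  have "\<exists>a. a \<noteq> 0 \<and> (\<forall>y\<in>K. a \<bullet> z \<le> a \<bullet> y)"
  proof (cases "z \<in> rel_interior K")
    case False
    thus ?thesis using supporting_hyperplane_rel_boundary[OF convex zK(1)] by metis
  next
    case True
    hence "affine hull K \<noteq> UNIV" using zK(2) rel_interior_interior by blast
    hence "aff_dim K \<noteq> DIM(real^2)" using aff_dim_eq_full by blast
    hence "aff_dim K < DIM(real^2)" using aff_dim_le_DIM[of K] by linarith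
    then obtain a b where ab: "a \<noteq> 0" "K \<subseteq> {x. a \<bullet> x = b}" by (rule aff_lowdim_subset_hyperplane)
    have "a \<bullet> y = b" if "y \<in> K" for y using ab(2) that by blast
    thus ?thesis using ab(1) zK(1) by (intro exI[of _ a]) simp
  qed
  then obtain a where a: "a \<noteq> 0" "\<And>y. y \<in> K \<Longrightarrow> a \<bullet> z \<le> a \<bullet> y" by blast
  define \<theta> where "\<theta> = - (1 / norm a) *\<^sub>R a"
  show ?thesis
  proof (rule that[of \<theta>])
    show "norm \<theta> = 1" using a(1) by (simp add: \<theta>_def)
    show "\<theta> \<bullet> z = support_function K \<theta>"
      by (rule support_function_eqI[OF K zK(1) refl, symmetric])
        (use a in \<open>auto simp: \<theta>_def divide_right_mono\<close>)
  qed
qed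

text \<open>A direction touching at \<open>x0\<close> has a strict gap, as a ball about
  \<open>x0\<close> fits into \<open>\<Omega>\<close>, and hence a corner. A direction not touching
  there keeps away from points near \<open>x0\<close>. Finitely many directions cover the circle,
  and each boundary point has a normal.\<close>

lemma frontier_locally_polygonal:
  assumes \<Omega>: "convex_body \<Omega>" and p: "1 \<le> p" and sol: "is_solution \<Omega> p c \<omega>"
    and c: "0 < c" "c < area \<Omega>" and x0: "x0 \<in> frontier \<omega> \<inter> interior \<Omega>"
  shows "\<exists>\<delta>>0. \<exists>F. finite F \<and> (\<forall>(a, b)\<in>F. closed_segment a b \<subseteq> frontier \<omega>) \<and>
    frontier \<omega> \<inter> ball x0 \<delta> \<subseteq> (\<Union>(a, b)\<in>F. closed_segment a b)"
proof -
  have \<omega>: "convex_body \<omega>" using sol by (auto simp: is_solution_def admissible_def)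
  have closed: "closed \<omega>" using \<omega> by (simp add: convex_body_def compact_imp_closed)
  have x0\<omega>: "x0 \<in> \<omega>" using x0 closed by (auto simp: frontier_def)
  obtain e where e: "0 < e" "cball x0 e \<subseteq> \<Omega>" using x0 mem_interior_cball by blast
  define P where "P U \<delta> a b \<longleftrightarrow> 0 < \<delta> \<and> closed_segment a b \<subseteq> frontier \<omega> \<and>
    (\<forall>\<theta>'\<in>U. \<forall>z\<in>\<omega> \<inter> ball x0 \<delta>. \<theta>' \<bullet> z = support_function \<omega> \<theta>' \<longrightarrow> z \<in> closed_segment a b)"
    for U :: "(real^2) set" and \<delta> :: real and a b
  have "\<exists>U \<delta> a b. open U \<and> \<theta> \<in> U \<and> P U \<delta> a b" if n: "norm \<theta> = 1" for \<theta>
  proof (cases "\<theta> \<bullet> x0 = support_function \<omega> \<theta>")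
    case True
    have "x0 + e *\<^sub>R \<theta> \<in> \<Omega>" using e n by (auto simp: dist_norm)
    hence "\<theta> \<bullet> x0 + e * (\<theta> \<bullet> \<theta>) \<le> support_function \<Omega> \<theta>"
      using support_function_upper[OF \<Omega>, of "x0 + e *\<^sub>R \<theta>" \<theta>] by (simp add: inner_add_right)
    moreover have "\<theta> \<bullet> \<theta> = 1" using n by (simp add: norm_eq_1)
    ultimately have "support_function \<omega> \<theta> < support_function \<Omega> \<theta>" using e True by simp
    then obtain U x y where U: "open U" "\<theta> \<in> U" "corner \<omega> U x y"
      "\<And>z. z \<in> closed_segment x y \<Longrightarrow> \<theta> \<bullet> z = support_function \<omega> \<theta>"
      using solution_corner_if_gap[OF \<Omega> p sol c n] by blast
    have "closed_segment x y \<subseteq> frontier \<omega>"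
    proof
      fix z assume z: "z \<in> closed_segment x y"
      have "closed_segment x y \<subseteq> \<omega>"
        using U(3) \<omega> by (intro closed_segment_subset) (auto simp: corner_def convex_body_def)
      hence "z \<in> \<omega>" using z by blast
      moreover have "z \<notin> interior \<omega>"
        by (rule not_interior_if_contact[OF \<omega> _ U(4)[OF z]]) (use n in auto)
      ultimately show "z \<in> frontier \<omega>" using closed by (simp add: frontier_def)
    qed
    moreover have "\<forall>z\<in>\<omega>. \<forall>\<theta>'\<in>U. \<theta>' \<bullet> z = support_function \<omega> \<theta>' \<longrightarrow> z \<in> closed_segment x y"
      using U(3) unfolding corner_def by blast
    ultimately have "P U 1 x y" unfolding P_def by (intro conjI zero_less_one) blast+
    thus ?thesis using U(1,2) by blast
  next
    case False
    hence lt: "\<theta> \<bullet> x0 < support_function \<omega> \<theta>" using support_function_upper[OF \<omega> x0\<omega>, of \<theta>] by linarith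
    define S where "S = {w :: (real^2) \<times> (real^2). fst w \<bullet> snd w < support_function \<omega> (fst w)}"
    have "open S" unfolding S_def
      by (intro open_Collect_less continuous_intros continuous_on_compose2[OF continuous_support_function[OF \<omega>, of UNIV]]) auto
    moreover have "(\<theta>, x0) \<in> S" using lt by (simp add: S_def)
    ultimately obtain A B where AB: "open A" "open B" "(\<theta>, x0) \<in> A \<times> B" "A \<times> B \<subseteq> S" by (rule open_prod_elim)
    then obtain \<delta> where \<delta>: "0 < \<delta>" "ball x0 \<delta> \<subseteq> B" using open_contains_ball by blast
    have "\<theta>' \<bullet> z \<noteq> support_function \<omega> \<theta>'" if "\<theta>' \<in> A" "z \<in> ball x0 \<delta>" for \<theta>' z
    proof -
      have "(\<theta>', z) \<in> S" using that AB(4) \<delta>(2) by blast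
      thus ?thesis by (simp add: S_def)
    qed
    \<comment> \<open>No contact occurs here, so the degenerate segment at \<open>x0\<close> is a
      placeholder.\<close>
    thus ?thesis unfolding P_def using AB \<delta>(1) x0 by (intro exI[of _ A] exI[of _ \<delta>] exI[of _ x0]) auto
  qed
  hence "\<forall>\<theta>\<in>unit_circle. \<exists>w. open (fst w) \<and> \<theta> \<in> fst w \<and> P (fst w) (fst (snd w)) (fst (snd (snd w))) (snd (snd (snd w)))"
    by fastforce
  from bchoice[OF this] obtain w where w: "\<forall>\<theta>\<in>unit_circle. open (fst (w \<theta>)) \<and> \<theta> \<in> fst (w \<theta>) \<and>
      P (fst (w \<theta>)) (fst (snd (w \<theta>))) (fst (snd (snd (w \<theta>)))) (snd (snd (snd (w \<theta>))))"
    by blast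
  define U \<delta> a b where "U \<theta> = fst (w \<theta>)" and "\<delta> \<theta> = fst (snd (w \<theta>))"
    and "a \<theta> = fst (snd (snd (w \<theta>)))" and "b \<theta> = snd (snd (snd (w \<theta>)))" for \<theta>
  have "open (U \<theta>) \<and> \<theta> \<in> U \<theta> \<and> P (U \<theta>) (\<delta> \<theta>) (a \<theta>) (b \<theta>)" if "norm \<theta> = 1" for \<theta>
    using w that by (simp add: U_def \<delta>_def a_def b_def)
  hence U: "\<And>\<theta>. norm \<theta> = 1 \<Longrightarrow> open (U \<theta>)" "\<And>\<theta>. norm \<theta> = 1 \<Longrightarrow> \<theta> \<in> U \<theta>"
    and \<delta>: "\<And>\<theta>. norm \<theta> = 1 \<Longrightarrow> 0 < \<delta> \<theta>"
    and ab: "\<And>\<theta>. norm \<theta> = 1 \<Longrightarrow> closed_segment (a \<theta>) (b \<theta>) \<subseteq> frontier \<omega>"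
    "\<And>\<theta> \<theta>' z. \<lbrakk>norm \<theta> = 1; \<theta>' \<in> U \<theta>; z \<in> \<omega>; z \<in> ball x0 (\<delta> \<theta>); \<theta>' \<bullet> z = support_function \<omega> \<theta>'\<rbrakk>
      \<Longrightarrow> z \<in> closed_segment (a \<theta>) (b \<theta>)"
    unfolding P_def by blast+
  have cov: "unit_circle \<subseteq> (\<Union>\<theta>\<in>unit_circle. U \<theta>)" using U(2) by auto
  obtain T where T: "T \<subseteq> unit_circle" "finite T" "unit_circle \<subseteq> (\<Union>\<theta>\<in>T. U \<theta>)"
    by (rule compactE_image[OF compact_sphere _ cov]) (use U(1) in simp, blast)
  define d where "d = Min (insert 1 (\<delta> ` T))"
  have "d \<in> insert 1 (\<delta> ` T)" unfolding d_def using T(2) by (intro Min_in) auto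
  hence d0: "0 < d" using T(1) \<delta> by auto
  have d_le: "d \<le> \<delta> \<theta>" if "\<theta> \<in> T" for \<theta> unfolding d_def using T(2) that by (intro Min_le) auto
  have "frontier \<omega> \<inter> ball x0 d \<subseteq> (\<Union>(a, b)\<in>(\<lambda>\<theta>. (a \<theta>, b \<theta>)) ` T. closed_segment a b)"
  proof
    fix z assume z: "z \<in> frontier \<omega> \<inter> ball x0 d"
    obtain \<theta>' where \<theta>': "norm \<theta>' = 1" "\<theta>' \<bullet> z = support_function \<omega> \<theta>'" using normal_exists[OF \<omega>] z by blast
    then obtain \<theta> where \<theta>: "\<theta> \<in> T" "\<theta>' \<in> U \<theta>" using T(3) by force
    have "z \<in> closed_segment (a \<theta>) (b \<theta>)"
    proof (rule ab(2)[OF _ \<theta>(2) _ _ \<theta>'(2)])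
      show "norm \<theta> = 1" using \<theta> T(1) by auto
      show "z \<in> \<omega>" using z closed by (auto simp: frontier_def)
      show "z \<in> ball x0 (\<delta> \<theta>)" using z d_le[OF \<theta>(1)] by auto
    qed
    thus "z \<in> (\<Union>(a, b)\<in>(\<lambda>\<theta>. (a \<theta>, b \<theta>)) ` T. closed_segment a b)" using \<theta>(1) by auto
  qed
  moreover have "\<forall>(a, b)\<in>(\<lambda>\<theta>. (a \<theta>, b \<theta>)) ` T. closed_segment a b \<subseteq> frontier \<omega>"
  proof -
    have "norm \<theta> = 1" if "\<theta> \<in> T" for \<theta> using T(1) that by auto
    thus ?thesis using ab(1) by simp
  qed
  ultimately show ?thesis using d0 T(2) by (intro exI[of _ d] conjI exI[of _ "(\<lambda>\<theta>. (a \<theta>, b \<theta>)) ` T"]) auto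
qed

text \<open>Every direction has a corner, and finitely many corners cover the circle. The hull of
  their end points has the same support function as the solution.\<close>

lemma solution_polytope:
  assumes \<Omega>: "convex_body \<Omega>" "polytope \<Omega>" and p: "1 \<le> p" and sol: "is_solution \<Omega> p c \<omega>"
    and c: "0 < c" "c < area \<Omega>"
  shows "polytope \<omega>"
proof -
  have \<omega>: "convex_body \<omega>" "\<omega> \<subseteq> \<Omega>" using sol by (auto simp: is_solution_def admissible_def)
  obtain V where V: "finite V" "\<Omega> = convex hull V" using \<Omega>(2) by (auto simp: polytope_def)
  have "V \<noteq> {}" using V(2) \<Omega>(1) by (auto simp: convex_body_def)
  have "\<exists>U x y. open U \<and> u \<in> U \<and> corner \<omega> U x y" if u: "norm u = 1" for u
    using solution_corner[OF \<Omega>(1) p sol c u]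
      frame.linear_or_gap_polygon[OF _ V(1) \<open>V \<noteq> {}\<close> \<Omega>(1)[unfolded V(2)] \<omega>(1) \<omega>(2)[unfolded V(2)]]
    unfolding V(2) by blast
  then obtain U x y where U: "\<And>u. norm u = 1 \<Longrightarrow> open (U u)" "\<And>u. norm u = 1 \<Longrightarrow> u \<in> U u"
    "\<And>u. norm u = 1 \<Longrightarrow> corner \<omega> (U u) (x u) (y u)" by metis
  have cov: "unit_circle \<subseteq> (\<Union>\<theta>\<in>unit_circle. U \<theta>)" using U(2) by auto
  obtain T where T: "T \<subseteq> unit_circle" "finite T" "unit_circle \<subseteq> (\<Union>\<theta>\<in>T. U \<theta>)"
    by (rule compactE_image[OF compact_sphere _ cov]) (use U(1) in simp, blast)
  define X where "X = x ` T \<union> y ` T"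
  have X: "finite X" "X \<subseteq> \<omega>" using T U(3) by (auto simp: X_def corner_def)
  have "unit_circle \<noteq> {}" using circle_point_in by blast
  hence "T \<noteq> {}" using T(3) by auto
  hence "X \<noteq> {}" by (auto simp: X_def)
  hence cb: "convex_body (convex hull X)"
    using X(1) by (auto simp: convex_body_def finite_imp_compact_convex_hull)
  have "\<omega> \<subseteq> convex hull X"
  proof (rule subset_if_support_function_le[OF \<omega>(1) cb])
    fix \<theta> :: "real^2" assume "norm \<theta> = 1"
    then obtain v where v: "v \<in> T" "\<theta> \<in> U v" using T(3) by force
    have "support_function \<omega> \<theta> = max (\<theta> \<bullet> x v) (\<theta> \<bullet> y v)"
      using U(3)[of v] v T(1) by (auto simp: corner_def)
    moreover have "x v \<in> convex hull X" "y v \<in> convex hull X" using v by (auto simp: X_def intro!: hull_inc)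
    ultimately show "support_function \<omega> \<theta> \<le> support_function (convex hull X) \<theta>"
      using support_function_upper[OF cb] by simp
  qed
  moreover have "convex hull X \<subseteq> \<omega>" using X(2) \<omega>(1) by (simp add: hull_minimal convex_body_def)
  ultimately show ?thesis using X(1) polytope_convex_hull by (metis subset_antisym)
qed

text \<open>Two segments of half-length \<open>\<eta>\<close> through \<open>x\<close>, parallel to
  the axes, are competitors of area 0. As
  \<open>\<bar>\<theta> $ 1\<bar> + \<bar>\<theta> $ 2\<bar> \<ge> 1\<close> on the circle, their
  integrands add up to at most twice that of the point minus \<open>\<eta> powr p\<close>, so one of
  them has smaller energy.\<close>

lemma solution_not_interior_point:
  assumes \<Omega>: "convex_body \<Omega>" and p: "1 \<le> p" and sol: "is_solution \<Omega> p 0 {x}"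
  shows "x \<notin> interior \<Omega>"
proof
  assume "x \<in> interior \<Omega>"
  then obtain \<eta> where \<eta>: "0 < \<eta>" "cball x \<eta> \<subseteq> \<Omega>" using mem_interior_cball by blast
  define L where "L i = closed_segment (x - \<eta> *\<^sub>R axis i 1) (x + \<eta> *\<^sub>R axis i 1)" for i :: 2
  have cb: "convex_body (L i)" for i by (simp add: L_def convex_body_def)
  have sub: "L i \<subseteq> \<Omega>" for i
  proof -
    have "L i \<subseteq> cball x \<eta>" unfolding L_def
      using \<eta>(1) by (intro closed_segment_subset convex_cball) (auto simp: dist_norm)
    thus ?thesis using \<eta>(2) by blast
  qed
  have area: "area (L i) = 0" for i
    using interior_nonempty_if_area_pos[OF cb, of i] area_nonneg[of "L i"]
      interior_closed_segment_ge2[of "x - \<eta> *\<^sub>R axis i 1" "x + \<eta> *\<^sub>R axis i 1"]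
    by (force simp: L_def)
  have sfx: "support_function {x} \<theta> = \<theta> \<bullet> x" for \<theta> by (simp add: support_function_def)
  have sfL: "support_function (L i) \<theta> \<ge> \<theta> \<bullet> x + \<eta> * \<bar>\<theta> $ i\<bar>" for i \<theta>
  proof -
    have "\<theta> \<bullet> (x - \<eta> *\<^sub>R axis i 1) \<le> support_function (L i) \<theta>" "\<theta> \<bullet> (x + \<eta> *\<^sub>R axis i 1) \<le> support_function (L i) \<theta>"
      by (intro support_function_upper[OF cb]; simp add: L_def)+
    thus ?thesis by (simp add: inner_diff_right inner_add_right inner_axis abs_if)
  qed
  define d where "d \<theta> = support_function \<Omega> \<theta> - \<theta> \<bullet> x" for \<theta>
  define f where "f i \<theta> = \<bar>support_function \<Omega> \<theta> - support_function (L i) \<theta>\<bar> powr p" for i \<theta>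
  have int_f: "integrable circle_measure (f i)" for i
    unfolding f_def by (intro integrable_circle_measure continuous_support_energy_integrand \<Omega> cb p)
  have cx: "convex_body {x}" by (simp add: convex_body_def)
  have int_d: "integrable circle_measure (\<lambda>\<theta>. \<bar>support_function \<Omega> \<theta> - support_function {x} \<theta>\<bar> powr p)"
    by (intro integrable_circle_measure continuous_support_energy_integrand \<Omega> cx p)
  have J_le: "support_energy p \<Omega> {x} \<le> (\<integral>\<theta>. f i \<theta> \<partial>circle_measure)" for i
    using support_energy_minimal[OF sol cb sub area p, of i] by (simp add: support_energy_def f_def)
  have pt: "f 1 \<theta> + f 2 \<theta> \<le> 2 * \<bar>support_function \<Omega> \<theta> - support_function {x} \<theta>\<bar> powr p - \<eta> powr p"
    if n: "norm \<theta> = 1" for \<theta>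
  proof -
    have d\<eta>: "\<eta> \<le> d \<theta>"
      using support_function_mono[OF convex_body_cball \<Omega> \<eta>(2), of \<theta>] \<eta>(1) n
      by (simp add: d_def support_function_cball)
    have fi: "f i \<theta> \<le> d \<theta> powr (p - 1) * (d \<theta> - \<eta> * \<bar>\<theta> $ i\<bar>)" for i
    proof -
      define y where "y = support_function \<Omega> \<theta> - support_function (L i) \<theta>"
      have y: "0 \<le> y" "y \<le> d \<theta> - \<eta> * \<bar>\<theta> $ i\<bar>"
        using support_function_mono[OF cb \<Omega> sub, of i \<theta>] sfL[of \<theta> i] by (auto simp: y_def d_def)
      have yd: "y \<le> d \<theta>" using y \<eta>(1) by (smt (verit) abs_ge_zero mult_nonneg_nonneg)
      have "f i \<theta> = y powr (p - 1) * y"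
        using y(1) by (cases "y = 0") (auto simp: f_def y_def[symmetric] powr_diff)
      also have "\<dots> \<le> d \<theta> powr (p - 1) * (d \<theta> - \<eta> * \<bar>\<theta> $ i\<bar>)"
        using y yd p by (intro mult_mono powr_mono2) auto
      finally show ?thesis .
    qed
    have "1 \<le> \<bar>\<theta> $ 1\<bar> + \<bar>\<theta> $ 2\<bar>" using norm_le_l1_cart[of \<theta>] n by (simp add: sum_2)
    hence "\<eta> * 1 \<le> \<eta> * (\<bar>\<theta> $ 1\<bar> + \<bar>\<theta> $ 2\<bar>)" using \<eta>(1) by (intro mult_left_mono) auto
    hence "d \<theta> powr (p - 1) * \<eta> \<le> d \<theta> powr (p - 1) * (\<eta> * (\<bar>\<theta> $ 1\<bar> + \<bar>\<theta> $ 2\<bar>))" by (intro mult_left_mono) auto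
    moreover have "\<eta> powr (p - 1) * \<eta> \<le> d \<theta> powr (p - 1) * \<eta>"
      using d\<eta> \<eta>(1) p by (intro mult_right_mono powr_mono2) auto
    moreover have "\<eta> powr (p - 1) * \<eta> = \<eta> powr p" "d \<theta> powr (p - 1) * d \<theta> = d \<theta> powr p"
      using \<eta>(1) d\<eta> by (auto simp: powr_diff)
    moreover have "\<bar>support_function \<Omega> \<theta> - support_function {x} \<theta>\<bar> powr p = d \<theta> powr p"
      using d\<eta> \<eta>(1) by (simp add: d_def sfx)
    ultimately show ?thesis using fi[of 1] fi[of 2] by (simp add: algebra_simps)
  qed
  interpret fm: finite_measure circle_measure by (rule finite_measure_circle_measure)
  have "2 * support_energy p \<Omega> {x} \<le> (\<integral>\<theta>. f 1 \<theta> + f 2 \<theta> \<partial>circle_measure)"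
    using J_le[of 1] J_le[of 2] int_f by simp
  also have "\<dots> \<le> (\<integral>\<theta>. 2 * \<bar>support_function \<Omega> \<theta> - support_function {x} \<theta>\<bar> powr p - \<eta> powr p \<partial>circle_measure)"
    using pt by (intro integral_mono) (auto simp: int_f int_d space_circle_measure)
  also have "\<dots> = 2 * support_energy p \<Omega> {x} - \<eta> powr p * (2 * pi)"
    using int_d by (simp add: support_energy_def space_circle_measure measure_circle_measure_space)
  finally have "\<eta> powr p * (2 * pi) \<le> 0" by simp
  moreover have "0 < \<eta> powr p * (2 * pi)" using \<eta>(1) by simp
  ultimately show False by linarith
qed

theorem theorem2:
  fixes \<Omega> \<omega> :: "(real^2) set" and p c :: real
  assumes "convex_body \<Omega>" and "interior \<Omega> \<noteq> {}"
    and "1 \<le> p"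
    and "0 \<le> c" and "c \<le> area \<Omega>"
    and "is_solution \<Omega> p c \<omega>"
  shows "union_of_polygonal_lines (frontier \<omega> - frontier \<Omega>)
    \<and> (convex_polygon \<Omega> \<longrightarrow> convex_polygon \<omega>)"
proof -
  have \<omega>: "convex_body \<omega>" "\<omega> \<subseteq> \<Omega>" "area \<omega> = c"
    using assms(6) by (auto simp: is_solution_def admissible_def)
  have closed: "closed \<omega>" "closed \<Omega>" using \<omega>(1) assms(1) by (auto simp: convex_body_def compact_imp_closed)
  have ne: "\<omega> \<noteq> {}" using \<omega>(1) by (simp add: convex_body_def)
  have free: "frontier \<omega> - frontier \<Omega> = frontier \<omega> \<inter> interior \<Omega>"
    using closed \<omega>(2) by (auto simp: frontier_def)
  have cf: "compact (frontier \<omega>)" using \<omega>(1) by (simp add: convex_body_def compact_frontier)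
  have int: "open (interior \<Omega>)" "interior \<Omega> \<noteq> UNIV"
  proof -
    have "bounded (interior \<Omega>)" using assms(1) interior_subset bounded_subset compact_imp_bounded
      unfolding convex_body_def by blast
    thus "interior \<Omega> \<noteq> UNIV" by auto
  qed simp
  have empty: "union_of_polygonal_lines {}"
    unfolding union_of_polygonal_lines_def by (intro exI[of _ "{}"]) (simp add: locally_finite_in_def)
  consider "c = 0" | "c = area \<Omega>" | "0 < c" "c < area \<Omega>" using assms(4,5) by linarith
  thus ?thesis
  proof cases
    case 1
    have "interior \<omega> = {}" using area_pos[OF \<omega>(1)] \<omega>(3) 1 by auto
    have "aff_dim \<omega> \<noteq> DIM(real^2)"
    proof
      assume "aff_dim \<omega> = DIM(real^2)"
      hence "rel_interior \<omega> = interior \<omega>" using aff_dim_eq_full rel_interior_interior by blast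
      thus False using \<open>interior \<omega> = {}\<close> rel_interior_eq_empty[of \<omega>] \<omega>(1) by (auto simp: convex_body_def)
    qed
    hence "aff_dim \<omega> \<le> 1" using aff_dim_le_DIM[of \<omega>] by simp
    hence "collinear \<omega>" by (simp add: collinear_aff_dim)
    then obtain a b where ab: "\<omega> = closed_segment a b"
      using compact_convex_collinear_segment[of \<omega>] \<omega>(1) ne by (auto simp: convex_body_def)
    have fr: "frontier \<omega> = closed_segment a b"
      using closed \<open>interior \<omega> = {}\<close> ab by (simp add: frontier_def)
    have "union_of_polygonal_lines (frontier \<omega> \<inter> interior \<Omega>)"
    proof (cases "a = b")
      case True
      \<comment> \<open>A single point is no union of nondegenerate segments, so it must lie on the
        frontier of \<open>\<Omega>\<close>, which leaves the free part empty.\<close>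
      hence "a \<notin> interior \<Omega>"
        using solution_not_interior_point[OF assms(1,3), of a] assms(6) ab 1 by simp
      hence "frontier \<omega> \<inter> interior \<Omega> = {}" using True fr by auto
      thus ?thesis using empty by simp
    next
      case False
      show ?thesis
      proof (rule union_of_polygonal_lines_if_local[OF cf int])
        fix x assume "x \<in> frontier \<omega> \<inter> interior \<Omega>"
        hence x: "x \<in> closed_segment a b" using fr by simp
        show "\<exists>\<delta>>0. \<exists>F. finite F \<and> (\<forall>(a, b)\<in>F. closed_segment a b \<subseteq> frontier \<omega>) \<and>
            frontier \<omega> \<inter> ball x \<delta> \<subseteq> (\<Union>(a, b)\<in>F. closed_segment a b)"
          by (intro exI[of _ 1] conjI exI[of _ "{(a, b)}"]) (auto simp: fr)
        show "x islimpt frontier \<omega>"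
          unfolding fr
        proof (rule connected_imp_perfect[OF _ x])
          fix y show "closed_segment a b \<noteq> {y}"
          proof
            assume eq: "closed_segment a b = {y}"
            have "a \<in> {y}" "b \<in> {y}" unfolding eq[symmetric] by (rule ends_in_segment)+
            thus False using \<open>a \<noteq> b\<close> by simp
          qed
        qed simp
      qed
    qed
    moreover have "polytope \<omega>" unfolding ab segment_convex_hull by (simp add: polytope_convex_hull)
    ultimately show ?thesis using ne by (simp add: free convex_polygon_def)
  next
    case 2
    hence "\<omega> = \<Omega>" using eq_if_area_eq[OF \<omega>(1) assms(1) \<omega>(2) assms(2)] \<omega>(3) by simp
    thus ?thesis using empty by simp
  next
    case 3
    have "interior \<omega> \<noteq> {}" using interior_nonempty_if_area_pos[OF \<omega>(1)] \<omega>(3) 3 by simp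
    hence "union_of_polygonal_lines (frontier \<omega> \<inter> interior \<Omega>)"
      using frontier_locally_polygonal[OF assms(1,3,6) 3] frontier_convex_body_islimpt[OF \<omega>(1)]
      by (intro union_of_polygonal_lines_if_local[OF cf int]) auto
    moreover have "convex_polygon \<Omega> \<longrightarrow> convex_polygon \<omega>"
      using solution_polytope[OF assms(1) _ assms(3,6) 3] ne by (simp add: convex_polygon_def)
    ultimately show ?thesis by (simp add: free)
  qed
qed

end
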